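(* Let $A$ be a unital separable C*-algebra, $G$ a second-countable compact group, and $\alpha\colon G\to\mathrm{Aut}(A)$ an action with the Rokhlin property. Then the inclusion $\iota\colon A^\alpha\to A$ induces an order-embedding $\mathrm{Cu}(\iota)\colon\mathrm{Cu}(A^\alpha)\to\mathrm{Cu}(A)$; that is, whenever $x,y\in\mathrm{Cu}(A^\alpha)$ satisfy $\mathrm{Cu}(\iota)(x)\le\mathrm{Cu}(\iota)(y)$, then $x\le y$.
   Context: For positive $a,b$ in a C*-algebra $D$, $a\precsim b$ (Cuntz subequivalence) if there are $x_n\in D$ with $\|x_n^*bx_n-a\|\to0$; $a\sim b$ if $a\precsim b$ and $b\precsim a$. $\mathrm{Cu}(D)$ is the set of $\sim$-classes of positive elements of $D\otimes\mathcal K$, with addition by direct sum and order $[a]\le[b]$ iff $a\precsim b$; a homomorphism $\varphi$ induces $\mathrm{Cu}(\varphi)([a])=[(\varphi\otimes\mathrm{id}_{\mathcal K})(a)]$. Rokhlin property: with $A_\infty=\ell^\infty(\mathbb N,A)/c_0(\mathbb N,A)$ (quotient map $\kappa_A$, $A$ as constant sequences), $\alpha^\infty$ coordinatewise, $\ell^\infty_\alpha(\mathbb N,A)$ the sequences $a$ with $g\mapsto\alpha^\infty_g(a)$ norm continuous, $A_{\infty,\alpha}=\kappa_A(\ell^\infty_\alpha(\mathbb N,A))$ with action $\alpha_\infty$, $\mathtt{Lt}_g(f)(h)=f(g^{-1}h)$: there is a unital homomorphism $\varphi\colon C(G)\to A_{\infty,\alpha}\cap A'$ with $\varphi\circ\mathtt{Lt}_g=(\alpha_\infty)_g\circ\varphi$.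 *)

theory Defs
  imports "HOL-Analysis.Analysis"
begin

class cstar_algebra = real_normed_algebra_1 + banach +
  fixes cscale :: "complex \<Rightarrow> 'a \<Rightarrow> 'a"
    and adj :: "'a \<Rightarrow> 'a"
  assumes cscale_add_right: "cscale c (x + y) = cscale c x + cscale c y"
    and cscale_add_left: "cscale (c + d) x = cscale c x + cscale d x"
    and cscale_cscale: "cscale c (cscale d x) = cscale (c * d) x"
    and cscale_of_real: "cscale (of_real r) x = scaleR r x"
    and cscale_mult_left: "cscale c x * y = cscale c (x * y)"
    and cscale_mult_right: "x * cscale c y = cscale c (x * y)"
    and norm_cscale: "norm (cscale c x) = cmod c * norm x"
    and adj_adj: "adj (adj x) = x"
    and adj_add: "adj (x + y) = adj x + adj y"
    and adj_cscale: "adj (cscale c x) = cscale (cnj c) (adj x)"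
    and adj_mult: "adj (x * y) = adj y * adj x"
    and cstar_identity: "norm (adj x * x) = norm x * norm x"

definition separable_type :: "'a::topological_space itself \<Rightarrow> bool" where
  "separable_type _ \<longleftrightarrow> (\<exists>D::'a set. countable D \<and> closure D = UNIV)"

definition cstar_aut :: "('a::cstar_algebra \<Rightarrow> 'a) \<Rightarrow> bool" where
  "cstar_aut h \<longleftrightarrow> bij h \<and> (\<forall>x y. h (x + y) = h x + h y)
     \<and> (\<forall>c x. h (cscale c x) = cscale c (h x))
     \<and> (\<forall>x y. h (x * y) = h x * h y) \<and> (\<forall>x. h (adj x) = adj (h x))"

text \<open>Compact (Hausdorff) topological group, written additively (group_add need not
  be commutative), and a point-norm continuous action by *-automorphisms.\<close>

definition compact_group :: "'g::{t2_space,group_add} itself \<Rightarrow> bool" where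
  "compact_group _ \<longleftrightarrow> compact (UNIV::'g set)
     \<and> continuous_on UNIV (\<lambda>p::'g \<times> 'g. fst p + snd p)
     \<and> continuous_on UNIV (\<lambda>x::'g. - x)"

definition cstar_action :: "('g::{topological_space,group_add} \<Rightarrow> 'a::cstar_algebra \<Rightarrow> 'a) \<Rightarrow> bool" where
  "cstar_action \<alpha> \<longleftrightarrow> (\<forall>g. cstar_aut (\<alpha> g)) \<and> \<alpha> 0 = id
     \<and> (\<forall>g h. \<alpha> (g + h) = \<alpha> g \<circ> \<alpha> h)
     \<and> (\<forall>a. continuous_on UNIV (\<lambda>g. \<alpha> g a))"

definition fixed_points :: "('g \<Rightarrow> 'a \<Rightarrow> 'a) \<Rightarrow> 'a set" where
  "fixed_points \<alpha> = {a. \<forall>g. \<alpha> g a = a}"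

text \<open>For a C*-subalgebra B of A, B \<otimes> K is realised as the set of infinite matrices
  with entries in B whose upper-left n x n truncations form a Cauchy sequence for the
  C*-norms of M_n(A).  The norm on M_n(A) is the operator norm on the Hilbert
  A-module A^n.\<close>

type_synonym 'a mat = "nat \<Rightarrow> nat \<Rightarrow> 'a"

definition trunc :: "nat \<Rightarrow> 'a::zero mat \<Rightarrow> 'a mat" where
  "trunc n x = (\<lambda>i j. if i < n \<and> j < n then x i j else 0)"

definition mnorm_n :: "nat \<Rightarrow> 'a::cstar_algebra mat \<Rightarrow> real" where
  "mnorm_n n x = Sup {sqrt (norm (\<Sum>i<n. adj (\<Sum>j<n. x i j * \<xi> j) * (\<Sum>j<n. x i j * \<xi> j)))
      | \<xi>. norm (\<Sum>j<n. adj (\<xi> j) * \<xi> j) \<le> 1}"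

definition mnorm :: "'a::cstar_algebra mat \<Rightarrow> real" where
  "mnorm x = (SUP n. mnorm_n n x)"

definition stab :: "'a::cstar_algebra set \<Rightarrow> 'a mat set" where
  "stab B = {x. (\<forall>i j. x i j \<in> B) \<and>
     (\<forall>e>0. \<exists>N. \<forall>m\<ge>N. \<forall>n\<ge>m. mnorm_n n (\<lambda>i j. x i j - trunc m x i j) < e)}"

definition mmult :: "'a::cstar_algebra mat \<Rightarrow> 'a mat \<Rightarrow> 'a mat" where
  "mmult x y = (\<lambda>i j. lim (\<lambda>n. \<Sum>k<n. x i k * y k j))"

definition madj :: "'a::cstar_algebra mat \<Rightarrow> 'a mat" where
  "madj x = (\<lambda>i j. adj (x j i))"

definition cu_pos :: "'a::cstar_algebra set \<Rightarrow> 'a mat set" where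
  "cu_pos B = {a. \<exists>c \<in> stab B. a = mmult (madj c) c}"

definition cuntz_le :: "'a::cstar_algebra set \<Rightarrow> 'a mat \<Rightarrow> 'a mat \<Rightarrow> bool" where
  "cuntz_le B a b \<longleftrightarrow> (\<exists>v. (\<forall>k. v k \<in> stab B) \<and>
     (\<lambda>k. mnorm (\<lambda>i j. mmult (mmult (madj (v k)) b) (v k) i j - a i j)) \<longlonglongrightarrow> 0)"

text \<open>A unital *-homomorphism C(G) \<rightarrow> A_{\<infinity>,\<alpha>} \<inter> A' is given by choosing, for every
  continuous f, a bounded representing sequence \<phi> f lying in ell-infinity-alpha(\<nat>,A); all
  algebraic identities hold modulo c_0.  Lt_g f = (\<lambda>h. f (-g + h)).\<close>

definition rokhlin :: "('g::{topological_space,group_add} \<Rightarrow> 'a::cstar_algebra \<Rightarrow> 'a) \<Rightarrow> bool" where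
  "rokhlin \<alpha> \<longleftrightarrow> (\<exists>\<phi> :: ('g \<Rightarrow> complex) \<Rightarrow> nat \<Rightarrow> 'a.
     (\<forall>f. continuous_on UNIV f \<longrightarrow>
        bounded (range (\<phi> f))
        \<and> (\<forall>g0. \<forall>e>0. eventually (\<lambda>g. \<forall>n. norm (\<alpha> g (\<phi> f n) - \<alpha> g0 (\<phi> f n)) \<le> e) (nhds g0))
        \<and> (\<forall>a. (\<lambda>n. \<phi> f n * a - a * \<phi> f n) \<longlonglongrightarrow> 0)
        \<and> (\<forall>g. (\<lambda>n. \<phi> (\<lambda>h. f (- g + h)) n - \<alpha> g (\<phi> f n)) \<longlonglongrightarrow> 0)
        \<and> (\<lambda>n. \<phi> (\<lambda>h. cnj (f h)) n - adj (\<phi> f n)) \<longlonglongrightarrow> 0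
        \<and> (\<forall>c. (\<lambda>n. \<phi> (\<lambda>h. c * f h) n - cscale c (\<phi> f n)) \<longlonglongrightarrow> 0))
     \<and> (\<forall>f f'. continuous_on UNIV f \<and> continuous_on UNIV f' \<longrightarrow>
        (\<lambda>n. \<phi> (\<lambda>h. f h + f' h) n - (\<phi> f n + \<phi> f' n)) \<longlonglongrightarrow> 0
        \<and> (\<lambda>n. \<phi> (\<lambda>h. f h * f' h) n - \<phi> f n * \<phi> f' n) \<longlonglongrightarrow> 0)
     \<and> (\<lambda>n. \<phi> (\<lambda>h. 1) n - 1) \<longlonglongrightarrow> 0)"

end

theory Submission
  imports Defs
begin

text \<open>Choose \<open>v\<close> over \<open>A\<close> with \<open>v\<^sup>* b v\<close> close to \<open>a\<close>; cutting down, all matrices are \<open>N \<times> N\<close>.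
  Take a fine partition of unity \<open>p\<^sub>g\<close> on \<open>G\<close> centred at finitely many \<open>g\<close> and let
  \<open>w\<^sub>n = \<Sum>\<^sub>g \<phi>(p\<^sub>g)\<^sub>n \<alpha>\<^sub>g(v)\<close>. Since \<open>\<phi>\<close> is asymptotically central and multiplicative, \<open>w\<^sub>n\<^sup>* b w\<^sub>n - a\<close> is
  asymptotically \<open>\<Sum> \<phi>(p\<^sub>s p\<^sub>t)\<^sub>n (\<alpha>\<^sub>s(v)\<^sup>* b \<alpha>\<^sub>t(v) - a)\<close>, where only terms with \<open>\<alpha>\<^sub>s(v)\<close> near \<open>\<alpha>\<^sub>t(v)\<close> matter;
  these are near \<open>\<alpha>\<^sub>s(v\<^sup>* b v - a)\<close>, and the sum is no larger than its largest coefficient. By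
  equivariance \<open>w\<^sub>n\<close> is almost invariant, and an almost invariant element lies near a fixed one:
  averaging over finite nets of \<open>G\<close> shrinks the orbit, so no Haar integral is required.
  The norm estimates rest on positivity in C*-algebras, obtained from the binomial series of the
  square root and Kaplansky's argument that \<open>x\<^sup>* x\<close> is positive.\<close>

section \<open>Positive elements\<close>

text \<open>\<open>\<phi>\<close> is given only through representing sequences, so its relations
  hold in the limit and are used for finitely many entries at a time. Hence the cut to
  \<open>N\<close> by \<open>N\<close> corners precedes every use of \<open>\<phi>\<close>: with
  \<open>N\<close> fixed, a factor \<open>N * N\<close> between entrywise and operator estimates is
  harmless. The number of pieces of the partition, in contrast, is not controlled as its mesh
  shrinks, so the triangle inequality is too weak for sums over it. It is replaced by the
  compression bound \<open>op_bound_block_sum\<close>, which has to add operator inequalities and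
  not merely norm inequalities. Matrices over \<open>A\<close> are no instance of
  \<open>cstar_algebra\<close>; positivity is developed in \<open>A\<close> alone, and matrices are
  estimated through their action on \<open>A^n\<close>. One more gap lies between almost invariance
  for each single \<open>g\<close>, which equivariance provides, and almost invariance uniformly in
  \<open>g\<close>, which averaging requires; equicontinuity of the sequences and compactness of the
  group close it.\<close>

lemma adj_0 [simp]: "adj (0::'a::cstar_algebra) = 0"
  using adj_add[of "0::'a" 0] by simp

lemma adj_minus [simp]: "adj (- x) = - adj (x::'a::cstar_algebra)"
  using adj_add[of x "- x"] by (simp add: eq_neg_iff_add_eq_0 add.commute)

lemma adj_diff: "adj (x - y) = adj x - adj (y::'a::cstar_algebra)"
  using adj_add[of x "- y"] by simp

lemma adj_1 [simp]: "adj (1::'a::cstar_algebra) = 1"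
  by (metis adj_adj adj_mult mult.left_neutral mult.right_neutral)

lemma adj_scaleR: "adj (r *\<^sub>R x) = r *\<^sub>R adj (x::'a::cstar_algebra)"
  by (metis adj_cscale complex_cnj_complex_of_real cscale_of_real)

lemma adj_sum: "adj (sum f S) = (\<Sum>i\<in>S. adj (f i :: 'a::cstar_algebra))"
  by (induction S rule: infinite_finite_induct) (auto simp: adj_add)

lemma adj_power: "adj (x ^ n) = adj (x::'a::cstar_algebra) ^ n"
  by (induction n) (auto simp: adj_mult power_commutes)

lemma norm_adj [simp]: "norm (adj x) = norm (x::'a::cstar_algebra)"
proof -
  have le: "norm y \<le> norm (adj y)" for y :: 'a
  proof (cases "y = 0")
    case False
    have "norm y * norm y \<le> norm (adj y) * norm y"
      using norm_mult_ineq[of "adj y" y] by (simp add: cstar_identity)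
    then show ?thesis using False by simp
  qed simp
  show ?thesis using le[of x] le[of "adj x"] by (simp add: adj_adj)
qed

lemma bounded_linear_adj: "bounded_linear (adj :: 'a::cstar_algebra \<Rightarrow> 'a)"
  by (rule bounded_linear_intro[where K=1]) (auto simp: adj_add adj_scaleR)

lemma tendsto_adj [tendsto_intros]:
  "(f \<longlongrightarrow> l) F \<Longrightarrow> ((\<lambda>x. adj (f x :: 'a::cstar_algebra)) \<longlongrightarrow> adj l) F"
  by (rule bounded_linear.tendsto[OF bounded_linear_adj])

lemma norm_self_adjoint_square:
  "adj k = k \<Longrightarrow> norm (k * k) = (norm (k::'a::cstar_algebra))\<^sup>2"
  using cstar_identity[of k] by (simp add: power2_eq_square)

section \<open>Binomial series for powers of \<open>1 - y\<close>, and square roots\<close>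

definition binom_pow :: "real \<Rightarrow> 'a::cstar_algebra \<Rightarrow> 'a" where
  "binom_pow a y = (\<Sum>n. (a gchoose n) *\<^sub>R (- y) ^ n)"

abbreviation binom_summable :: "real \<Rightarrow> 'a::cstar_algebra \<Rightarrow> bool" where
  "binom_summable a y \<equiv> summable (\<lambda>n. norm ((a gchoose n) *\<^sub>R (- y) ^ n))"

text \<open>From index 1 on, passing from \<open>n\<close> to \<open>n + 1\<close> multiplies by the
  negative factor \<open>(1/2 - n) / (n + 1)\<close>, so the signs alternate. A sum of absolute
  values thereby becomes an alternating sum.\<close>

lemma gbinomial_half_sign: "n \<ge> 1 \<Longrightarrow> \<bar>(1/2::real) gchoose n\<bar> = - ((-1) ^ n * ((1/2) gchoose n))"
proof (induction n rule: nat_induct_at_least)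
  case (Suc n)
  have "(1/2::real) gchoose Suc n = ((1/2) gchoose n) * ((1/2 - real n) / (real n + 1))"
    using gbinomial_mult_1[of "1/2::real" n] by (simp add: field_simps)
  moreover have "\<bar>(1/2 - real n) / (real n + 1)\<bar> = - ((1/2 - real n) / (real n + 1))"
    by (rule abs_of_nonpos) (use Suc in \<open>simp add: divide_le_0_iff\<close>)
  ultimately show ?case using Suc.IH by (simp only: abs_mult power_Suc) simp
qed simp

lemma gbinomial_minus_half_sign: "\<bar>(-1/2::real) gchoose n\<bar> = (-1) ^ n * ((-1/2) gchoose n)"
proof (induction n)
  case (Suc n)
  have "(-1/2::real) gchoose Suc n = ((-1/2) gchoose n) * ((-1/2 - real n) / (real n + 1))"
    using gbinomial_mult_1[of "-1/2::real" n] by (simp add: field_simps)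
  moreover have "\<bar>(-1/2 - real n) / (real n + 1)\<bar> = - ((-1/2 - real n) / (real n + 1))"
    by (rule abs_of_nonpos) (simp add: divide_le_0_iff)
  ultimately show ?case using Suc.IH by (simp only: abs_mult power_Suc)
qed simp

lemma gbinomial_minus_half_le_1: "\<bar>(-1/2::real) gchoose n\<bar> \<le> 1"
proof (induction n)
  case (Suc n)
  have "(-1/2::real) gchoose Suc n = ((-1/2) gchoose n) * ((-1/2 - real n) / (real n + 1))"
    using gbinomial_mult_1[of "-1/2::real" n] by (simp add: field_simps)
  moreover have "\<bar>(-1/2 - real n) / (real n + 1)\<bar> \<le> 1" by (simp add: abs_if field_simps)
  ultimately show ?case using Suc.IH by (simp only: abs_mult mult_le_one abs_ge_zero)
qed simp

text \<open>By the sign pattern the absolute sum is 1 minus the alternating partial sum that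
  includes index 0, and that partial sum equals the absolute value of
  \<open>(-1/2) gchoose n\<close>. The sharp constant 1 is what later makes the square root itself
  positive.\<close>

lemma sum_gbinomial_half_abs_le: "(\<Sum>k=1..n. \<bar>(1/2::real) gchoose k\<bar>) \<le> 1"
proof -
  have "(\<Sum>k\<le>n. ((1/2::real) gchoose k) * (-1) ^ k) = (-1) ^ n * ((1/2 - 1) gchoose n)"
    by (rule gbinomial_sum_lower_neg)
  also have "\<dots> = \<bar>(-1/2::real) gchoose n\<bar>" using gbinomial_minus_half_sign[of n] by simp
  finally have s: "(\<Sum>k\<le>n. ((1/2::real) gchoose k) * (-1) ^ k) \<ge> 0" by simp
  have "(\<Sum>k\<le>n. ((1/2::real) gchoose k) * (-1) ^ k) = 1 + (\<Sum>k=1..n. ((1/2::real) gchoose k) * (-1) ^ k)"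
    by (simp add: atMost_atLeast0 sum.atLeast_Suc_atMost)
  moreover have "(\<Sum>k=1..n. \<bar>(1/2::real) gchoose k\<bar>) = - (\<Sum>k=1..n. ((1/2::real) gchoose k) * (-1) ^ k)"
    unfolding sum_negf[symmetric] by (rule sum.cong) (auto simp: gbinomial_half_sign mult.commute)
  ultimately show ?thesis using s by simp
qed

text \<open>Absolute summability of the coefficients gives convergence on the closed ball; its
  boundary is where roots of non-invertible elements come from. The second bound says that the root
  again satisfies the norm criterion for positivity.\<close>

lemma binom_summable_half:
  assumes "norm (y::'a::cstar_algebra) \<le> 1"
  shows "binom_summable (1/2) y" and "norm (1 - binom_pow (1/2) y) \<le> 1"
proof -
  let ?f = "\<lambda>n. ((1/2) gchoose n) *\<^sub>R (- y) ^ n"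
  have b: "norm (?f n) \<le> \<bar>(1/2::real) gchoose n\<bar>" for n
  proof -
    have "norm ((- y) ^ n) \<le> 1"
      using norm_power_ineq[of "- y" n] power_le_one[of "norm y" n] assms by simp
    then show ?thesis by (simp add: mult_left_le)
  qed
  have sb: "(\<Sum>k<n. norm (?f (Suc k))) \<le> 1" for n
  proof -
    have "(\<Sum>k<n. norm (?f (Suc k))) \<le> (\<Sum>k<n. \<bar>(1/2::real) gchoose (Suc k)\<bar>)"
      by (rule sum_mono) (rule b)
    also have "\<dots> = (\<Sum>k=1..n. \<bar>(1/2::real) gchoose k\<bar>)"
      by (rule sum.reindex_bij_witness[of _ "\<lambda>k. k - 1" Suc]) auto
    finally show ?thesis using sum_gbinomial_half_abs_le[of n] by linarith
  qed
  have s': "summable (\<lambda>n. norm (?f (Suc n)))"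
    by (rule summableI_nonneg_bounded[of _ 1]) (use sb in auto)
  then show s: "binom_summable (1/2) y"
    by (subst (asm) summable_Suc_iff)
  have "binom_pow (1/2) y = (\<Sum>n. ?f (Suc n)) + ?f 0"
    unfolding binom_pow_def using suminf_split_head[OF summable_norm_cancel[OF s]] by simp
  then have "norm (1 - binom_pow (1/2) y) = norm (\<Sum>n. ?f (Suc n))" by simp
  also have "\<dots> \<le> (\<Sum>n. norm (?f (Suc n)))" by (rule summable_norm[OF s'])
  also have "\<dots> \<le> 1" by (rule suminf_le_const[OF s' sb])
  finally show "norm (1 - binom_pow (1/2) y) \<le> 1" .
qed

lemma binom_summable_minus_half:
  assumes "norm (y::'a::cstar_algebra) < 1"
  shows "binom_summable (-1/2) y"
proof (rule summable_comparison_test)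
  show "summable (\<lambda>n. norm y ^ n)" using assms by (simp add: summable_geometric)
  have "norm ((-1/2 gchoose n) *\<^sub>R (- y) ^ n) \<le> norm y ^ n" for n
    using mult_mono[OF gbinomial_minus_half_le_1[of n] norm_power_ineq[of "-y" n]] by simp
  then show "\<exists>N. \<forall>n\<ge>N. norm (norm ((-1/2 gchoose n) *\<^sub>R (- y) ^ n)) \<le> norm y ^ n" by auto
qed

text \<open>The Vandermonde identity collapses each degree of the Cauchy product. This exponent law
  gives square roots from \<open>1/2 + 1/2\<close> and their inverses from
  \<open>-1/2 + 1/2\<close>.\<close>

lemma binom_pow_mult:
  assumes "binom_summable a (y::'a::cstar_algebra)" "binom_summable b y"
  shows "binom_pow a y * binom_pow b y = binom_pow (a + b) y"
proof -
  have "(\<Sum>i\<le>k. ((a gchoose i) *\<^sub>R (- y) ^ i) * ((b gchoose (k - i)) *\<^sub>R (- y) ^ (k - i)))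
      = ((a + b) gchoose k) *\<^sub>R (- y) ^ k" for k
  proof -
    have "(\<Sum>i\<le>k. ((a gchoose i) *\<^sub>R (- y) ^ i) * ((b gchoose (k - i)) *\<^sub>R (- y) ^ (k - i)))
        = (\<Sum>i\<le>k. ((a gchoose i) * (b gchoose (k - i))) *\<^sub>R (- y) ^ k)"
    proof (rule sum.cong)
      fix i assume "i \<in> {..k}"
      then have "(- y) ^ i * (- y) ^ (k - i) = (- y) ^ k"
        by (simp add: power_add[symmetric])
      then show "((a gchoose i) *\<^sub>R (- y) ^ i) * ((b gchoose (k - i)) *\<^sub>R (- y) ^ (k - i))
          = ((a gchoose i) * (b gchoose (k - i))) *\<^sub>R (- y) ^ k"
        by (simp add: mult.commute)
    qed simp
    also have "\<dots> = ((a + b) gchoose k) *\<^sub>R (- y) ^ k"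
      by (simp add: scaleR_sum_left[symmetric] gbinomial_Vandermonde atMost_atLeast0)
    finally show ?thesis .
  qed
  then show ?thesis
    unfolding binom_pow_def using Cauchy_product[OF assms] by simp
qed

lemma binom_pow_0: "binom_pow 0 (y::'a::cstar_algebra) = 1"
proof -
  have "(\<lambda>n. ((0::real) gchoose n) *\<^sub>R (- y) ^ n) = (\<lambda>n. if n = 0 then 1 else 0)"
  proof
    fix n
    have "of_nat (0 choose n) = (0::real) gchoose n" using binomial_gbinomial[of 0 n] by simp
    then show "((0::real) gchoose n) *\<^sub>R (- y) ^ n = (if n = 0 then 1 else 0)"
      by (cases n) auto
  qed
  then show ?thesis unfolding binom_pow_def
    using suminf_finite[of "{0}" "\<lambda>n. if n = 0 then (1::'a) else 0"] by simp
qed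

lemma binom_pow_1: "binom_pow 1 (y::'a::cstar_algebra) = 1 - y"
proof -
  have "((1::real) gchoose n) *\<^sub>R (- y) ^ n = 0" if "n \<notin> {0,1}" for n
  proof -
    have "of_nat (1 choose n) = (1::real) gchoose n" using binomial_gbinomial[of 1 n] by simp
    moreover have "1 choose n = 0" using that by (intro binomial_eq_0) auto
    ultimately have "(1::real) gchoose n = 0" by (metis of_nat_0)
    then show ?thesis by simp
  qed
  then have "binom_pow 1 y = (\<Sum>n\<in>{0,1}. ((1::real) gchoose n) *\<^sub>R (- y) ^ n)"
    unfolding binom_pow_def by (intro suminf_finite) auto
  then show ?thesis by simp
qed

lemma adj_binom_pow:
  assumes "binom_summable a (y::'a::cstar_algebra)" "adj y = y"
  shows "adj (binom_pow a y) = binom_pow a y"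
  unfolding binom_pow_def
  by (subst bounded_linear.suminf[OF bounded_linear_adj summable_norm_cancel[OF assms(1)]])
     (simp add: adj_scaleR adj_power assms(2))

text \<open>Commutation passes from the powers to the series. It stands in for functional calculus
  whenever two roots have to commute.\<close>

lemma binom_pow_commute:
  assumes "binom_summable a (y::'a::cstar_algebra)" "z * y = y * z"
  shows "z * binom_pow a y = binom_pow a y * z"
proof -
  have s: "summable (\<lambda>n. (a gchoose n) *\<^sub>R (- y) ^ n)" by (rule summable_norm_cancel[OF assms(1)])
  have "z * (- y) ^ n = (- y) ^ n * z" for n
    by (rule power_commuting_commutes[symmetric]) (simp add: assms(2))
  then show ?thesis unfolding binom_pow_def suminf_mult[OF s, symmetric] suminf_mult2[OF s] by simp
qed

text \<open>Squares of self-adjoint elements replace the spectral notion of positivity. The working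
  form is the criterion \<open>norm (t *\<^sub>R 1 - x) \<le> t\<close>, tied to this definition by
  \<open>psd_of_norm\<close> and \<open>psd_norm\<close>.\<close>

definition psd :: "'a::cstar_algebra \<Rightarrow> bool" where
  "psd x \<longleftrightarrow> (\<exists>k. adj k = k \<and> x = k * k)"

text \<open>The hypothesis puts \<open>y = 1 - x / t\<close> into the closed unit ball, and
  \<open>sqrt t\<close> times the root of \<open>1 - y\<close> is a root of \<open>x\<close>. The
  estimate for \<open>sqrt t *\<^sub>R 1 - k\<close> is recorded so that \<open>k\<close> meets the
  same criterion and is positive in turn.\<close>

lemma sqrt_exists:
  assumes x: "adj x = x" and t: "norm (t *\<^sub>R 1 - x) \<le> (t::real)"
  obtains k :: "'a::cstar_algebra" where "adj k = k" "k * k = x"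
    "norm (sqrt t *\<^sub>R 1 - k) \<le> sqrt t" "\<And>z. z * x = x * z \<Longrightarrow> z * k = k * z"
proof (cases "t = 0")
  case True
  then have "x = 0" using t by simp
  then show ?thesis using True that[of 0] by simp
next
  case False
  have "t \<ge> 0" using t norm_ge_zero order_trans by blast
  then have tp: "t > 0" using False by simp
  define y where "y = 1 - inverse t *\<^sub>R x"
  have "y = inverse t *\<^sub>R (t *\<^sub>R 1 - x)"
    unfolding y_def using tp by (simp add: scaleR_right_diff_distrib)
  then have y1: "norm y \<le> 1" using t tp by (simp add: divide_le_eq_1 inverse_eq_divide)
  have ya: "adj y = y" by (simp add: y_def adj_diff adj_scaleR x)
  note s = binom_summable_half(1)[OF y1]
  define k where "k = sqrt t *\<^sub>R binom_pow (1/2) y"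
  have "k * k = t *\<^sub>R (1 - y)"
    unfolding k_def using binom_pow_mult[OF s s] tp by (simp add: binom_pow_1)
  then have "k * k = x" unfolding y_def using tp by simp
  moreover have "adj k = k" unfolding k_def by (simp add: adj_scaleR adj_binom_pow[OF s ya])
  moreover have "sqrt t *\<^sub>R 1 - k = sqrt t *\<^sub>R (1 - binom_pow (1/2) y)"
    by (simp add: k_def scaleR_right_diff_distrib)
  then have "norm (sqrt t *\<^sub>R 1 - k) \<le> sqrt t"
    using binom_summable_half(2)[OF y1] tp by (simp add: mult_left_le)
  moreover have "z * k = k * z" if "z * x = x * z" for z
  proof -
    have "z * y = y * z" unfolding y_def using that by (simp add: algebra_simps)
    then show ?thesis unfolding k_def using binom_pow_commute[OF s] by simp
  qed
  ultimately show ?thesis using that by blast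
qed

abbreviation imag :: "'a::cstar_algebra \<Rightarrow> 'a" where "imag x \<equiv> cscale \<i> x"

lemma cscale_minus_one: "cscale (- 1) x = - (x::'a::cstar_algebra)"
  using cscale_of_real[of "-1" x] by simp

lemma cscale_minus_left: "cscale (- c) x = - cscale c (x::'a::cstar_algebra)"
  by (metis cscale_cscale cscale_minus_one mult_minus1)

lemma cscale_zero_left [simp]: "cscale 0 x = (0::'a::cstar_algebra)"
  using cscale_of_real[of 0 x] by simp

lemma cscale_minus_right: "cscale c (- x) = - cscale c (x::'a::cstar_algebra)"
  by (metis cscale_cscale cscale_minus_left cscale_minus_one mult.commute mult_minus1)

lemma cscale_diff_right: "cscale c (x - y) = cscale c x - cscale c (y::'a::cstar_algebra)"
  by (metis add_uminus_conv_diff cscale_add_right cscale_minus_right)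

lemma imag_imag: "imag (imag x) = - (x::'a::cstar_algebra)"
  by (simp add: cscale_cscale cscale_minus_one)

lemma adj_imag: "adj (imag x) = - imag (adj (x::'a::cstar_algebra))"
  by (simp add: adj_cscale cscale_minus_left)

text \<open>For \<open>u = k + imag m\<close> the mixed terms of \<open>adj u * u\<close> cancel by
  commutation, so \<open>norm u\<close> is \<open>sqrt t\<close>; and \<open>k\<close> is the real
  part of \<open>u\<close>, hence no larger in norm.\<close>

lemma norm_le_of_squares:
  assumes k: "adj k = k" and m: "adj m = m" and c: "k * m = m * (k::'a::cstar_algebra)"
    and e: "k * k + m * m = t *\<^sub>R 1" and t: "t \<ge> 0"
  shows "(norm k)\<^sup>2 \<le> t"
proof -
  define u where "u = k + imag m"
  have au: "adj u = k - imag m" by (simp add: u_def adj_add adj_imag k m)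
  have "adj u * u = k * k + m * m"
    unfolding au unfolding u_def
    by (simp add: algebra_simps cscale_mult_left cscale_mult_right cscale_diff_right c imag_imag)
  then have "(norm u)\<^sup>2 = norm (t *\<^sub>R (1::'a))" using e cstar_identity[of u] by (simp add: power2_eq_square)
  then have nu: "(norm u)\<^sup>2 = \<bar>t\<bar>" by simp
  have "2 *\<^sub>R k = u + adj u" by (simp add: au) (simp add: u_def scaleR_2)
  then have "2 * norm k \<le> norm u + norm u"
    by (metis norm_adj norm_scaleR norm_triangle_ineq abs_numeral)
  then have "(norm k)\<^sup>2 \<le> (norm u)\<^sup>2" by (simp add: power_mono)
  then show ?thesis using nu t by simp
qed

section \<open>The order on self-adjoint elements\<close>

lemma psd_self_adjoint: "psd x \<Longrightarrow> adj x = (x::'a::cstar_algebra)"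
  by (auto simp: psd_def adj_mult)

lemma psd_of_norm: "adj x = x \<Longrightarrow> norm (t *\<^sub>R 1 - x) \<le> t \<Longrightarrow> psd (x::'a::cstar_algebra)"
  by (metis sqrt_exists psd_def)

text \<open>Both \<open>x\<close> and \<open>t - x\<close> have roots, the latter because its
  distance to the scalar \<open>t\<close> is \<open>norm x\<close>. The roots commute and their
  squares add up to \<open>t\<close>, so \<open>norm_le_of_squares\<close> bounds the root of
  \<open>t - x\<close>.\<close>

lemma psd_norm:
  assumes "psd x" "norm (x::'a::cstar_algebra) \<le> t"
  shows "norm (t *\<^sub>R 1 - x) \<le> t"
proof -
  obtain k where k: "adj k = k" "x = k * k" using assms(1) by (auto simp: psd_def)
  have t: "t \<ge> 0" using assms(2) norm_ge_zero order_trans by blast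
  have "adj (t *\<^sub>R 1 - x) = t *\<^sub>R 1 - x" by (simp add: adj_diff adj_scaleR psd_self_adjoint assms)
  moreover have "norm (t *\<^sub>R 1 - (t *\<^sub>R 1 - x)) \<le> t" using assms by simp
  ultimately obtain m where m: "adj m = m" "m * m = t *\<^sub>R 1 - x"
      "\<And>z. z * (t *\<^sub>R 1 - x) = (t *\<^sub>R 1 - x) * z \<Longrightarrow> z * m = m * z"
    using sqrt_exists by metis
  have "k * m = m * k" by (rule m(3)) (simp add: k algebra_simps)
  then have "(norm m)\<^sup>2 \<le> t"
    by (intro norm_le_of_squares[OF m(1) k(1)]) (use m(2) k(2) t in auto)
  then show ?thesis using m by (metis norm_self_adjoint_square)
qed

lemma psd_root:
  assumes "psd (x::'a::cstar_algebra)"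
  obtains k where "psd k" "adj k = k" "k * k = x" "\<And>z. z * x = x * z \<Longrightarrow> z * k = k * z"
proof -
  obtain k where "adj k = k" "k * k = x"
    "norm (sqrt (norm x) *\<^sub>R 1 - k) \<le> sqrt (norm x)" "\<And>z. z * x = x * z \<Longrightarrow> z * k = k * z"
    using sqrt_exists[OF psd_self_adjoint[OF assms] psd_norm[OF assms order_refl]] by metis
  then show ?thesis using that psd_of_norm by blast
qed

text \<open>It is not visible that a sum of two squares is a square; the norm criterion with
  \<open>t = norm x + norm y\<close> turns the claim into the triangle inequality.\<close>

lemma psd_add: 
  assumes "psd x" "psd (y::'a::cstar_algebra)" shows "psd (x + y)"
proof (rule psd_of_norm[of _ "norm x + norm y"])
  show "adj (x + y) = x + y" using assms by (simp add: adj_add psd_self_adjoint)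
  have "(norm x + norm y) *\<^sub>R 1 - (x + y) = (norm x *\<^sub>R 1 - x) + (norm y *\<^sub>R 1 - y)"
    by (simp add: algebra_simps)
  then show "norm ((norm x + norm y) *\<^sub>R 1 - (x + y)) \<le> norm x + norm y"
    using norm_triangle_mono[OF psd_norm[OF assms(1) order_refl] psd_norm[OF assms(2) order_refl]]
    by (simp only:)
qed

lemma psd_square: "adj k = k \<Longrightarrow> psd (k * (k::'a::cstar_algebra))"
  by (auto simp: psd_def)

lemma psd_0 [simp]: "psd (0::'a::cstar_algebra)"
  using psd_square[of "0::'a"] by simp

lemma psd_scaleR:
  assumes "psd x" "c \<ge> 0" shows "psd (c *\<^sub>R (x::'a::cstar_algebra))"
proof -
  obtain k where "adj k = k" "x = k * k" using assms(1) by (auto simp: psd_def)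
  then have "c *\<^sub>R x = (sqrt c *\<^sub>R k) * (sqrt c *\<^sub>R k)" using assms(2) by simp
  then show ?thesis using psd_square[of "sqrt c *\<^sub>R k"] \<open>adj k = k\<close> by (simp add: adj_scaleR)
qed

lemma psd_sum: "(\<And>i. i \<in> S \<Longrightarrow> psd (f i :: 'a::cstar_algebra)) \<Longrightarrow> psd (sum f S)"
  by (induction S rule: infinite_finite_induct) (auto intro: psd_add)

lemma psd_scalar: "c \<ge> 0 \<Longrightarrow> psd (c *\<^sub>R (1::'a::cstar_algebra))"
  using psd_scaleR[of 1 c] psd_square[of "1::'a"] by simp

text \<open>The norm criterion with \<open>t = norm x\<close> is a closed condition, so the roots of
  the terms need not be followed to the limit.\<close>

lemma psd_limit:
  assumes "\<And>n. psd (f n :: 'a::cstar_algebra)" "f \<longlonglongrightarrow> x"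
  shows "psd x"
proof -
  have "(\<lambda>n. adj (f n)) \<longlonglongrightarrow> adj x" by (intro tendsto_intros assms)
  then have "adj x = x" using assms LIMSEQ_unique by (simp add: psd_self_adjoint)
  moreover have "norm (norm x *\<^sub>R 1 - x) \<le> norm x"
  proof (rule LIMSEQ_le)
    show "(\<lambda>n. norm (norm (f n) *\<^sub>R 1 - f n)) \<longlonglongrightarrow> norm (norm x *\<^sub>R 1 - x)"
      by (intro tendsto_intros assms)
    show "(\<lambda>n. norm (f n)) \<longlonglongrightarrow> norm x" by (intro tendsto_intros assms)
    show "\<exists>N. \<forall>n\<ge>N. norm (norm (f n) *\<^sub>R 1 - f n) \<le> norm (f n)" using assms psd_norm by blast
  qed
  ultimately show ?thesis by (rule psd_of_norm)
qed

lemma psd_norm_diff: "adj x = x \<Longrightarrow> norm x \<le> t \<Longrightarrow> psd (t *\<^sub>R 1 - (x::'a::cstar_algebra))"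
  by (rule psd_of_norm[of _ t]) (auto simp: adj_diff adj_scaleR)

lemma psd_le_scalar_norm:
  assumes "psd p" "psd (t *\<^sub>R 1 - (p::'a::cstar_algebra))" "t \<ge> 0"
  shows "norm p \<le> t"
proof -
  obtain k where k: "adj k = k" "k * k = p" "\<And>z. z * p = p * z \<Longrightarrow> z * k = k * z"
    using psd_root[OF assms(1)] by metis
  obtain m where m: "adj m = m" "m * m = t *\<^sub>R 1 - p"
      "\<And>z. z * (t *\<^sub>R 1 - p) = (t *\<^sub>R 1 - p) * z \<Longrightarrow> z * m = m * z"
    using psd_root[OF assms(2)] by metis
  have "k * m = m * k" by (rule m(3)) (simp add: k(2)[symmetric] algebra_simps)
  then have "(norm k)\<^sup>2 \<le> t"
    by (intro norm_le_of_squares[OF k(1) m(1)]) (use m(2) k(2) assms(3) in auto)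
  then show ?thesis using k by (metis norm_self_adjoint_square)
qed

text \<open>\<open>q\<close> lies below the scalar \<open>norm q\<close>, hence so does
  \<open>p\<close>, and a positive element below a scalar has norm at most that scalar. This is how
  later estimates turn an operator inequality into a norm bound.\<close>

lemma psd_norm_mono:
  assumes "psd p" "psd (q - (p::'a::cstar_algebra))"
  shows "norm p \<le> norm q"
proof (rule psd_le_scalar_norm[OF assms(1)])
  have "psd q" using psd_add[OF assms] by simp
  then have "psd (norm q *\<^sub>R 1 - q)" by (intro psd_norm_diff psd_self_adjoint) auto
  from psd_add[OF this assms(2)] show "psd (norm q *\<^sub>R 1 - p)" by simp
qed simp

text \<open>Commutation is inherited in two stages: \<open>q\<close> commutes with the root
  \<open>k\<close> of \<open>p\<close>, and then \<open>k\<close> with the root \<open>m\<close> of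
  \<open>q\<close>. So \<open>k * m\<close> is self-adjoint and squares to
  \<open>p * q\<close>.\<close>

lemma psd_mult_commute:
  assumes "psd p" "psd (q::'a::cstar_algebra)" "p * q = q * p"
  shows "psd (p * q)"
proof -
  obtain k where k: "adj k = k" "k * k = p" "\<And>z. z * p = p * z \<Longrightarrow> z * k = k * z"
    using psd_root[OF assms(1)] by metis
  obtain m where m: "adj m = m" "m * m = q" "\<And>z. z * q = q * z \<Longrightarrow> z * m = m * z"
    using psd_root[OF assms(2)] by metis
  have "q * k = k * q" using k(3)[of q] assms(3) by simp
  then have km: "k * m = m * k" using m(3)[of k] by simp
  have "(k * m) * (k * m) = k * (m * k) * m" by (simp add: mult.assoc)
  also have "\<dots> = (k * k) * (m * m)" by (simp add: km[symmetric] mult.assoc)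
  finally have "p * q = (k * m) * (k * m)" using k(2) m(2) by simp
  moreover have "adj (k * m) = k * m" using k(1) m(1) km by (simp add: adj_mult)
  ultimately show ?thesis using psd_square by metis
qed

section \<open>Positivity of \<open>adj x * x\<close>\<close>

lemma self_adjoint_cube_eq_0:
  assumes "adj x = x" "x * x * x = (0::'a::cstar_algebra)"
  shows "x = 0"
proof -
  have "(x * x) * (x * x) = 0" using assms(2) by (simp add: mult.assoc[symmetric])
  then have "norm (x * x) = 0"
    using norm_self_adjoint_square[of "x * x"] assms(1) by (simp add: adj_mult)
  then show ?thesis using norm_self_adjoint_square[OF assms(1)] by simp
qed

text \<open>The powers of \<open>1 + m\<close> dominate 1, so a Bernoulli-type induction shows that
  \<open>(1 + m) ^ n * m\<close> dominates \<open>n\<close> times \<open>m * m\<close>; boundedness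
  in \<open>n\<close> then kills \<open>m * m\<close>. In \<open>adj_mult_self_neg\<close> this
  takes the place of a comparison of spectra.\<close>

lemma psd_unbounded_growth:
  assumes m: "psd (m::'a::cstar_algebra)" and b: "\<And>n. norm ((1 + m) ^ n * m) \<le> C"
  shows "m = 0"
proof -
  have c: "(1 + m) ^ n * m = m * (1 + m) ^ n" for n
    by (rule power_commuting_commutes) (simp add: algebra_simps)
  have one: "psd (1::'a)" using psd_scalar[of 1] by simp
  have p: "psd ((1 + m) ^ n)" for n
  proof (induction n)
    case (Suc n)
    have "psd ((1 + m) * (1 + m) ^ n)"
      by (rule psd_mult_commute[OF psd_add[OF one m] Suc]) (simp add: power_commutes)
    then show ?case by simp
  qed (simp add: one)
  have q: "psd ((1 + m) ^ n - 1)" for n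
  proof (induction n)
    case (Suc n)
    have "psd (((1 + m) ^ n - 1) + (1 + m) ^ n * m)"
      by (rule psd_add[OF Suc psd_mult_commute[OF p m c]])
    also have "((1 + m) ^ n - 1) + (1 + m) ^ n * m = (1 + m) ^ Suc n - 1"
      by (simp add: c algebra_simps)
    finally show ?case .
  qed simp
  have mm: "psd (m * m)" by (rule psd_square[OF psd_self_adjoint[OF m]])
  have r: "psd ((1 + m) ^ n * m - real n *\<^sub>R (m * m))" for n
  proof (induction n)
    case (Suc n)
    have "psd (((1 + m) ^ n - 1) * (m * m))"
    proof (rule psd_mult_commute[OF q mm])
      show "((1 + m) ^ n - 1) * (m * m) = m * m * ((1 + m) ^ n - 1)"
        unfolding left_diff_distrib right_diff_distrib by (metis c mult.assoc mult.left_neutral mult.right_neutral)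
    qed
    from psd_add[OF Suc this]
    have "psd ((1 + m) ^ n * m - real n *\<^sub>R (m * m) + ((1 + m) ^ n - 1) * (m * m))" .
    also have "(1 + m) ^ n * m - real n *\<^sub>R (m * m) + ((1 + m) ^ n - 1) * (m * m) =
        (1 + m) ^ Suc n * m - real (Suc n) *\<^sub>R (m * m)"
    proof -
      have "m * (1 + m) ^ n * m = (1 + m) ^ n * (m * m)" by (simp add: c[symmetric] mult.assoc)
      then show ?thesis by (simp add: algebra_simps)
    qed
    finally show ?case .
  qed (simp add: m)
  have "real n * norm (m * m) \<le> C" for n
  proof -
    have "norm (real n *\<^sub>R (m * m)) \<le> norm ((1 + m) ^ n * m)"
      by (rule psd_norm_mono[OF psd_scaleR[OF mm] r]) simp
    then show ?thesis using b[of n] by simp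
  qed
  then have "norm (m * m) = 0"
    using ex_less_of_nat_mult[of "norm (m * m)" C] by (metis norm_ge_zero not_less order_le_less)
  then show ?thesis using norm_self_adjoint_square[OF psd_self_adjoint[OF m]] by simp
qed

text \<open>The sum of \<open>adj y * y\<close> and \<open>y * adj y\<close> is a sum of squares, so
  if the negative of the first is positive, the second is positive as well. Then the powers of
  \<open>q\<close> are bounded, the relation \<open>e\<close> transfers this to the powers of
  \<open>1 + m\<close>, and the growth of the latter forces \<open>m = 0\<close>.\<close>

lemma adj_mult_self_neg:
  assumes "psd (- (adj y * (y::'a::cstar_algebra)))"
  shows "y = 0"
proof (rule ccontr)
  assume "y \<noteq> 0"
  define t where "t = (norm y)\<^sup>2"
  have t: "t > 0" using \<open>y \<noteq> 0\<close> by (simp add: t_def)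
  have nyy: "norm (y * adj y) = t" using cstar_identity[of "adj y"] by (simp add: adj_adj t_def power2_eq_square)
  \<comment> \<open>Up to sign these are twice the real and the imaginary part of
    \<open>y\<close>.\<close>
  define r s where "r = y + adj y" and "s = imag (y - adj y)"
  have "adj r = r" by (simp add: r_def adj_add adj_adj add.commute)
  have "adj s = s" by (simp add: s_def adj_imag adj_diff adj_adj cscale_minus_right[symmetric])
  have "r * r + s * s = 2 *\<^sub>R (y * adj y + adj y * y)"
    by (simp add: r_def s_def algebra_simps cscale_mult_left cscale_mult_right cscale_diff_right cscale_add_right imag_imag scaleR_2)
  then have "2 *\<^sub>R (y * adj y) = (r * r + s * s) + 2 *\<^sub>R (- (adj y * y))"
    by (simp add: algebra_simps)
  moreover have "psd \<dots>"
    using psd_square[OF \<open>adj r = r\<close>] psd_square[OF \<open>adj s = s\<close>] assms by (intro psd_add psd_scaleR) auto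
  ultimately have "psd (2 *\<^sub>R (y * adj y))" by metis
  then have "psd ((1/2) *\<^sub>R (2 *\<^sub>R (y * adj y)))" by (rule psd_scaleR) simp
  then have "psd (y * adj y)" unfolding scaleR_scaleR by simp
  then have q1: "norm (t *\<^sub>R 1 - y * adj y) \<le> t" by (rule psd_norm) (simp add: nyy)
  define q where "q = 1 - inverse t *\<^sub>R (y * adj y)"
  have "q = inverse t *\<^sub>R (t *\<^sub>R 1 - y * adj y)" using t by (simp add: q_def scaleR_right_diff_distrib)
  then have q: "norm q \<le> 1" using q1 t by (simp add: divide_le_eq_1 inverse_eq_divide)
  define m where "m = inverse t *\<^sub>R (- (adj y * y))"
  have m: "psd m" unfolding m_def by (rule psd_scaleR[OF assms]) (use t in simp)
  \<comment> \<open>Moving \<open>adj y\<close> across exchanges \<open>y * adj y\<close> for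
    \<open>adj y * y\<close>, an algebraic substitute for the two products having the same nonzero
    spectrum.\<close>
  have e: "adj y * q ^ n = (1 + m) ^ n * adj y" for n
  proof (induction n)
    case (Suc n)
    have "adj y * q = (1 + m) * adj y" by (simp add: q_def m_def algebra_simps)
    then show ?case using Suc by (metis mult.assoc power_Suc power_commutes)
  qed simp
  have "norm ((1 + m) ^ n * m) \<le> 1" for n
  proof -
    have "(1 + m) ^ n * m = - (inverse t *\<^sub>R (adj y * q ^ n * y))"
      unfolding e by (subst (2) m_def) (simp add: mult.assoc)
    then have "norm ((1 + m) ^ n * m) = inverse t * norm (adj y * q ^ n * y)" using t by simp
    also have "norm (adj y * q ^ n * y) \<le> norm (adj y) * norm (q ^ n) * norm y"
      by (meson norm_mult_ineq mult_right_mono norm_ge_zero order_trans)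
    also have "\<dots> \<le> norm (adj y) * 1 * norm y"
      using norm_power_ineq[of q n] power_le_one[of "norm q" n] q
      by (intro mult_right_mono mult_left_mono) auto
    also have "\<dots> = t" by (simp add: t_def power2_eq_square)
    finally show ?thesis using t by (simp add: field_simps)
  qed
  then have "m = 0" by (rule psd_unbounded_growth[OF m])
  then have "adj y * y = 0" using t by (simp add: m_def)
  then show False using cstar_identity[of y] \<open>y \<noteq> 0\<close> by simp
qed

text \<open>For self-adjoint h with absolute value p, the element n = p - h (twice the negative part)
  satisfies n h n = - n p n, so x n has a negative square and vanishes.\<close>
lemma psd_adj_mult: "psd (adj x * (x::'a::cstar_algebra))"
proof -
  define h where "h = adj x * x"
  have h: "adj h = h" by (simp add: h_def adj_mult adj_adj)
  obtain p where p: "psd p" "adj p = p" "p * p = h * h" "\<And>z. z * (h * h) = h * h * z \<Longrightarrow> z * p = p * z"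
    using psd_root[OF psd_square[OF h]] by metis
  have c: "h * p = p * h" by (rule p(4)) (simp add: mult.assoc)
  define n where "n = p - h"
  have n: "adj n = n" by (simp add: n_def adj_diff h p)
  have hn: "h * n = - (p * n)" by (simp add: n_def algebra_simps p(3) c)
  have pn: "p * n = n * p" by (simp add: n_def algebra_simps c)
  have nn: "n * n = 2 *\<^sub>R (p * n)" by (simp add: n_def algebra_simps p(3) c scaleR_2)
  have e: "adj (x * n) * (x * n) = - (p * (n * n))"
  proof -
    have "adj (x * n) * (x * n) = n * (h * n)" by (simp add: adj_mult n h_def mult.assoc)
    also have "\<dots> = - (n * p * n)" by (simp add: hn mult.assoc)
    finally show ?thesis by (simp add: pn[symmetric] mult.assoc)
  qed
  have pnn: "p * (n * n) = n * n * p" by (metis pn mult.assoc)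
  have "psd (- (adj (x * n) * (x * n)))"
    using psd_mult_commute[OF p(1) psd_square[OF n] pnn] by (simp add: e)
  then have "x * n = 0" by (rule adj_mult_self_neg)
  then have "p * (n * n) = 0" using e by simp
  then have "n * n * n = 0" by (simp add: nn mult.assoc)
  then have "n = 0" by (rule self_adjoint_cube_eq_0[OF n])
  then have "h = p" by (simp add: n_def)
  then show ?thesis using p(1) h_def by simp
qed

lemma psd_conj:
  assumes "psd (p::'a::cstar_algebra)" shows "psd (adj z * p * z)"
proof -
  obtain k where "adj k = k" "p = k * k" using assms by (auto simp: psd_def)
  then have "adj z * p * z = adj (k * z) * (k * z)" by (simp add: adj_mult mult.assoc)
  then show ?thesis using psd_adj_mult by metis
qed

lemma psd_conj_le_norm:
  assumes "adj p = (p::'a::cstar_algebra)" "norm p \<le> c"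
  shows "psd (c *\<^sub>R (adj z * z) - adj z * p * z)"
  using psd_conj[OF psd_norm_diff[OF assms], of z] by (simp add: algebra_simps)

text \<open>The shift by \<open>d\<close> provides invertibility: with \<open>t = norm p + d\<close>
  the argument of the series has norm at most \<open>norm p / t\<close>, which is below 1, and there
  the series for both exponents converge.\<close>

lemma inverse_sqrt_exists:
  assumes p: "psd (p::'a::cstar_algebra)" and d: "d > 0"
  obtains r s where "adj r = r" "adj s = s" "r * s = 1" "s * r = 1" "s * s = p + d *\<^sub>R 1"
proof -
  define t where "t = norm p + d"
  have t: "t > 0" using d by (simp add: t_def add_nonneg_pos)
  define y where "y = 1 - inverse t *\<^sub>R (p + d *\<^sub>R 1)"
  have "y = inverse t *\<^sub>R (t *\<^sub>R 1 - (p + d *\<^sub>R 1))"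
    unfolding y_def using t by (simp add: scaleR_right_diff_distrib)
  also have "t *\<^sub>R 1 - (p + d *\<^sub>R 1) = norm p *\<^sub>R 1 - p" by (simp add: t_def algebra_simps)
  finally have "norm y \<le> inverse t * norm p"
    using psd_norm[OF p order_refl] t by (simp add: mult_left_mono)
  also have "\<dots> < 1" using t d by (simp add: t_def field_simps)
  finally have y: "norm y < 1" .
  have ya: "adj y = y" by (simp add: y_def adj_diff adj_scaleR adj_add psd_self_adjoint[OF p])
  note s1 = binom_summable_half(1)[OF less_imp_le[OF y]]
  note s2 = binom_summable_minus_half[OF y]
  have e: "-1/2 + 1/2 = (0::real)" "1/2 + -1/2 = (0::real)" by simp_all
  show ?thesis
  proof (rule that[of "inverse (sqrt t) *\<^sub>R binom_pow (-1/2) y" "sqrt t *\<^sub>R binom_pow (1/2) y"])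
    show "sqrt t *\<^sub>R binom_pow (1/2) y * sqrt t *\<^sub>R binom_pow (1/2) y = p + d *\<^sub>R 1"
      using binom_pow_mult[OF s1 s1] t by (simp add: binom_pow_1) (simp add: y_def)
  qed (use t binom_pow_mult[OF s1 s2, unfolded e binom_pow_0] binom_pow_mult[OF s2 s1, unfolded e binom_pow_0]
          adj_binom_pow[OF s1 ya] adj_binom_pow[OF s2 ya] in \<open>simp_all add: adj_scaleR\<close>)
qed

lemma square_le_mult_cancel:
  fixes h c :: real
  shows "h * h \<le> c * h \<Longrightarrow> 0 \<le> h \<Longrightarrow> 0 \<le> c \<Longrightarrow> h \<le> c"
  by (cases "h = 0") (auto simp: mult_le_cancel_right less_le)

text \<open>Cauchy-Schwarz divides by a bound for a norm that may vanish. Keeping the bound strictly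
  larger avoids a case distinction there, and this lemma lets it decrease to the norm.\<close>

lemma le_mult_of_forall_greater:
  fixes A B t :: real
  assumes "\<And>c. c > t \<Longrightarrow> A \<le> c * B" "B \<ge> 0"
  shows "A \<le> t * B"
proof (cases "B = 0")
  case True
  then show ?thesis using assms(1)[of "t + 1"] by simp
next
  case False
  then have "A / B \<le> t" using assms by (intro dense_ge[of t "A / B"]) (simp add: field_simps)
  then show ?thesis using False assms(2) by (simp add: field_simps)
qed

section \<open>The Hilbert module \<open>A\<^sup>n\<close>\<close>

abbreviation ip :: "'i set \<Rightarrow> ('i \<Rightarrow> 'a::cstar_algebra) \<Rightarrow> ('i \<Rightarrow> 'a) \<Rightarrow> 'a" where
  "ip I u v \<equiv> (\<Sum>i\<in>I. adj (u i) * v i)"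

text \<open>The index set is left arbitrary because block diagonal matrices act on families indexed
  by pairs.\<close>

definition hnorm :: "'i set \<Rightarrow> ('i \<Rightarrow> 'a::cstar_algebra) \<Rightarrow> real" where
  "hnorm I u = sqrt (norm (ip I u u))"

lemma hnorm_nonneg [simp]: "0 \<le> hnorm I u"
  by (simp add: hnorm_def)

lemma hnorm_power2: "(hnorm I u)\<^sup>2 = norm (ip I u u)"
  by (simp add: hnorm_def)

lemma adj_ip: "adj (ip I u v) = ip I v u"
  by (simp add: adj_sum adj_mult adj_adj)

lemma psd_ip: "psd (ip I u u)"
  by (intro psd_sum psd_adj_mult)

lemma norm_adj_mult_self: "norm (adj x * x) = (norm (x::'a::cstar_algebra))\<^sup>2"
  by (simp add: cstar_identity power2_eq_square)

text \<open>In the inner product of \<open>u a - v\<close> with itself the quadratic term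
  \<open>adj a * X * a\<close> is at most \<open>c\<close> times \<open>adj a * a\<close>. The
  minimising choice \<open>a = Z / c\<close> leaves an operator inequality between
  \<open>adj Z * Z / c\<close> and \<open>Y\<close>.\<close>

lemma Cauchy_Schwarz_ip: "norm (ip I u v) \<le> hnorm I u * hnorm I (v :: 'i \<Rightarrow> 'a::cstar_algebra)"
proof -
  let ?X = "ip I u u" and ?Y = "ip I v v" and ?Z = "ip I u v"
  have "(norm ?Z)\<^sup>2 \<le> c * norm ?Y" if c: "c > norm ?X" for c
  proof -
    have c0: "c > 0" using c norm_ge_zero[of ?X] by linarith
    define a where "a = inverse c *\<^sub>R ?Z"
    have "ip I (\<lambda>i. u i * a - v i) (\<lambda>i. u i * a - v i) = adj a * ?X * a - adj a * ?Z - adj ?Z * a + ?Y"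
      unfolding adj_ip
      by (simp add: adj_diff adj_mult algebra_simps sum.distrib sum_subtractf sum_distrib_left sum_distrib_right)
    then have "psd (adj a * ?X * a - adj a * ?Z - adj ?Z * a + ?Y)" using psd_ip by metis
    moreover have "psd (c *\<^sub>R (adj a * a) - adj a * ?X * a)"
      by (rule psd_conj_le_norm) (use c in \<open>auto simp: adj_ip\<close>)
    ultimately have "psd ((adj a * ?X * a - adj a * ?Z - adj ?Z * a + ?Y) + (c *\<^sub>R (adj a * a) - adj a * ?X * a))"
      by (rule psd_add)
    also have "(adj a * ?X * a - adj a * ?Z - adj ?Z * a + ?Y) + (c *\<^sub>R (adj a * a) - adj a * ?X * a)
        = ?Y - inverse c *\<^sub>R (adj ?Z * ?Z)"
      using c0 by (simp add: a_def adj_scaleR algebra_simps)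
    finally have "psd (?Y - inverse c *\<^sub>R (adj ?Z * ?Z))" .
    then have "norm (inverse c *\<^sub>R (adj ?Z * ?Z)) \<le> norm ?Y"
      using c0 by (intro psd_norm_mono psd_scaleR psd_adj_mult) auto
    then show ?thesis using c0 by (simp add: norm_adj_mult_self field_simps)
  qed
  then have "(norm ?Z)\<^sup>2 \<le> norm ?X * norm ?Y" by (rule le_mult_of_forall_greater) auto
  then have "(norm ?Z)\<^sup>2 \<le> (hnorm I u * hnorm I v)\<^sup>2" by (simp add: power_mult_distrib hnorm_power2)
  then show ?thesis by (simp add: power2_le_iff_abs_le)
qed

lemma hnorm_triangle: "hnorm I (\<lambda>i. u i + v i) \<le> hnorm I u + hnorm I (v :: 'i \<Rightarrow> 'a::cstar_algebra)"
proof -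
  have "ip I (\<lambda>i. u i + v i) (\<lambda>i. u i + v i) = ip I u u + ip I u v + ip I v u + ip I v v"
    by (simp add: adj_add algebra_simps sum.distrib)
  then have "(hnorm I (\<lambda>i. u i + v i))\<^sup>2 \<le> norm (ip I u u) + norm (ip I u v) + norm (ip I v u) + norm (ip I v v)"
    unfolding hnorm_power2 by (auto intro!: order_trans[OF norm_triangle_ineq] add_right_mono)
  also have "\<dots> \<le> (hnorm I u)\<^sup>2 + hnorm I u * hnorm I v + hnorm I v * hnorm I u + (hnorm I v)\<^sup>2"
    by (intro add_mono Cauchy_Schwarz_ip) (simp_all add: hnorm_power2)
  also have "\<dots> = (hnorm I u + hnorm I v)\<^sup>2" by (simp add: power2_eq_square algebra_simps)
  finally show ?thesis by (rule power2_le_imp_le) simp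
qed

lemma hnorm_cong: "(\<And>i. i \<in> I \<Longrightarrow> u i = v i) \<Longrightarrow> hnorm I u = hnorm I v"
  by (simp add: hnorm_def)

lemma hnorm_scaleR: "hnorm I (\<lambda>i. c *\<^sub>R u i) = \<bar>c\<bar> * hnorm I (u :: 'i \<Rightarrow> 'a::cstar_algebra)"
proof -
  have "ip I (\<lambda>i. c *\<^sub>R u i) (\<lambda>i. c *\<^sub>R u i) = c\<^sup>2 *\<^sub>R ip I u u"
    by (simp add: adj_scaleR scaleR_sum_right power2_eq_square)
  then show ?thesis by (simp add: hnorm_def real_sqrt_mult)
qed

lemma hnorm_minus: "hnorm I (\<lambda>i. - u i) = hnorm I (u :: 'i \<Rightarrow> 'a::cstar_algebra)"
  by (simp add: hnorm_def)

lemma hnorm_0 [simp]: "hnorm I (\<lambda>i. 0 :: 'a::cstar_algebra) = 0"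
  by (simp add: hnorm_def)

lemma hnorm_mono:
  assumes "finite I" "J \<subseteq> I" shows "hnorm J u \<le> hnorm I (u :: 'i \<Rightarrow> 'a::cstar_algebra)"
proof -
  have "ip I u u - ip J u u = ip (I - J) u u" using assms by (simp add: sum_diff)
  then have "psd (ip I u u - ip J u u)" using psd_ip by metis
  then show ?thesis unfolding hnorm_def by (simp add: psd_norm_mono[OF psd_ip])
qed

lemma hnorm_singleton: "hnorm {i} u = norm (u i :: 'a::cstar_algebra)"
  by (simp add: hnorm_def cstar_identity)

lemma norm_le_hnorm: "finite I \<Longrightarrow> i \<in> I \<Longrightarrow> norm (u i :: 'a::cstar_algebra) \<le> hnorm I u"
  using hnorm_mono[of I "{i}" u] by (simp add: hnorm_singleton)

lemma hnorm_le_sum: "hnorm I u \<le> (\<Sum>i\<in>I. norm (u i :: 'a::cstar_algebra))"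
proof -
  have "(hnorm I u)\<^sup>2 \<le> (\<Sum>i\<in>I. (norm (u i))\<^sup>2)"
    unfolding hnorm_power2 by (rule order_trans[OF norm_sum]) (simp add: norm_adj_mult_self)
  also have "\<dots> \<le> (\<Sum>i\<in>I. norm (u i))\<^sup>2"
  proof (induction I rule: infinite_finite_induct)
    case (insert i I)
    have "0 \<le> norm (u i) * (\<Sum>i\<in>I. norm (u i))" by (simp add: sum_nonneg)
    then show ?case using insert by (simp add: power2_sum)
  qed auto
  finally show ?thesis by (rule power2_le_imp_le) (simp add: sum_nonneg)
qed

lemma tendsto_hnorm [tendsto_intros]:
  "(\<And>i. i \<in> I \<Longrightarrow> ((\<lambda>n. u n i :: 'a::cstar_algebra) \<longlongrightarrow> v i) F) \<Longrightarrow> ((\<lambda>n. hnorm I (u n)) \<longlongrightarrow> hnorm I v) F"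
  unfolding hnorm_def by (intro tendsto_intros) auto

section \<open>Bounded rectangular matrices\<close>

text \<open>An upper bound for an operator from \<open>A^n\<close> to \<open>A^m\<close> rather than
  its norm: bounds compose and pass to limits without any supremum. The rectangular shape lets rows
  and columns be cut independently.\<close>

definition op_bound :: "nat \<Rightarrow> nat \<Rightarrow> 'a::cstar_algebra mat \<Rightarrow> real \<Rightarrow> bool" where
  "op_bound m n x C \<longleftrightarrow> 0 \<le> C \<and>
     (\<forall>\<xi>. hnorm {..<m} (\<lambda>i. \<Sum>j<n. x i j * \<xi> j) \<le> C * hnorm {..<n} \<xi>)"

lemma op_boundI:
  "0 \<le> C \<Longrightarrow> (\<And>\<xi>. hnorm {..<m} (\<lambda>i. \<Sum>j<n. x i j * \<xi> j) \<le> C * hnorm {..<n} \<xi>) \<Longrightarrow> op_bound m n x C"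
  by (simp add: op_bound_def)

lemma op_boundD: "op_bound m n x C \<Longrightarrow> hnorm {..<m} (\<lambda>i. \<Sum>j<n. x i j * \<xi> j) \<le> C * hnorm {..<n} \<xi>"
  by (simp add: op_bound_def)

lemma op_bound_nonneg: "op_bound m n x C \<Longrightarrow> 0 \<le> C"
  by (simp add: op_bound_def)

lemma op_bound_cong:
  "(\<And>i j. i < m \<Longrightarrow> j < n \<Longrightarrow> x i j = y i j) \<Longrightarrow> op_bound m n x C = op_bound m n y C"
proof -
  assume a: "\<And>i j. i < m \<Longrightarrow> j < n \<Longrightarrow> x i j = y i j"
  have "hnorm {..<m} (\<lambda>i. \<Sum>j<n. x i j * \<xi> j) = hnorm {..<m} (\<lambda>i. \<Sum>j<n. y i j * \<xi> j)" for \<xi>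
    by (rule hnorm_cong) (auto intro!: sum.cong simp: a)
  then show ?thesis by (simp add: op_bound_def)
qed

lemma op_bound_mono: "op_bound m n x C \<Longrightarrow> C \<le> D \<Longrightarrow> op_bound m n x D"
  unfolding op_bound_def by (meson hnorm_nonneg mult_right_mono order_trans)

lemma op_bound_add:
  assumes "op_bound m n x C" "op_bound m n y D"
  shows "op_bound m n (\<lambda>i j. x i j + y i j) (C + D)"
proof (rule op_boundI)
  fix \<xi> :: "nat \<Rightarrow> 'a"
  have "hnorm {..<m} (\<lambda>i. \<Sum>j<n. (x i j + y i j) * \<xi> j)
      \<le> hnorm {..<m} (\<lambda>i. \<Sum>j<n. x i j * \<xi> j) + hnorm {..<m} (\<lambda>i. \<Sum>j<n. y i j * \<xi> j)"
    using hnorm_triangle[of "{..<m}" "\<lambda>i. \<Sum>j<n. x i j * \<xi> j" "\<lambda>i. \<Sum>j<n. y i j * \<xi> j"]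
    by (simp add: distrib_right sum.distrib)
  then show "hnorm {..<m} (\<lambda>i. \<Sum>j<n. (x i j + y i j) * \<xi> j) \<le> (C + D) * hnorm {..<n} \<xi>"
    using op_boundD[OF assms(1), of \<xi>] op_boundD[OF assms(2), of \<xi>] by (simp add: distrib_right)
qed (use assms in \<open>auto simp: op_bound_def\<close>)

lemma op_bound_minus: "op_bound m n x C \<Longrightarrow> op_bound m n (\<lambda>i j. - x i j) C"
  by (simp add: op_bound_def sum_negf hnorm_minus)

lemma op_bound_diff:
  "op_bound m n x C \<Longrightarrow> op_bound m n y D \<Longrightarrow> op_bound m n (\<lambda>i j. x i j - y i j) (C + D)"
  using op_bound_add[OF _ op_bound_minus, of m n x C y D] by simp

lemma op_bound_mult:
  assumes "op_bound l m x C" "op_bound m n y D"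
  shows "op_bound l n (\<lambda>i j. \<Sum>k<m. x i k * y k j) (C * D)"
proof (rule op_boundI)
  show "0 \<le> C * D" using assms by (simp add: op_bound_def)
  fix \<xi> :: "nat \<Rightarrow> 'a"
  have "(\<Sum>j<n. (\<Sum>k<m. x i k * y k j) * \<xi> j) = (\<Sum>k<m. x i k * (\<Sum>j<n. y k j * \<xi> j))" for i
    by (simp add: sum_distrib_left sum_distrib_right mult.assoc) (rule sum.swap)
  then have "hnorm {..<l} (\<lambda>i. \<Sum>j<n. (\<Sum>k<m. x i k * y k j) * \<xi> j)
     \<le> C * hnorm {..<m} (\<lambda>k. \<Sum>j<n. y k j * \<xi> j)"
    using op_boundD[OF assms(1)] by simp
  also have "\<dots> \<le> C * (D * hnorm {..<n} \<xi>)"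
    by (rule mult_left_mono[OF op_boundD[OF assms(2)] op_bound_nonneg[OF assms(1)]])
  finally show "hnorm {..<l} (\<lambda>i. \<Sum>j<n. (\<Sum>k<m. x i k * y k j) * \<xi> j) \<le> C * D * hnorm {..<n} \<xi>"
    by (simp add: mult.assoc)
qed

text \<open>The squared norm of the image \<open>\<eta>\<close> of \<open>\<xi>\<close> is the
  pairing of \<open>\<xi>\<close> with the image of \<open>\<eta>\<close> under \<open>x\<close>;
  Cauchy-Schwarz leaves one factor \<open>hnorm\<close> of \<open>\<eta>\<close> to cancel.\<close>

lemma op_bound_adj:
  assumes "op_bound m n x C"
  shows "op_bound n m (\<lambda>i j. adj (x j i)) C"
proof (rule op_boundI)
  show "0 \<le> C" using assms by (rule op_bound_nonneg)
  fix \<xi> :: "nat \<Rightarrow> 'a"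
  define \<eta> where "\<eta> = (\<lambda>i. \<Sum>j<m. adj (x j i) * \<xi> j)"
  have "ip {..<n} \<eta> \<eta> = (\<Sum>i<n. \<Sum>j<m. adj (\<xi> j) * (x j i * \<eta> i))"
    by (rule sum.cong) (auto simp: \<eta>_def adj_sum adj_mult adj_adj sum_distrib_right mult.assoc)
  also have "\<dots> = ip {..<m} \<xi> (\<lambda>j. \<Sum>i<n. x j i * \<eta> i)"
    by (subst sum.swap) (simp add: sum_distrib_left)
  finally have "(hnorm {..<n} \<eta>)\<^sup>2 \<le> hnorm {..<m} \<xi> * hnorm {..<m} (\<lambda>j. \<Sum>i<n. x j i * \<eta> i)"
    unfolding hnorm_power2 by (simp add: Cauchy_Schwarz_ip)
  also have "\<dots> \<le> hnorm {..<m} \<xi> * (C * hnorm {..<n} \<eta>)"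
    by (intro mult_left_mono op_boundD[OF assms]) simp
  finally have "hnorm {..<n} \<eta> * hnorm {..<n} \<eta> \<le> C * hnorm {..<m} \<xi> * hnorm {..<n} \<eta>"
    by (simp add: power2_eq_square algebra_simps)
  then show "hnorm {..<n} \<eta> \<le> C * hnorm {..<m} \<xi>"
    by (rule square_le_mult_cancel) (simp_all add: \<open>0 \<le> C\<close>)
qed

lemma op_bound_mono_cols:
  assumes "op_bound m n x C" "n' \<le> n"
  shows "op_bound m n' x C"
proof (rule op_boundI)
  show "0 \<le> C" using assms(1) by (rule op_bound_nonneg)
  fix \<xi> :: "nat \<Rightarrow> 'a"
  let ?\<xi> = "\<lambda>j. if j < n' then \<xi> j else 0"
  have "(\<Sum>j<n. x i j * ?\<xi> j) = (\<Sum>j<n'. x i j * \<xi> j)" for i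
    by (rule sum.mono_neutral_cong_right) (use assms(2) in auto)
  moreover have "ip {..<n} ?\<xi> ?\<xi> = ip {..<n'} \<xi> \<xi>"
    by (rule sum.mono_neutral_cong_right) (use assms(2) in auto)
  ultimately show "hnorm {..<m} (\<lambda>i. \<Sum>j<n'. x i j * \<xi> j) \<le> C * hnorm {..<n'} \<xi>"
    using op_boundD[OF assms(1), of ?\<xi>] by (simp add: hnorm_def)
qed

lemma op_bound_mono_rows:
  assumes "op_bound m n x C" "m' \<le> m"
  shows "op_bound m' n x C"
  unfolding op_bound_def
  using assms op_bound_nonneg[OF assms(1)]
  by (auto intro!: order_trans[OF hnorm_mono op_boundD[OF assms(1)]])

text \<open>At a fixed size only entrywise convergence matters. This carries bounds from partial
  sums over to the entries of \<open>mmult\<close>, which are limits.\<close>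

lemma op_bound_limit:
  fixes x :: "'k \<Rightarrow> 'a::cstar_algebra mat"
  assumes "F \<noteq> bot" "\<forall>\<^sub>F k in F. op_bound m n (x k) C"
    "\<And>i j. i < m \<Longrightarrow> j < n \<Longrightarrow> ((\<lambda>k. x k i j) \<longlongrightarrow> y i j) F"
  shows "op_bound m n y C"
proof (rule op_boundI)
  show "0 \<le> C"
    using eventually_happens'[OF assms(1,2)] by (auto simp: op_bound_def)
  fix \<xi> :: "nat \<Rightarrow> 'a"
  show "hnorm {..<m} (\<lambda>i. \<Sum>j<n. y i j * \<xi> j) \<le> C * hnorm {..<n} \<xi>"
  proof (rule tendsto_upperbound[OF _ _ assms(1)])
    show "((\<lambda>k. hnorm {..<m} (\<lambda>i. \<Sum>j<n. x k i j * \<xi> j)) \<longlongrightarrow> hnorm {..<m} (\<lambda>i. \<Sum>j<n. y i j * \<xi> j)) F"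
      by (intro tendsto_intros assms(3)) auto
    show "\<forall>\<^sub>F k in F. hnorm {..<m} (\<lambda>i. \<Sum>j<n. x k i j * \<xi> j) \<le> C * hnorm {..<n} \<xi>"
      using assms(2) by eventually_elim (rule op_boundD)
  qed
qed

text \<open>Lossy, but sufficient where the entries can be made small after the size is fixed, or
  where any finite bound will do.\<close>

lemma op_bound_crude:
  assumes "\<And>i j. i < m \<Longrightarrow> j < n \<Longrightarrow> norm (x i j) \<le> c" "0 \<le> c"
  shows "op_bound m n x (real m * real n * c)"
proof (rule op_boundI)
  show "0 \<le> real m * real n * c" using assms(2) by simp
  fix \<xi> :: "nat \<Rightarrow> 'a"
  have "hnorm {..<m} (\<lambda>i. \<Sum>j<n. x i j * \<xi> j) \<le> (\<Sum>i<m. norm (\<Sum>j<n. x i j * \<xi> j))"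
    by (rule hnorm_le_sum)
  also have "\<dots> \<le> (\<Sum>i<m. \<Sum>j<n. c * hnorm {..<n} \<xi>)"
  proof (intro sum_mono order_trans[OF norm_sum])
    fix i j assume "i \<in> {..<m}" "j \<in> {..<n}"
    then show "norm (x i j * \<xi> j) \<le> c * hnorm {..<n} \<xi>"
      using assms by (intro order_trans[OF norm_mult_ineq] mult_mono norm_le_hnorm) auto
  qed
  finally show "hnorm {..<m} (\<lambda>i. \<Sum>j<n. x i j * \<xi> j) \<le> real m * real n * c * hnorm {..<n} \<xi>"
    by simp
qed

lemma op_bound_column:
  assumes "op_bound m n x C" "j < n"
  shows "hnorm {..<m} (\<lambda>i. x i j) \<le> C"
proof -
  let ?\<xi> = "\<lambda>k. if k = j then 1 else 0 :: 'a"
  have "(\<Sum>k<n. x i k * ?\<xi> k) = x i j" for i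
    using assms(2) by (simp add: if_distrib sum.delta cong: if_cong)
  moreover have "ip {..<n} ?\<xi> ?\<xi> = 1"
    using assms(2) by (simp add: if_distrib sum.delta cong: if_cong)
  ultimately show ?thesis using op_boundD[OF assms(1), of ?\<xi>] by (simp add: hnorm_def)
qed

lemma op_bound_entry:
  "op_bound m n x C \<Longrightarrow> i < m \<Longrightarrow> j < n \<Longrightarrow> norm (x i j) \<le> C"
  using norm_le_hnorm[of "{..<m}" i "\<lambda>i. x i j"] op_bound_column[of m n x C j] by force

text \<open>Replacing \<open>\<xi>\<close> by \<open>\<xi> (\<langle>\<xi>, \<xi>\<rangle> + d)\<^sup>-\<^sup>1\<^sup>/\<^sup>2\<close> upgrades the norm bound to an operator inequality.\<close>
lemma op_bound_psd:
  assumes "op_bound m n x C"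
  defines "T \<equiv> \<lambda>\<xi> i. \<Sum>j<n. x i j * \<xi> j"
  shows "psd (C\<^sup>2 *\<^sub>R ip {..<n} \<xi> \<xi> - ip {..<m} (T \<xi>) (T \<xi>))"
proof -
  let ?p = "ip {..<n} \<xi> \<xi>" and ?t = "ip {..<m} (T \<xi>) (T \<xi>)"
  have d: "psd (C\<^sup>2 *\<^sub>R (?p + d *\<^sub>R 1) - ?t)" if d0: "d > 0" for d
  proof -
    obtain r s where rs: "adj r = r" "adj s = s" "r * s = 1" "s * r = 1" "s * s = ?p + d *\<^sub>R 1"
      by (rule inverse_sqrt_exists[OF psd_ip d0])
    have ipr: "ip I (\<lambda>i. u i * r) (\<lambda>i. u i * r) = r * ip I u u * r" for u :: "nat \<Rightarrow> 'a" and I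
      by (simp add: adj_mult rs sum_distrib_left sum_distrib_right mult.assoc)
    have "r * (s * s) * r = 1" using rs(3,4) by (metis mult.assoc mult.right_neutral)
    then have "1 - r * ?p * r = d *\<^sub>R (r * r)" unfolding rs(5) by (simp add: algebra_simps)
    then have "psd (1 *\<^sub>R 1 - r * ?p * r)" using d0 by (simp add: psd_scaleR psd_square rs)
    moreover have "psd (r * ?p * r)" using psd_conj[OF psd_ip, of r] rs(1) by simp
    ultimately have "norm (r * ?p * r) \<le> 1" by (intro psd_le_scalar_norm) auto
    then have "hnorm {..<n} (\<lambda>j. \<xi> j * r) \<le> 1" unfolding hnorm_def ipr by simp
    then have "C * hnorm {..<n} (\<lambda>j. \<xi> j * r) \<le> C" using op_bound_nonneg[OF assms(1)] by (simp add: mult_left_le)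
    then have "hnorm {..<m} (T (\<lambda>j. \<xi> j * r)) \<le> C"
      unfolding T_def using op_boundD[OF assms(1), of "\<lambda>j. \<xi> j * r"] by linarith
    also have "T (\<lambda>j. \<xi> j * r) = (\<lambda>i. T \<xi> i * r)"
      by (simp add: T_def fun_eq_iff sum_distrib_right mult.assoc)
    finally have "(hnorm {..<m} (\<lambda>i. T \<xi> i * r))\<^sup>2 \<le> C\<^sup>2" by (simp add: power_mono)
    then have "norm (r * ?t * r) \<le> C\<^sup>2" unfolding hnorm_power2 ipr .
    moreover have "adj (r * ?t * r) = r * ?t * r"
      by (simp only: adj_mult adj_ip rs mult.assoc)
    \<comment> \<open>Conjugation by \<open>s\<close>, the inverse of \<open>r\<close>, undoes the
      normalisation and places \<open>?t\<close> below \<open>C\<^sup>2\<close> times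
      \<open>?p + d\<close>.\<close>
    ultimately have "psd (C\<^sup>2 *\<^sub>R (adj s * s) - adj s * (r * ?t * r) * s)"
      by (intro psd_conj_le_norm)
    moreover have "adj s * (r * ?t * r) * s = (s * r) * ?t * (r * s)" by (simp only: rs(2) mult.assoc)
    ultimately show ?thesis by (simp add: rs)
  qed
  have "(\<lambda>k. C\<^sup>2 *\<^sub>R (?p + inverse (real (Suc k)) *\<^sub>R 1) - ?t) \<longlonglongrightarrow> C\<^sup>2 *\<^sub>R (?p + 0 *\<^sub>R 1) - ?t"
    by (intro tendsto_intros LIMSEQ_inverse_real_of_nat)
  then have "psd (C\<^sup>2 *\<^sub>R (?p + 0 *\<^sub>R 1) - ?t)"
    by (rule psd_limit[rotated]) (rule d, simp)
  then show ?thesis by simp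
qed

text \<open>The matrix is a compression: \<open>V\<close> sends \<open>\<xi>\<close> to the family
  \<open>e j * \<xi> i\<close> over pairs, the \<open>x j\<close> act as a block diagonal matrix,
  and the adjoint of \<open>V\<close> leads back. The diagonal has bound \<open>C\<close> and
  \<open>V\<close> has bound \<open>sqrt K\<close>, whatever the number of blocks.\<close>

lemma op_bound_block_sum:
  fixes e :: "'j \<Rightarrow> 'a::cstar_algebra"
  assumes x: "\<And>j. j \<in> J \<Longrightarrow> op_bound n n (x j) C" and C: "0 \<le> C"
    and K: "norm (\<Sum>j\<in>J. adj (e j) * e j) \<le> K"
  shows "op_bound n n (\<lambda>i k. \<Sum>j\<in>J. adj (e j) * x j i k * e j) (C * K)"
proof (cases "finite J")
  case False
  then have "(\<lambda>i k. \<Sum>j\<in>J. adj (e j) * x j i k * e j) = (\<lambda>i k. 0)" by simp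
  moreover have "0 \<le> C * K" using C K norm_ge_zero order_trans by (intro mult_nonneg_nonneg) blast+
  ultimately show ?thesis by (simp add: op_bound_def)
next
  case fin: True
  have K0: "0 \<le> K" using K norm_ge_zero order_trans by blast
  show ?thesis
  proof (rule op_boundI)
    show "0 \<le> C * K" using C K0 by simp
    fix \<xi> :: "nat \<Rightarrow> 'a"
    let ?P = "J \<times> {..<n}"
    define T where "T = (\<lambda>j i. \<Sum>k<n. x j i k * (e j * \<xi> k))"
    define \<eta> where "\<eta> = (\<lambda>i. \<Sum>k<n. (\<Sum>j\<in>J. adj (e j) * x j i k * e j) * \<xi> k)"
    have eta: "\<eta> i = (\<Sum>j\<in>J. adj (e j) * T j i)" for i
      unfolding \<eta>_def T_def
      by (simp add: sum_distrib_left sum_distrib_right mult.assoc) (rule sum.swap)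
    \<comment> \<open>The bound \<open>sqrt K\<close> of \<open>V\<close>: the inequality between
      \<open>?S\<close> and the scalar \<open>K\<close> is conjugated by each \<open>u i\<close>,
      summed, and only then are norms taken.\<close>
    have dil: "hnorm ?P (\<lambda>(j,i). e j * u i) \<le> sqrt K * hnorm {..<n} u" for u :: "nat \<Rightarrow> 'a"
    proof -
      let ?S = "\<Sum>j\<in>J. adj (e j) * e j"
      have "(\<Sum>p\<in>?P. adj (case p of (j,i) \<Rightarrow> e j * u i) * (case p of (j,i) \<Rightarrow> e j * u i))
          = (\<Sum>i<n. adj (u i) * ?S * u i)"
        by (simp add: sum.cartesian_product' adj_mult mult.assoc
            sum_distrib_left sum_distrib_right) (rule sum.swap)
      moreover have "psd (\<Sum>i<n. K *\<^sub>R (adj (u i) * u i) - adj (u i) * ?S * u i)"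
        by (intro psd_sum psd_conj_le_norm K adj_ip)
      then have "psd (K *\<^sub>R ip {..<n} u u - (\<Sum>i<n. adj (u i) * ?S * u i))"
        by (simp add: sum_subtractf scaleR_sum_right)
      then have "norm (\<Sum>i<n. adj (u i) * ?S * u i) \<le> norm (K *\<^sub>R ip {..<n} u u)"
        by (rule psd_norm_mono[rotated]) (intro psd_sum psd_conj psd_ip)
      ultimately have "(hnorm ?P (\<lambda>(j,i). e j * u i))\<^sup>2 \<le> K * (hnorm {..<n} u)\<^sup>2"
        using K0 by (simp add: hnorm_power2)
      also have "\<dots> = (sqrt K * hnorm {..<n} u)\<^sup>2" using K0 by (simp add: power_mult_distrib)
      finally show ?thesis by (rule power2_le_imp_le) (simp add: K0)
    qed
    \<comment> \<open>Norm bounds of single blocks would accumulate with their number. The operator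
      inequalities of \<open>op_bound_psd\<close> are added instead, and the norm is taken once at
      the end.\<close>
    have Tb: "hnorm ?P (\<lambda>(j,i). T j i) \<le> C * hnorm ?P (\<lambda>(j,i). e j * \<xi> i)"
    proof -
      have "psd (\<Sum>j\<in>J. C\<^sup>2 *\<^sub>R ip {..<n} (\<lambda>k. e j * \<xi> k) (\<lambda>k. e j * \<xi> k) - ip {..<n} (T j) (T j))"
        unfolding T_def by (intro psd_sum op_bound_psd x)
      moreover have "(\<Sum>p\<in>?P. adj (case p of (j,i) \<Rightarrow> T j i) * (case p of (j,i) \<Rightarrow> T j i))
         = (\<Sum>j\<in>J. ip {..<n} (T j) (T j))"
        by (simp add: sum.cartesian_product')
      moreover have "(\<Sum>p\<in>?P. adj (case p of (j,i) \<Rightarrow> e j * \<xi> i) * (case p of (j,i) \<Rightarrow> e j * \<xi> i))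
         = (\<Sum>j\<in>J. ip {..<n} (\<lambda>k. e j * \<xi> k) (\<lambda>k. e j * \<xi> k))"
        by (simp add: sum.cartesian_product')
      ultimately have "psd (C\<^sup>2 *\<^sub>R ip ?P (\<lambda>(j,i). e j * \<xi> i) (\<lambda>(j,i). e j * \<xi> i)
          - ip ?P (\<lambda>(j,i). T j i) (\<lambda>(j,i). T j i))"
        by (simp add: sum_subtractf scaleR_sum_right)
      from psd_norm_mono[OF psd_ip this]
      have "(hnorm ?P (\<lambda>(j,i). T j i))\<^sup>2 \<le> (C * hnorm ?P (\<lambda>(j,i). e j * \<xi> i))\<^sup>2"
        by (simp add: hnorm_power2 power_mult_distrib)
      then show ?thesis by (rule power2_le_imp_le) (simp add: C)
    qed
    have "ip {..<n} \<eta> \<eta> = ip ?P (\<lambda>(j,i). e j * \<eta> i) (\<lambda>(j,i). T j i)"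
    proof -
      have "ip {..<n} \<eta> \<eta> = (\<Sum>i<n. \<Sum>j\<in>J. adj (e j * \<eta> i) * T j i)"
      proof (rule sum.cong)
        fix i
        have "adj (\<eta> i) * \<eta> i = adj (\<eta> i) * (\<Sum>j\<in>J. adj (e j) * T j i)" by (simp only: eta)
        then show "adj (\<eta> i) * \<eta> i = (\<Sum>j\<in>J. adj (e j * \<eta> i) * T j i)"
          by (simp add: adj_mult sum_distrib_left mult.assoc)
      qed simp
      also have "\<dots> = (\<Sum>j\<in>J. \<Sum>i<n. adj (e j * \<eta> i) * T j i)" by (rule sum.swap)
      finally show ?thesis by (simp add: sum.cartesian_product')
    qed
    then have "(hnorm {..<n} \<eta>)\<^sup>2 \<le> hnorm ?P (\<lambda>(j,i). e j * \<eta> i) * hnorm ?P (\<lambda>(j,i). T j i)"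
      unfolding hnorm_power2 by (simp only: Cauchy_Schwarz_ip)
    also have "\<dots> \<le> (sqrt K * hnorm {..<n} \<eta>) * (C * (sqrt K * hnorm {..<n} \<xi>))"
      by (intro mult_mono dil order_trans[OF Tb] mult_left_mono) (auto simp: C K0)
    also have "\<dots> = (C * K * hnorm {..<n} \<xi>) * hnorm {..<n} \<eta>"
      using K0 by (simp add: algebra_simps)
    finally have "hnorm {..<n} \<eta> * hnorm {..<n} \<eta> \<le> (C * K * hnorm {..<n} \<xi>) * hnorm {..<n} \<eta>"
      by (simp add: power2_eq_square)
    then show "hnorm {..<n} \<eta> \<le> C * K * hnorm {..<n} \<xi>"
      by (rule square_le_mult_cancel) (simp_all add: C K0)
  qed
qed

section \<open>Operator bounds and the norms of matrix algebras\<close>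

lemma mnorm_n_le:
  assumes "op_bound n n x C" shows "mnorm_n n x \<le> C"
  unfolding mnorm_n_def
proof (rule cSup_least)
  show "{sqrt (norm (\<Sum>i<n. adj (\<Sum>j<n. x i j * \<xi> j) * (\<Sum>j<n. x i j * \<xi> j))) | \<xi>.
      norm (\<Sum>j<n. adj (\<xi> j) * \<xi> j) \<le> 1} \<noteq> {}"
    by (auto intro!: exI[of _ "\<lambda>_. 0"])
  fix s assume "s \<in> {sqrt (norm (\<Sum>i<n. adj (\<Sum>j<n. x i j * \<xi> j) * (\<Sum>j<n. x i j * \<xi> j))) | \<xi>.
      norm (\<Sum>j<n. adj (\<xi> j) * \<xi> j) \<le> 1}"
  then obtain \<xi> where s: "s = hnorm {..<n} (\<lambda>i. \<Sum>j<n. x i j * \<xi> j)" "hnorm {..<n} \<xi> \<le> 1"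
    by (auto simp: hnorm_def)
  have "C * hnorm {..<n} \<xi> \<le> C" using s(2) op_bound_nonneg[OF assms] by (simp add: mult_left_le)
  then show "s \<le> C" using op_boundD[OF assms, of \<xi>] s(1) by simp
qed

text \<open>The crude entrywise bound makes the set bounded above, so the supremum is genuine;
  rescaling carries the estimate from the unit ball to all vectors.\<close>

lemma op_bound_mnorm_n: "op_bound n n x (mnorm_n n x)"
proof -
  let ?S = "{sqrt (norm (\<Sum>i<n. adj (\<Sum>j<n. x i j * \<xi> j) * (\<Sum>j<n. x i j * \<xi> j))) | \<xi>.
      norm (\<Sum>j<n. adj (\<xi> j) * \<xi> j) \<le> 1}"
  define c where "c = (\<Sum>i<n. \<Sum>j<n. norm (x i j))"
  have "norm (x i j) \<le> c" if "i < n" "j < n" for i j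
  proof -
    have "norm (x i j) \<le> (\<Sum>j<n. norm (x i j))" using that by (intro member_le_sum) auto
    also have "\<dots> \<le> c" unfolding c_def
      by (rule member_le_sum[of i _ "\<lambda>i. \<Sum>j<n. norm (x i j)"]) (use that in \<open>auto intro: sum_nonneg\<close>)
    finally show ?thesis .
  qed
  then have B: "op_bound n n x (real n * real n * c)"
    by (rule op_bound_crude) (auto simp: c_def intro!: sum_nonneg)
  have bdd: "bdd_above ?S"
  proof (rule bdd_aboveI[of _ "real n * real n * c"])
    fix s assume "s \<in> ?S"
    then obtain \<xi> where s: "s = hnorm {..<n} (\<lambda>i. \<Sum>j<n. x i j * \<xi> j)" "hnorm {..<n} \<xi> \<le> 1"
      by (auto simp: hnorm_def)
    have "real n * real n * c * hnorm {..<n} \<xi> \<le> real n * real n * c"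
      using s(2) op_bound_nonneg[OF B] by (simp only: mult_left_le)
    then show "s \<le> real n * real n * c" using op_boundD[OF B, of \<xi>] s(1) by simp
  qed
  have unit: "hnorm {..<n} (\<lambda>i. \<Sum>j<n. x i j * \<xi> j) \<le> mnorm_n n x" if "hnorm {..<n} \<xi> \<le> 1" for \<xi>
    unfolding mnorm_n_def by (rule cSup_upper[OF _ bdd]) (use that in \<open>auto simp: hnorm_def\<close>)
  show ?thesis
  proof (rule op_boundI)
    show "0 \<le> mnorm_n n x" using unit[of "\<lambda>_. 0"] by simp
    fix \<xi> :: "nat \<Rightarrow> 'a"
    let ?h = "hnorm {..<n} \<xi>"
    show "hnorm {..<n} (\<lambda>i. \<Sum>j<n. x i j * \<xi> j) \<le> mnorm_n n x * ?h"
    proof (cases "?h = 0")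
      case True
      then show ?thesis using op_boundD[OF B, of \<xi>] by simp
    next
      case False
      then have h: "?h > 0" using hnorm_nonneg less_le by metis
      have "hnorm {..<n} (\<lambda>j. inverse ?h *\<^sub>R \<xi> j) \<le> 1" using h by (simp add: hnorm_scaleR)
      from unit[OF this] have "hnorm {..<n} (\<lambda>i. inverse ?h *\<^sub>R (\<Sum>j<n. x i j * \<xi> j)) \<le> mnorm_n n x"
        by (simp add: scaleR_sum_right)
      then show ?thesis using h by (simp add: hnorm_scaleR field_simps)
    qed
  qed
qed

lemma mnorm_n_nonneg: "0 \<le> mnorm_n n x"
  using op_bound_mnorm_n op_bound_nonneg by blast

lemma op_bound_mask:
  assumes "op_bound m n x C"
  shows "op_bound m n (\<lambda>i j. if P i \<and> Q j then x i j else 0) C"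
proof (rule op_boundI)
  show "0 \<le> C" using assms by (rule op_bound_nonneg)
  fix \<xi> :: "nat \<Rightarrow> 'a"
  let ?\<xi> = "\<lambda>j. if Q j then \<xi> j else 0"
  have sub: "hnorm I (\<lambda>i. if R i then u i else 0) \<le> hnorm I u" if "finite I" for R I and u :: "nat \<Rightarrow> 'a"
  proof -
    have "ip I (\<lambda>i. if R i then u i else 0) (\<lambda>i. if R i then u i else 0) = ip {i\<in>I. R i} u u"
      using that by (intro sum.mono_neutral_cong_right) auto
    then show ?thesis using hnorm_mono[OF that, of "{i\<in>I. R i}" u] by (simp add: hnorm_def)
  qed
  have "(\<Sum>j<n. (if P i \<and> Q j then x i j else 0) * \<xi> j) = (if P i then \<Sum>j<n. x i j * ?\<xi> j else 0)" for i
    by (auto intro!: sum.cong sum.neutral)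
  then have "hnorm {..<m} (\<lambda>i. \<Sum>j<n. (if P i \<and> Q j then x i j else 0) * \<xi> j)
     \<le> hnorm {..<m} (\<lambda>i. \<Sum>j<n. x i j * ?\<xi> j)"
    using sub[of "{..<m}" P] by simp
  also have "\<dots> \<le> C * hnorm {..<n} ?\<xi>" by (rule op_boundD[OF assms])
  also have "\<dots> \<le> C * hnorm {..<n} \<xi>" by (intro mult_left_mono sub \<open>0 \<le> C\<close>) simp
  finally show "hnorm {..<m} (\<lambda>i. \<Sum>j<n. (if P i \<and> Q j then x i j else 0) * \<xi> j) \<le> C * hnorm {..<n} \<xi>" .
qed

text \<open>The target size may be larger or smaller than \<open>m\<close> and \<open>n\<close>; the
  bound is proved at the maxima and then cut down.\<close>

lemma op_bound_zero_extend:
  assumes "op_bound m n x C"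
  shows "op_bound r s (\<lambda>i j. if i < m \<and> j < n then x i j else 0) C"
proof -
  let ?r = "max r m" and ?s = "max s n"
  have "op_bound ?r ?s (\<lambda>i j. if i < m \<and> j < n then x i j else 0) C"
  proof (rule op_boundI)
    show "0 \<le> C" using assms by (rule op_bound_nonneg)
    fix \<xi> :: "nat \<Rightarrow> 'a"
    have e: "(\<Sum>j<?s. (if i < m \<and> j < n then x i j else 0) * \<xi> j) = (if i < m then \<Sum>j<n. x i j * \<xi> j else 0)" for i
    proof (cases "i < m")
      case True
      have "(\<Sum>j<?s. (if i < m \<and> j < n then x i j else 0) * \<xi> j) = (\<Sum>j<n. x i j * \<xi> j)"
        using True by (intro sum.mono_neutral_cong_right) auto
      then show ?thesis using True by simp
    qed simp
    have "hnorm {..<?r} (\<lambda>i. if i < m then \<Sum>j<n. x i j * \<xi> j else 0) = hnorm {..<m} (\<lambda>i. \<Sum>j<n. x i j * \<xi> j)"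
      unfolding hnorm_def
      by (rule arg_cong[of _ _ "\<lambda>x. sqrt (norm x)"], rule sum.mono_neutral_cong_right) auto
    also have "\<dots> \<le> C * hnorm {..<n} \<xi>" by (rule op_boundD[OF assms])
    also have "\<dots> \<le> C * hnorm {..<?s} \<xi>" by (intro mult_left_mono hnorm_mono \<open>0 \<le> C\<close>) auto
    finally show "hnorm {..<?r} (\<lambda>i. \<Sum>j<?s. (if i < m \<and> j < n then x i j else 0) * \<xi> j) \<le> C * hnorm {..<?s} \<xi>"
      unfolding e .
  qed
  then show ?thesis by (rule op_bound_mono_rows[OF op_bound_mono_cols]) auto
qed

section \<open>Infinite matrices\<close>

text \<open>Infinite matrices are not turned into operators on a completed module; a bound common to
  all finite corners serves instead.\<close>

definition mat_bound :: "'a::cstar_algebra mat \<Rightarrow> real \<Rightarrow> bool" where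
  "mat_bound x C \<longleftrightarrow> (\<forall>m n. op_bound m n x C)"

lemma mat_boundD: "mat_bound x C \<Longrightarrow> op_bound m n x C"
  by (simp add: mat_bound_def)

lemma mat_bound_madj: "mat_bound x C \<Longrightarrow> mat_bound (madj x) C"
  by (simp add: mat_bound_def madj_def op_bound_adj)

lemma madj_madj [simp]: "madj (madj x) = (x :: 'a::cstar_algebra mat)"
  by (simp add: madj_def adj_adj)

lemma stab_tail:
  assumes "x \<in> stab B" "e > 0"
  obtains N where "\<And>m. m \<ge> N \<Longrightarrow> mat_bound (\<lambda>i j. x i j - trunc m x i j) e"
proof -
  obtain N where N: "\<And>m n. m \<ge> N \<Longrightarrow> n \<ge> m \<Longrightarrow> mnorm_n n (\<lambda>i j. x i j - trunc m x i j) < e"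
    using assms unfolding stab_def by blast
  have "op_bound r s (\<lambda>i j. x i j - trunc m x i j) e" if "m \<ge> N" for m r s
  proof -
    let ?n = "max m (max r s)"
    have "op_bound ?n ?n (\<lambda>i j. x i j - trunc m x i j) e"
      by (rule op_bound_mono[OF op_bound_mnorm_n less_imp_le[OF N[OF that]]]) simp
    then show ?thesis by (rule op_bound_mono_rows[OF op_bound_mono_cols]) auto
  qed
  then show ?thesis by (intro that[of N]) (simp add: mat_bound_def)
qed

lemma stab_bounded:
  assumes "x \<in> stab B"
  obtains C where "mat_bound x C"
proof -
  obtain N where N: "mat_bound (\<lambda>i j. x i j - trunc N x i j) 1"
    using stab_tail[OF assms, of 1] by (metis order_refl zero_less_one)
  have "op_bound r s x (mnorm_n N x + 1)" for r s
  proof -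
    have "op_bound r s (trunc N x) (mnorm_n N x)"
      unfolding trunc_def by (rule op_bound_zero_extend[OF op_bound_mnorm_n])
    from op_bound_add[OF this mat_boundD[OF N]] show ?thesis by simp
  qed
  then show ?thesis using that by (auto simp: mat_bound_def)
qed

lemma mat_bound_nonneg: "mat_bound x C \<Longrightarrow> 0 \<le> C"
  using mat_boundD op_bound_nonneg by blast

text \<open>In rows from \<open>m\<close> on \<open>trunc m x\<close> is zero, so the tail of a
  column of \<open>x\<close> is part of a column of the small matrix
  \<open>x - trunc m x\<close>.\<close>

lemma stab_column_tail:
  assumes "x \<in> stab B" "e > 0"
  obtains N where "\<And>m n. m \<ge> N \<Longrightarrow> hnorm {m..<n} (\<lambda>k. x k j) \<le> e"
proof -
  obtain N where N: "\<And>m. m \<ge> N \<Longrightarrow> mat_bound (\<lambda>i j. x i j - trunc m x i j) e"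
    using stab_tail[OF assms] by blast
  have "hnorm {m..<n} (\<lambda>k. x k j) \<le> e" if "m \<ge> N" for m n
  proof -
    have "hnorm {m..<n} (\<lambda>k. x k j) = hnorm {m..<n} (\<lambda>k. x k j - trunc m x k j)"
      by (rule hnorm_cong) (simp add: trunc_def)
    also have "\<dots> \<le> hnorm {..<n} (\<lambda>k. x k j - trunc m x k j)" by (rule hnorm_mono) auto
    also have "\<dots> \<le> e" by (rule op_bound_column[OF mat_boundD[OF N[OF that]], of j "Suc j"]) simp
    finally show ?thesis .
  qed
  then show ?thesis using that by blast
qed

lemma column_bound: "mat_bound x C \<Longrightarrow> hnorm {m..<n} (\<lambda>k. x k j) \<le> C"
  by (rule order_trans[OF hnorm_mono[of "{..<n}"] op_bound_column[OF mat_boundD, of x C j "Suc j"]]) auto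

text \<open>The \<open>lim\<close> in \<open>mmult\<close> carries information only once convergence
  is known. Cauchy-Schwarz on a window of indices needs a small tail of one column and a mere bound
  for the other; hence the disjunction, which admits factors known only to be bounded.\<close>

lemma mmult_madj_tendsto:
  assumes u: "mat_bound u C" and w: "mat_bound w D" and s: "u \<in> stab A \<or> w \<in> stab B"
  shows "(\<lambda>n. \<Sum>k<n. adj (u k i) * w k j) \<longlonglongrightarrow> mmult (madj u) w i j"
proof -
  have "summable (\<lambda>k. adj (u k i) * w k j)"
  proof (subst summable_Cauchy, intro allI impI)
    fix e :: real assume e: "e > 0"
    define e' where "e' = e / (2 * (C + D + 1))"
    have CD: "0 \<le> C" "0 \<le> D" using u w by (auto intro: mat_bound_nonneg)
    have e': "e' > 0" using e CD by (simp add: e'_def)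
    have small: "e' * C < e" "e' * D < e" using e CD
      by (simp_all add: e'_def field_simps add_nonneg_pos add_pos_nonneg)
    show "\<exists>N. \<forall>m\<ge>N. \<forall>n. norm (ip {m..<n} (\<lambda>k. u k i) (\<lambda>k. w k j)) < e"
      using s
    proof
      assume "u \<in> stab A"
      then obtain N where N: "\<And>m n. m \<ge> N \<Longrightarrow> hnorm {m..<n} (\<lambda>k. u k i) \<le> e'"
        using stab_column_tail[OF _ e'] by metis
      have "norm (ip {m..<n} (\<lambda>k. u k i) (\<lambda>k. w k j)) < e" if "m \<ge> N" for m n
        using Cauchy_Schwarz_ip[where I = "{m..<n}" and u = "\<lambda>k. u k i" and v = "\<lambda>k. w k j"]
          mult_mono[OF N[OF that, of n] column_bound[OF w, of m n j]] e' small by simp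
      then show ?thesis by blast
    next
      assume "w \<in> stab B"
      then obtain N where N: "\<And>m n. m \<ge> N \<Longrightarrow> hnorm {m..<n} (\<lambda>k. w k j) \<le> e'"
        using stab_column_tail[OF _ e'] by metis
      have "norm (ip {m..<n} (\<lambda>k. u k i) (\<lambda>k. w k j)) < e" if "m \<ge> N" for m n
        using Cauchy_Schwarz_ip[where I = "{m..<n}" and u = "\<lambda>k. u k i" and v = "\<lambda>k. w k j"]
          mult_mono[OF column_bound[OF u, of m n i] N[OF that, of n]] e' small CD
        by (simp add: mult.commute)
      then show ?thesis by blast
    qed
  qed
  then have "(\<lambda>n. \<Sum>k<n. adj (u k i) * w k j) \<longlonglongrightarrow> (\<Sum>k. adj (u k i) * w k j)" by (rule summable_LIMSEQ)
  then show ?thesis unfolding mmult_def madj_def by (simp add: limI)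
qed

lemma mat_bound_mmult_madj:
  assumes u: "mat_bound u C" and w: "mat_bound w D" and s: "u \<in> stab A \<or> w \<in> stab B"
  shows "mat_bound (mmult (madj u) w) (C * D)"
proof -
  have "op_bound m n (mmult (madj u) w) (C * D)" for m n
    by (rule op_bound_limit[OF sequentially_bot _ mmult_madj_tendsto[OF assms]])
       (intro always_eventually allI op_bound_mult op_bound_adj mat_boundD u w)
  then show ?thesis by (simp add: mat_bound_def)
qed

lemma op_bound_gram_diff:
  assumes "op_bound m r u C" "op_bound m s u C" "op_bound m r w C" "op_bound m s w C"
    and "op_bound m r (\<lambda>k i. u k i - w k i) e" "op_bound m s (\<lambda>k i. u k i - w k i) e"
  shows "op_bound r s (\<lambda>i j. (\<Sum>k<m. adj (u k i) * u k j) - (\<Sum>k<m. adj (w k i) * w k j)) (2 * C * e)"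
proof -
  have "op_bound r s (\<lambda>i j. (\<Sum>k<m. adj (u k i - w k i) * u k j) + (\<Sum>k<m. adj (w k i) * (u k j - w k j))) (e * C + C * e)"
    by (rule op_bound_add[OF op_bound_mult[OF op_bound_adj[OF assms(5)] assms(2)]
          op_bound_mult[OF op_bound_adj[OF assms(3)] assms(6)]])
  then show ?thesis by (simp add: adj_diff algebra_simps sum_subtractf)
qed

lemma cu_pos_bounded:
  assumes "a \<in> cu_pos B"
  obtains C where "mat_bound a C"
proof -
  obtain c where c: "c \<in> stab B" "a = mmult (madj c) c" using assms by (auto simp: cu_pos_def)
  obtain C where "mat_bound c C" using stab_bounded[OF c(1)] by blast
  then show ?thesis using mat_bound_mmult_madj[of c C c C B B] c that by blast
qed

text \<open>\<open>a\<close> is the Gram matrix of some \<open>c\<close>; deleting columns of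
  \<open>c\<close> amounts to truncating \<open>a\<close>, and Gram matrices of close bounded
  matrices are close.\<close>

lemma cu_pos_tail:
  assumes "a \<in> cu_pos B" "e > 0"
  obtains N where "\<And>m. m \<ge> N \<Longrightarrow> mat_bound (\<lambda>i j. a i j - trunc m a i j) e"
proof -
  obtain c where c: "c \<in> stab B" "a = mmult (madj c) c" using assms by (auto simp: cu_pos_def)
  obtain C where C: "mat_bound c C" using stab_bounded[OF c(1)] by blast
  have C0: "0 \<le> C" using C by (rule mat_bound_nonneg)
  define d where "d = e / (2 * C + 1)"
  have d: "d > 0" "2 * C * d \<le> e" using assms(2) C0 by (simp_all add: d_def field_simps add_nonneg_pos)
  obtain N where N: "\<And>m. m \<ge> N \<Longrightarrow> mat_bound (\<lambda>i j. c i j - trunc m c i j) d"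
    using stab_tail[OF c(1) d(1)] by blast
  have "op_bound r s (\<lambda>i j. a i j - trunc m a i j) e" if m: "m \<ge> N" for m r s
  proof -
    \<comment> \<open>\<open>c\<close> without its columns from \<open>m\<close> on; its Gram matrix
      is \<open>trunc m a\<close>.\<close>
    define w where "w = (\<lambda>k i. if i < m then c k i else 0)"
    have w: "op_bound K q w C" for K q
      using op_bound_mask[OF mat_boundD[OF C, of K q], of "\<lambda>_. True" "\<lambda>i. i < m"] by (simp add: w_def)
    have cw: "op_bound K q (\<lambda>k i. c k i - w k i) d" for K q
    proof -
      \<comment> \<open>On the deleted columns \<open>trunc m c\<close> vanishes, so the difference
        is a mask of the small matrix \<open>c - trunc m c\<close>.\<close>
      have "(\<lambda>k i. c k i - w k i) = (\<lambda>k i. if True \<and> \<not> i < m then c k i - trunc m c k i else 0)"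
        by (auto simp: w_def trunc_def fun_eq_iff)
      then show ?thesis
        using op_bound_mask[OF mat_boundD[OF N[OF m], of K q], of "\<lambda>_. True" "\<lambda>i. \<not> i < m"] by simp
    qed
    let ?x = "\<lambda>K i j. (\<Sum>k<K. adj (c k i) * c k j) - (\<Sum>k<K. adj (w k i) * w k j)"
    have lim: "(\<lambda>K. ?x K i j) \<longlonglongrightarrow> a i j - trunc m a i j" for i j
    proof (intro tendsto_diff)
      show l: "(\<lambda>K. \<Sum>k<K. adj (c k i) * c k j) \<longlonglongrightarrow> a i j"
        unfolding c(2) using mmult_madj_tendsto[OF C C] c(1) by blast
      have "(\<lambda>K. \<Sum>k<K. adj (w k i) * w k j) = (\<lambda>K. if i < m \<and> j < m then \<Sum>k<K. adj (c k i) * c k j else 0)"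
        by (auto simp: w_def fun_eq_iff)
      then show "(\<lambda>K. \<Sum>k<K. adj (w k i) * w k j) \<longlonglongrightarrow> trunc m a i j"
        by (cases "i < m"; cases "j < m") (use l in \<open>simp_all add: trunc_def\<close>)
    qed
    have "op_bound r s (?x K) (2 * C * d)" for K
      by (rule op_bound_gram_diff) (rule mat_boundD[OF C] w cw)+
    then have "op_bound r s (\<lambda>i j. a i j - trunc m a i j) (2 * C * d)"
      by (intro op_bound_limit[OF sequentially_bot _ lim]) auto
    then show ?thesis by (rule op_bound_mono) (rule d(2))
  qed
  then show ?thesis by (intro that[of N]) (simp add: mat_bound_def)
qed

text \<open>A finite counterpart of the nested \<open>mmult\<close>: its sums are finite, so
  asymptotic relations can be applied term by term.\<close>

definition sandwich :: "nat \<Rightarrow> 'a::cstar_algebra mat \<Rightarrow> 'a mat \<Rightarrow> 'a mat" where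
  "sandwich n v b = (\<lambda>i j. \<Sum>k<n. (\<Sum>l<n. adj (v l i) * b l k) * v k j)"

text \<open>The finite sandwich sees only the first \<open>n\<close> rows of \<open>v\<close>, and
  the remaining rows are small on the columns below \<open>n\<close>. The error is split between the
  two outer factors.\<close>

lemma sandwich_approx:
  assumes v: "v \<in> stab A" and b: "mat_bound b D" and e: "e > 0"
  obtains N where "\<And>n. n \<ge> N \<Longrightarrow>
    op_bound n n (\<lambda>i j. sandwich n v b i j - mmult (mmult (madj v) b) v i j) e"
proof -
  obtain C where C: "mat_bound v C" using stab_bounded[OF v] by blast
  have C0: "0 \<le> C" "0 \<le> D" using C b by (auto intro: mat_bound_nonneg)
  define d where "d = e / (2 * D * C + 1)"
  have d: "d > 0" using e C0 by (simp add: d_def add_nonneg_pos)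
  have d2: "d * D * C + C * D * d \<le> e" 
  proof -
    have "d * (2 * D * C + 1) = e" using C0 by (simp add: d_def add_nonneg_eq_0_iff)
    then show ?thesis using d by (simp add: algebra_simps)
  qed
  obtain N where N: "\<And>m. m \<ge> N \<Longrightarrow> mat_bound (\<lambda>i j. v i j - trunc m v i j) d"
    using stab_tail[OF v d] by blast
  have "op_bound n n (\<lambda>i j. sandwich n v b i j - mmult (mmult (madj v) b) v i j) e" if n: "n \<ge> N" for n
  proof -
    define w where "w = (\<lambda>k i. if k < n then v k i else 0)"
    have w: "op_bound K q w C" for K q
      using op_bound_mask[OF mat_boundD[OF C, of K q], of "\<lambda>k. k < n" "\<lambda>_. True"] by (simp add: w_def)
    have vw: "op_bound K n (\<lambda>k i. v k i - w k i) d" for K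
    proof -
      have "op_bound K n (\<lambda>k i. if \<not> k < n \<and> True then v k i - trunc n v k i else 0) d"
        by (rule op_bound_mask[OF mat_boundD[OF N[OF n]]])
      then show ?thesis by (rule op_bound_cong[THEN iffD1, rotated]) (auto simp: w_def trunc_def)
    qed
    let ?G = "\<lambda>K L i j. \<Sum>k<K. (\<Sum>l<L. adj (v l i) * b l k) * v k j"
    have "op_bound n n (\<lambda>i j. sandwich n v b i j - ?G K L i j) e" if KL: "K \<ge> n" "L \<ge> n" for K L
    proof -
      have s: "sandwich n v b i j = (\<Sum>k<K. (\<Sum>l<L. adj (w l i) * b l k) * w k j)" for i j
      proof -
        have "(\<Sum>l<L. adj (w l i) * b l k) = (\<Sum>l<n. adj (v l i) * b l k)" for k
          using KL by (intro sum.mono_neutral_cong_right) (auto simp: w_def)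
        then show ?thesis unfolding sandwich_def
          using KL by (intro sum.mono_neutral_cong_left) (auto simp: w_def)
      qed
      have "op_bound n n (\<lambda>i j. (\<Sum>k<K. (\<Sum>l<L. adj (v l i - w l i) * b l k) * v k j)
           + (\<Sum>k<K. (\<Sum>l<L. adj (w l i) * b l k) * (v k j - w k j))) (d * D * C + C * D * d)"
        by (rule op_bound_add[OF op_bound_mult[OF op_bound_mult[OF op_bound_adj[OF vw] mat_boundD[OF b]] mat_boundD[OF C]]
           op_bound_mult[OF op_bound_mult[OF op_bound_adj[OF w] mat_boundD[OF b]] vw]])
      then have "op_bound n n (\<lambda>i j. ?G K L i j - sandwich n v b i j) (d * D * C + C * D * d)"
        unfolding s by (simp add: adj_diff left_diff_distrib right_diff_distrib sum_subtractf)
      from op_bound_minus[OF this] show ?thesis using op_bound_mono[OF _ d2] by simp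
    qed note GL = this
    have i1: "(\<lambda>L. \<Sum>l<L. adj (v l i) * b l k) \<longlonglongrightarrow> mmult (madj v) b i k" for i k
      using mmult_madj_tendsto[OF C b] v by blast
    have i2: "(\<lambda>K. \<Sum>k<K. mmult (madj v) b i k * v k j) \<longlonglongrightarrow> mmult (mmult (madj v) b) v i j" for i j
    proof -
      \<comment> \<open>\<open>mmult_madj_tendsto\<close> wants the left factor as an adjoint, so
        the inner product matrix is read as the adjoint of its adjoint; the small tails now come
        from the right factor \<open>v\<close>.\<close>
      have "mat_bound (madj (mmult (madj v) b)) (C * D)"
        using mat_bound_mmult_madj[OF C b] v by (blast intro: mat_bound_madj)
      from mmult_madj_tendsto[OF this C, of UNIV A i j] show ?thesis using v
        by (simp add: madj_def adj_adj)
    qed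
    \<comment> \<open>The limits are nested, so the bound passes to the limit in \<open>L\<close>
      with \<open>K\<close> fixed, and afterwards to the limit in \<open>K\<close>.\<close>
    have "op_bound n n (\<lambda>i j. sandwich n v b i j - (\<Sum>k<K. mmult (madj v) b i k * v k j)) e" if K: "K \<ge> n" for K
    proof (rule op_bound_limit[OF sequentially_bot])
      show "\<forall>\<^sub>F L in sequentially. op_bound n n (\<lambda>i j. sandwich n v b i j - ?G K L i j) e"
        using eventually_ge_at_top[of n] by eventually_elim (rule GL[OF K])
    qed (intro tendsto_intros i1)
    then show ?thesis
      by (intro op_bound_limit[OF sequentially_bot, where x = "\<lambda>K i j. sandwich n v b i j - (\<Sum>k<K. mmult (madj v) b i k * v k j)"])
         (auto intro: eventually_sequentiallyI[of n] tendsto_intros i2)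
  qed
  then show ?thesis using that by blast
qed

lemma sandwich_zero_extend:
  assumes "\<And>i j. \<not> (i < n \<and> j < n) \<Longrightarrow> w i j = (0::'a::cstar_algebra)"
  shows "mmult (mmult (madj w) b) w = trunc n (sandwich n w b)"
proof -
  have ev: "(\<lambda>m. \<Sum>k<m. f k) \<longlonglongrightarrow> (\<Sum>k<n. f k)" if "\<And>k. k \<ge> n \<Longrightarrow> f k = 0" for f :: "nat \<Rightarrow> 'a"
  proof (rule tendsto_eventually, rule eventually_sequentiallyI[of n])
    fix m assume "n \<le> m"
    then show "(\<Sum>k<m. f k) = (\<Sum>k<n. f k)"
      by (intro sum.mono_neutral_right) (use that in auto)
  qed
  have 1: "mmult (madj w) b i k = (\<Sum>l<n. adj (w l i) * b l k)" for i k
    unfolding mmult_def madj_def by (rule limI[OF ev]) (use assms in auto)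
  have 2: "mmult (mmult (madj w) b) w i j = sandwich n w b i j" for i j
    unfolding mmult_def[of "mmult (madj w) b"] sandwich_def 1 by (rule limI[OF ev]) (use assms in auto)
  have "sandwich n w b i j = 0" if "\<not> (i < n \<and> j < n)" for i j
  proof (cases "i < n")
    case True
    then have "\<And>k. w k j = 0" using that assms by auto
    then show ?thesis by (simp add: sandwich_def)
  next
    case False
    then have "\<And>k. w k i = 0" using assms by auto
    then show ?thesis by (simp add: sandwich_def)
  qed
  then show ?thesis by (auto simp: fun_eq_iff trunc_def 2)
qed

lemma finite_matrix_in_stab:
  assumes "\<And>i j. w i j \<in> B" "\<And>i j. \<not> (i < n \<and> j < n) \<Longrightarrow> w i j = (0::'a::cstar_algebra)"
  shows "w \<in> stab B"
proof -
  have "(\<lambda>i j. w i j - trunc m w i j) = (\<lambda>i j. 0)" if "m \<ge> n" for m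
    using assms(2) that by (fastforce simp: fun_eq_iff trunc_def)
  moreover have "mnorm_n k (\<lambda>i j. 0::'a) \<le> 0" for k
    by (rule mnorm_n_le) (simp add: op_bound_def)
  ultimately have "mnorm_n k (\<lambda>i j. w i j - trunc m w i j) < e" if "m \<ge> n" "e > 0" for m k e
    using that by (metis le_less_trans)
  then show ?thesis using assms(1) by (auto simp: stab_def)
qed

lemma mnorm_le: "mat_bound x C \<Longrightarrow> mnorm x \<le> C"
  unfolding mnorm_def by (rule cSUP_least) (auto intro: mnorm_n_le mat_boundD)

lemma mat_bound_mnorm:
  assumes "mat_bound x C" shows "op_bound n n x (mnorm x)" and "0 \<le> mnorm x"
proof -
  have "bdd_above (range (\<lambda>n. mnorm_n n x))"
    by (rule bdd_aboveI[of _ C]) (auto intro: mnorm_n_le mat_boundD[OF assms])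
  then have le: "mnorm_n n x \<le> mnorm x" for n unfolding mnorm_def by (rule cSUP_upper[rotated]) simp
  show "op_bound n n x (mnorm x)" by (rule op_bound_mono[OF op_bound_mnorm_n le])
  show "0 \<le> mnorm x" using le[of 0] mnorm_n_nonneg[of 0 x] by linarith
qed

section \<open>Almost invariant elements\<close>

lemma psd_cstar_aut:
  assumes "cstar_aut h" "psd x" shows "psd (h x)"
proof -
  obtain k where "adj k = k" "x = k * k" using assms(2) by (auto simp: psd_def)
  then have "adj (h k) = h k" "h x = h k * h k"
    using assms(1) unfolding cstar_aut_def by metis+
  then show ?thesis by (auto simp: psd_def)
qed

lemma cstar_aut_one:
  assumes "cstar_aut h" shows "h 1 = 1"
proof -
  obtain x where "h x = 1" using assms unfolding cstar_aut_def by (metis bij_pointE)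
  then have "h 1 = h 1 * h x" by simp
  also have "\<dots> = h (1 * x)" using assms unfolding cstar_aut_def by metis
  finally show ?thesis using \<open>h x = 1\<close> by simp
qed

lemma cstar_aut_linear:
  assumes "cstar_aut h" shows "linear h"
proof (rule linearI)
  show "h (x + y) = h x + h y" for x y using assms unfolding cstar_aut_def by metis
  show "h (r *\<^sub>R x) = r *\<^sub>R h x" for r x using assms unfolding cstar_aut_def by (metis cscale_of_real)
qed

text \<open>The norm is recovered from the order: the scalar \<open>?t\<close> minus
  \<open>adj x * x\<close> is positive, an automorphism preserves this and fixes 1, and a scalar
  bound for a positive element is a norm bound.\<close>

lemma cstar_aut_norm_le:
  assumes "cstar_aut h" shows "norm (h x) \<le> norm x"
proof -
  let ?t = "(norm x)\<^sup>2"
  interpret linear h by (rule cstar_aut_linear[OF assms])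
  have "psd (?t *\<^sub>R 1 - adj x * x)"
    by (rule psd_norm_diff) (auto simp: adj_mult adj_adj norm_adj_mult_self)
  then have "psd (h (?t *\<^sub>R 1 - adj x * x))" by (rule psd_cstar_aut[OF assms])
  also have "h (?t *\<^sub>R 1 - adj x * x) = ?t *\<^sub>R 1 - adj (h x) * h x"
    using assms by (simp add: diff scaleR cstar_aut_one) (metis cstar_aut_def)
  finally have "norm (adj (h x) * h x) \<le> ?t" by (rule psd_le_scalar_norm[OF psd_adj_mult]) simp
  then show ?thesis by (simp add: norm_adj_mult_self)
qed

text \<open>The functions \<open>r g\<close> play the role of distances from \<open>g\<close>, read
  off from orbits in \<open>A\<close>; their sublevel sets are open and contain \<open>g\<close>, so
  finitely many of them cover.\<close>

lemma compact_finite_net: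
  assumes "compact (UNIV :: 'g::topological_space set)"
    and "\<And>g. continuous_on UNIV (r g :: 'g \<Rightarrow> real)" "\<And>g. r g g < d"
  obtains F where "finite F" "\<And>h. \<exists>g\<in>F. r g h < d"
proof -
  have "open {h. r g h < d}" for g by (intro open_Collect_less assms continuous_intros)
  moreover have "UNIV \<subseteq> (\<Union>g. {h. r g h < d})" using assms(3) by blast
  ultimately obtain F where F: "finite F" "UNIV \<subseteq> (\<Union>g\<in>F. {h. r g h < d})"
    by (rule compactE_image[OF assms(1), where f = "\<lambda>g. {h. r g h < d}"])
  then have "\<exists>g\<in>F. r g h < d" for h by auto
  then show ?thesis by (rule that[OF F(1)])
qed

locale compact_action =
  fixes \<alpha> :: "'g::{t2_space,group_add} \<Rightarrow> 'a::cstar_algebra \<Rightarrow> 'a"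
  assumes compact: "compact_group TYPE('g)" and action: "cstar_action \<alpha>"
begin

lemma compact_UNIV: "compact (UNIV :: 'g set)"
  using compact by (simp add: compact_group_def)

lemma act_aut: "cstar_aut (\<alpha> g)"
  using action by (simp add: cstar_action_def)

lemma act_add: "\<alpha> g (x + y) = \<alpha> g x + \<alpha> g y"
  and act_mult: "\<alpha> g (x * y) = \<alpha> g x * \<alpha> g y"
  and act_adj: "\<alpha> g (adj x) = adj (\<alpha> g x)"
  using act_aut[of g] by (auto simp: cstar_aut_def)

lemma act_act: "\<alpha> g (\<alpha> h x) = \<alpha> (g + h) x"
  using action by (simp add: cstar_action_def)

lemma act_0 [simp]: "\<alpha> 0 x = x"
  using action by (simp add: cstar_action_def)

lemma linear_act: "linear (\<alpha> g)"
  by (rule cstar_aut_linear[OF act_aut])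

lemma act_diff: "\<alpha> g (x - y) = \<alpha> g x - \<alpha> g y"
  by (rule linear_diff[OF linear_act])

lemma act_scaleR: "\<alpha> g (c *\<^sub>R x) = c *\<^sub>R \<alpha> g x"
  by (rule linear_cmul[OF linear_act])

lemma act_sum: "\<alpha> g (sum f S) = (\<Sum>i\<in>S. \<alpha> g (f i))"
  by (rule linear_sum[OF linear_act])

lemma act_zero [simp]: "\<alpha> g 0 = 0"
  by (rule linear_0[OF linear_act])

lemma norm_act [simp]: "norm (\<alpha> g x) = norm x"
proof (rule antisym)
  show "norm (\<alpha> g x) \<le> norm x" by (rule cstar_aut_norm_le[OF act_aut])
  show "norm x \<le> norm (\<alpha> g x)"
    using cstar_aut_norm_le[OF act_aut, of "- g" "\<alpha> g x"] by (simp add: act_act)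
qed

lemma bounded_linear_act: "bounded_linear (\<alpha> g)"
  by (rule bounded_linear_intro[where K=1]) (auto simp: act_add act_scaleR)

lemma tendsto_act [tendsto_intros]: "(f \<longlongrightarrow> l) F \<Longrightarrow> ((\<lambda>x. \<alpha> g (f x)) \<longlongrightarrow> \<alpha> g l) F"
  by (rule bounded_linear.tendsto[OF bounded_linear_act])

lemma continuous_act: "continuous_on UNIV (\<lambda>g. \<alpha> g x)"
  using action by (simp add: cstar_action_def)

lemma norm_act_diff: "norm (\<alpha> g x - \<alpha> h y) = norm (x - \<alpha> (- g + h) y)"
proof -
  have "\<alpha> g x - \<alpha> h y = \<alpha> g (x - \<alpha> (- g + h) y)" by (simp add: act_diff act_act add.assoc[symmetric])
  then show ?thesis by simp
qed

text \<open>An invariant convex set that contains all averages formed below. It lies in every ball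
  around \<open>w\<close> that contains the orbit, which controls how far averaging moves a
  point.\<close>

definition orbit_hull :: "'a \<Rightarrow> 'a set" where
  "orbit_hull w = convex hull range (\<lambda>g. \<alpha> g w)"

lemma in_orbit_hull: "w \<in> orbit_hull w"
  unfolding orbit_hull_def by (rule hull_inc) (metis act_0 rangeI)

lemma act_in_orbit_hull: "x \<in> orbit_hull w \<Longrightarrow> \<alpha> g x \<in> orbit_hull w"
proof -
  assume "x \<in> orbit_hull w"
  then have "\<alpha> g x \<in> convex hull (\<alpha> g ` range (\<lambda>g. \<alpha> g w))"
    unfolding orbit_hull_def using convex_hull_linear_image[OF linear_act] by blast
  also have "\<dots> \<subseteq> orbit_hull w"
    unfolding orbit_hull_def by (rule hull_mono) (auto simp: act_act)
  finally show ?thesis .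
qed

text \<open>One net must serve the whole hull, because the gain of an averaging step depends on its
  cardinality. The points that \<open>h\<close> and \<open>g\<close> move almost alike form a convex
  set, so it is enough to treat the orbit of \<open>w\<close>, and up to \<open>e / 3\<close> a
  finite part of it.\<close>

lemma orbit_hull_net:
  assumes "e > 0"
  obtains F where "finite F" "\<And>h. \<exists>g\<in>F. \<forall>x\<in>orbit_hull w. norm (\<alpha> h x - \<alpha> g x) \<le> e"
proof -
  define r where "r = (\<lambda>k h. norm (\<alpha> h w - \<alpha> k w))"
  have "\<And>g. continuous_on UNIV (r g)" unfolding r_def by (intro continuous_intros continuous_act)
  moreover have "\<And>g. r g g < e / 3" using assms by (simp add: r_def)
  ultimately obtain F1 where F1: "finite F1" "\<And>h. \<exists>g\<in>F1. r g h < e / 3"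
    using compact_finite_net[OF compact_UNIV] by metis
  \<comment> \<open>Summing over the representatives in \<open>F1\<close> gives a net that handles
    all of them simultaneously.\<close>
  define s where "s = (\<lambda>g h. \<Sum>k\<in>F1. norm (\<alpha> h (\<alpha> k w) - \<alpha> g (\<alpha> k w)))"
  have "\<And>g. continuous_on UNIV (s g)" unfolding s_def by (intro continuous_intros continuous_act)
  moreover have "\<And>g. s g g < e / 3" using assms by (simp add: s_def)
  ultimately obtain F where F: "finite F" "\<And>h. \<exists>g\<in>F. s g h < e / 3"
    using compact_finite_net[OF compact_UNIV] by metis
  have "\<exists>g\<in>F. \<forall>x\<in>orbit_hull w. norm (\<alpha> h x - \<alpha> g x) \<le> e" for h
  proof -
    obtain g where g: "g \<in> F" "s g h < e / 3" using F by blast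
    let ?f = "\<lambda>x. \<alpha> h x - \<alpha> g x"
    have "?f (\<alpha> k w) \<in> cball 0 e" for k
    proof -
      obtain k' where k': "k' \<in> F1" "r k' k < e / 3" using F1 by blast
      have "norm (?f (\<alpha> k' w)) \<le> s g h" unfolding s_def
        by (rule member_le_sum[OF k'(1)]) (use F1 in auto)
      moreover have "?f (\<alpha> k w) = \<alpha> h (\<alpha> k w - \<alpha> k' w) + (?f (\<alpha> k' w) - \<alpha> g (\<alpha> k w - \<alpha> k' w))"
        by (simp add: act_diff)
      then have "norm (?f (\<alpha> k w)) \<le> norm (\<alpha> h (\<alpha> k w - \<alpha> k' w)) + (norm (?f (\<alpha> k' w)) + norm (\<alpha> g (\<alpha> k w - \<alpha> k' w)))"
        by (simp only:) (intro order_trans[OF norm_triangle_ineq] add_left_mono norm_triangle_ineq4)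
      ultimately show ?thesis using k'(2) g(2) by (simp add: r_def)
    qed
    then have "range (\<lambda>g. \<alpha> g w) \<subseteq> ?f -` cball 0 e" by auto
    moreover have "convex (?f -` cball 0 e)"
      by (intro convex_linear_vimage linear_compose_sub linear_act convex_cball)
    ultimately have "orbit_hull w \<subseteq> ?f -` cball 0 e" unfolding orbit_hull_def by (rule hull_minimal)
    then have "\<forall>x\<in>orbit_hull w. norm (?f x) \<le> e" by (auto simp: subset_iff)
    then show ?thesis using g(1) by blast
  qed
  then show ?thesis using that F(1) by blast
qed

text \<open>For each \<open>k\<close> some \<open>\<alpha> g x\<close> with \<open>g\<close> in
  \<open>F\<close> is within \<open>e\<close> of \<open>\<alpha> k x\<close> and the others are
  within \<open>d\<close>, so the mean distance falls by \<open>(d - e) / card F\<close>. Since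
  \<open>\<alpha> h z\<close> is a mean of orbit points, it is that close to \<open>z\<close> as
  well.\<close>

lemma average_contracts:
  assumes F: "finite F" "\<And>h. \<exists>g\<in>F. norm (\<alpha> h x - \<alpha> g x) \<le> e"
    and d: "\<And>g. norm (\<alpha> g x - x) \<le> d"
  defines "z \<equiv> \<Sum>g\<in>F. inverse (real (card F)) *\<^sub>R \<alpha> g x"
  shows "norm (\<alpha> h z - z) \<le> d - (d - e) / real (card F)"
proof -
  let ?n = "real (card F)"
  have ne: "F \<noteq> {}" using F(2) by blast
  then have n: "?n > 0" using F(1) by (simp add: card_gt_0_iff)
  have avg: "y = (\<Sum>g\<in>F. inverse ?n *\<^sub>R y)" for y :: 'a
    unfolding sum_constant_scaleR using n by simp
  have near: "norm (\<alpha> k x - z) \<le> d - (d - e) / ?n" for k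
  proof -
    obtain g0 where g0: "g0 \<in> F" "norm (\<alpha> k x - \<alpha> g0 x) \<le> e" using F(2) by blast
    have "\<alpha> k x - z = (\<Sum>g\<in>F. inverse ?n *\<^sub>R (\<alpha> k x - \<alpha> g x))"
      unfolding z_def scaleR_right_diff_distrib sum_subtractf using avg[of "\<alpha> k x"] by simp
    also have "norm \<dots> \<le> (\<Sum>g\<in>F. inverse ?n * norm (\<alpha> k x - \<alpha> g x))"
      by (rule order_trans[OF norm_sum]) simp
    also have "\<dots> = inverse ?n * (norm (\<alpha> k x - \<alpha> g0 x) + (\<Sum>g\<in>F-{g0}. norm (\<alpha> k x - \<alpha> g x)))"
      using F(1) g0(1) by (simp add: sum_distrib_left[symmetric] sum.remove)
    also have "\<dots> \<le> inverse ?n * (e + (\<Sum>g\<in>F-{g0}. d))"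
    proof (intro mult_left_mono add_mono g0 sum_mono)
      fix g
      show "norm (\<alpha> k x - \<alpha> g x) \<le> d"
        unfolding norm_act_diff using d[of "- k + g"] by (simp add: norm_minus_commute)
    qed (use n in simp)
    also have "\<dots> = inverse ?n * (e + (?n - 1) * d)"
      using F(1) g0(1) n by (simp add: of_nat_diff)
    also have "\<dots> = d - (d - e) / ?n" using n by (simp add: field_simps)
    finally show ?thesis .
  qed
  have "\<alpha> h z - z = (\<Sum>g\<in>F. inverse ?n *\<^sub>R (\<alpha> (h + g) x - z))"
    unfolding scaleR_right_diff_distrib sum_subtractf avg[of z, symmetric]
    by (simp add: z_def act_sum act_scaleR act_act)
  also have "norm \<dots> \<le> (\<Sum>g\<in>F. inverse ?n * norm (\<alpha> (h + g) x - z))"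
    by (rule order_trans[OF norm_sum]) simp
  also have "\<dots> \<le> (\<Sum>g\<in>F. inverse ?n * (d - (d - e) / ?n))"
    using n by (intro sum_mono mult_left_mono near) auto
  also have "\<dots> = d - (d - e) / ?n" using n by simp
  finally show ?thesis .
qed

text \<open>Were the infimum of the displacements in the hull at least \<open>e\<close>, averaging
  over an \<open>e / 2\<close>-net of one size for all points would lower each displacement by at
  least \<open>e / (2 * card F)\<close>, contradicting a nearly minimal choice.\<close>

lemma almost_fixed_in_orbit_hull:
  assumes "e > 0"
  shows "\<exists>x\<in>orbit_hull w. \<forall>g. norm (\<alpha> g x - x) \<le> e"
proof -
  let ?D = "{d. \<exists>x\<in>orbit_hull w. \<forall>g. norm (\<alpha> g x - x) \<le> d}"
  have nonneg: "0 \<le> d" if "d \<in> ?D" for d using that norm_ge_zero order_trans by blast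
  have "norm (\<alpha> g w - w) \<le> 2 * norm w" for g using norm_triangle_ineq4[of "\<alpha> g w" w] by simp
  then have ne: "?D \<noteq> {}" using in_orbit_hull by blast
  have bdd: "bdd_below ?D" using nonneg by (rule bdd_belowI)
  have "Inf ?D < e"
  proof (rule ccontr)
    assume "\<not> Inf ?D < e"
    then have ge: "e \<le> d" if "d \<in> ?D" for d using cInf_lower[OF that bdd] by linarith
    obtain F where F: "finite F" "\<And>h. \<exists>g\<in>F. \<forall>x\<in>orbit_hull w. norm (\<alpha> h x - \<alpha> g x) \<le> e / 2"
      using orbit_hull_net[of "e / 2"] assms by auto
    let ?n = "real (card F)"
    have "F \<noteq> {}" using F(2) by blast
    then have n: "?n > 0" using F(1) by (simp add: card_gt_0_iff)
    have "Inf ?D < Inf ?D + e / (2 * ?n)" using assms n by simp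
    then obtain d where d: "d \<in> ?D" "d < Inf ?D + e / (2 * ?n)"
      using cInf_lessD[OF ne] by blast
    then obtain x where x: "x \<in> orbit_hull w" "\<And>g. norm (\<alpha> g x - x) \<le> d" by blast
    define z where "z = (\<Sum>g\<in>F. inverse ?n *\<^sub>R \<alpha> g x)"
    have "norm (\<alpha> h z - z) \<le> d - (d - e / 2) / ?n" for h
      unfolding z_def by (rule average_contracts[OF F(1) _ x(2)]) (use F(2) x(1) in blast)
    moreover have "z \<in> orbit_hull w"
      unfolding z_def
    proof (rule convex_sum[OF F(1)])
      show "convex (orbit_hull w)" by (simp add: orbit_hull_def)
    qed (use n x act_in_orbit_hull in auto)
    ultimately have "Inf ?D \<le> d - (d - e / 2) / ?n" using bdd by (intro cInf_lower) auto
    moreover have "e / (2 * ?n) \<le> (d - e / 2) / ?n"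
      using ge[OF d(1)] n by (simp add: field_simps)
    ultimately show False using d(2) by linarith
  qed
  then obtain d where "d \<in> ?D" "d < e" using cInf_lessD[OF ne] by blast
  then obtain x where "x \<in> orbit_hull w" "\<And>g. norm (\<alpha> g x - x) \<le> d" by blast
  then show ?thesis using \<open>d < e\<close> by (meson less_imp_le order_trans)
qed

lemma almost_fixed_step:
  assumes "\<And>g. norm (\<alpha> g w - w) \<le> d" "e > 0"
  shows "\<exists>x. (\<forall>g. norm (\<alpha> g x - x) \<le> e) \<and> norm (x - w) \<le> d"
proof -
  obtain x where x: "x \<in> orbit_hull w" "\<forall>g. norm (\<alpha> g x - x) \<le> e"
    using almost_fixed_in_orbit_hull[OF assms(2)] by blast
  have "orbit_hull w \<subseteq> cball w d"
    unfolding orbit_hull_def by (rule hull_minimal) (use assms(1) in \<open>auto simp: dist_norm norm_minus_commute\<close>)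
  then have "norm (x - w) \<le> d" using x(1) by (auto simp: dist_norm norm_minus_commute)
  then show ?thesis using x(2) by blast
qed

text \<open>Almost fixed points with displacements \<open>d / 2^k\<close> are chosen successively,
  each within the displacement of its predecessor. The factor 2 is the sum of the geometric
  series.\<close>

lemma fixed_point_near:
  assumes d: "\<And>g. norm (\<alpha> g w - w) \<le> d" and d0: "d > 0"
  obtains x where "x \<in> fixed_points \<alpha>" "norm (x - w) \<le> 2 * d"
proof -
  let ?P = "\<lambda>k x. \<forall>g. norm (\<alpha> g x - x) \<le> d * (1/2) ^ k"
  \<comment> \<open>The clause for \<open>k = 0\<close> pins the first term of the chosen sequence
    to \<open>w\<close>.\<close>
  have "\<exists>f. \<forall>k. (?P k (f k) \<and> (k = 0 \<longrightarrow> f k = w)) \<and> norm (f (Suc k) - f k) \<le> d * (1/2) ^ k"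
  proof (rule dependent_nat_choice)
    show "\<exists>x. ?P 0 x \<and> (0 = (0::nat) \<longrightarrow> x = w)" using d by auto
    fix x k assume "?P k x \<and> (k = 0 \<longrightarrow> x = w)"
    then show "\<exists>y. (?P (Suc k) y \<and> (Suc k = 0 \<longrightarrow> y = w)) \<and> norm (y - x) \<le> d * (1/2) ^ k"
      using almost_fixed_step[of x "d * (1/2) ^ k" "d * (1/2) ^ Suc k"] d0 by auto
  qed
  then obtain f where f: "\<And>k g. norm (\<alpha> g (f k) - f k) \<le> d * (1/2) ^ k" "f 0 = w"
      "\<And>k. norm (f (Suc k) - f k) \<le> d * (1/2) ^ k" by blast
  have g: "(\<lambda>k. d * (1/2) ^ k) sums (d * 2)" using sums_mult[OF geometric_sums[of "1/2::real"], of d] by simp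
  have sn: "summable (\<lambda>k. norm (f (Suc k) - f k))"
    by (rule summable_comparison_test'[OF sums_summable[OF g], of 0]) (use f(3) in simp)
  define x where "x = w + (\<Sum>k. f (Suc k) - f k)"
  have "(\<lambda>n. w + (\<Sum>k<n. f (Suc k) - f k)) \<longlonglongrightarrow> x"
    unfolding x_def by (intro tendsto_intros summable_LIMSEQ summable_norm_cancel[OF sn])
  then have lim: "f \<longlonglongrightarrow> x" by (simp add: sum_lessThan_telescope f(2))
  have "norm (x - w) \<le> (\<Sum>k. norm (f (Suc k) - f k))" unfolding x_def using summable_norm[OF sn] by simp
  also have "\<dots> \<le> d * 2"
    using suminf_le[OF _ sn sums_summable[OF g]] f(3) sums_unique[OF g] by simp
  finally have "norm (x - w) \<le> 2 * d" by simp
  moreover have "\<alpha> g x = x" for g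
  proof -
    have "(\<lambda>k. \<alpha> g (f k) - f k) \<longlonglongrightarrow> 0"
      by (rule Lim_null_comparison[OF _ sums_summable[OF g, THEN summable_LIMSEQ_zero]]) (use f(1) in auto)
    moreover have "(\<lambda>k. \<alpha> g (f k) - f k) \<longlonglongrightarrow> \<alpha> g x - x" by (intro tendsto_intros lim)
    ultimately show ?thesis using LIMSEQ_unique by fastforce
  qed
  ultimately show ?thesis using that by (auto simp: fixed_points_def)
qed

end

section \<open>Sequences modulo null sequences\<close>

text \<open>Equality in the quotient of bounded by null sequences. Boundedness belongs to the
  relation so that products respect it.\<close>

definition aeq :: "(nat \<Rightarrow> 'a::real_normed_algebra) \<Rightarrow> (nat \<Rightarrow> 'a) \<Rightarrow> bool" where
  "aeq x y \<longleftrightarrow> Bseq x \<and> Bseq y \<and> (\<lambda>n. x n - y n) \<longlonglongrightarrow> 0"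

lemma aeq_refl: "Bseq x \<Longrightarrow> aeq x x"
  by (simp add: aeq_def)

lemma aeq_const: "aeq (\<lambda>n. c) (\<lambda>n. c)"
  by (simp add: aeq_def)

lemma aeq_sym: "aeq x y \<Longrightarrow> aeq y x"
  unfolding aeq_def using tendsto_minus[of "\<lambda>n. x n - y n" 0 sequentially] by simp

lemma aeq_trans [trans]: "aeq x y \<Longrightarrow> aeq y z \<Longrightarrow> aeq x z"
  unfolding aeq_def using tendsto_add[of "\<lambda>n. x n - y n" 0 sequentially "\<lambda>n. y n - z n" 0] by simp

lemma Bseq_add': "Bseq x \<Longrightarrow> Bseq y \<Longrightarrow> Bseq (\<lambda>n. x n + y n :: 'a::real_normed_vector)"
  unfolding Bseq_eq_bounded by (rule bounded_plus_comp)

lemma Bseq_mult': "Bseq x \<Longrightarrow> Bseq y \<Longrightarrow> Bseq (\<lambda>n. x n * y n :: 'a::real_normed_algebra)"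
  unfolding Bseq_def
proof safe
  fix K L :: real assume K: "0 < K" "\<forall>n. norm (x n) \<le> K" "0 < L" "\<forall>n. norm (y n) \<le> L"
  have "norm (x n * y n) \<le> K * L" for n
    using K by (intro order_trans[OF norm_mult_ineq] mult_mono) auto
  then show "\<exists>K>0. \<forall>n. norm (x n * y n) \<le> K" using K by (intro exI[of _ "K * L"]) auto
qed

lemma aeq_add:
  assumes "aeq x y" "aeq u v" shows "aeq (\<lambda>n. x n + u n) (\<lambda>n. y n + v n)"
proof -
  have "(\<lambda>n. (x n + u n) - (y n + v n)) \<longlonglongrightarrow> 0"
    using tendsto_add[of "\<lambda>n. x n - y n" 0 sequentially "\<lambda>n. u n - v n" 0] assms
    by (simp add: aeq_def algebra_simps)
  then show ?thesis using assms by (simp add: aeq_def Bseq_add')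
qed

lemma aeq_minus: "aeq x y \<Longrightarrow> aeq (\<lambda>n. - x n) (\<lambda>n. - y n)"
  unfolding aeq_def using tendsto_minus[of "\<lambda>n. x n - y n" 0 sequentially] by (simp add: Bseq_minus_iff)

lemma aeq_diff: "aeq x y \<Longrightarrow> aeq u v \<Longrightarrow> aeq (\<lambda>n. x n - u n) (\<lambda>n. y n - v n)"
  using aeq_add[OF _ aeq_minus, of x y u v] by simp

lemma aeq_mult:
  assumes "aeq x y" "aeq u v" shows "aeq (\<lambda>n. x n * u n) (\<lambda>n. y n * v n)"
proof -
  have "(\<lambda>n. x n * (u n - v n)) \<longlonglongrightarrow> 0"
    using bounded_bilinear.Bfun_prod_Zfun[OF bounded_bilinear_mult, of x sequentially "\<lambda>n. u n - v n"] assms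
    by (simp add: aeq_def tendsto_Zfun_iff)
  moreover have "(\<lambda>n. (x n - y n) * v n) \<longlonglongrightarrow> 0"
    using bounded_bilinear.Zfun_prod_Bfun[OF bounded_bilinear_mult, of "\<lambda>n. x n - y n" sequentially v] assms
    by (simp add: aeq_def tendsto_Zfun_iff)
  ultimately have "(\<lambda>n. x n * (u n - v n) + (x n - y n) * v n) \<longlonglongrightarrow> 0" using tendsto_add by fastforce
  then show ?thesis using assms by (simp add: aeq_def Bseq_mult' algebra_simps)
qed

lemma aeq_sum: "(\<And>j. j \<in> J \<Longrightarrow> aeq (x j) (y j)) \<Longrightarrow> aeq (\<lambda>n. \<Sum>j\<in>J. x j n) (\<lambda>n. \<Sum>j\<in>J. y j n)"
  by (induction J rule: infinite_finite_induct) (auto intro: aeq_add simp: aeq_const)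

section \<open>The Rokhlin property\<close>

locale rokhlin_map = compact_action \<alpha>
  for \<alpha> :: "'g::{t2_space,group_add} \<Rightarrow> 'a::cstar_algebra \<Rightarrow> 'a" +
  fixes \<phi> :: "('g \<Rightarrow> complex) \<Rightarrow> nat \<Rightarrow> 'a"
  assumes bounded: "continuous_on UNIV f \<Longrightarrow> bounded (range (\<phi> f))"
    and equicontinuous: "continuous_on UNIV f \<Longrightarrow> e > 0 \<Longrightarrow>
      eventually (\<lambda>g. \<forall>n. norm (\<alpha> g (\<phi> f n) - \<alpha> g0 (\<phi> f n)) \<le> e) (nhds g0)"
    and central: "continuous_on UNIV f \<Longrightarrow> (\<lambda>n. \<phi> f n * a - a * \<phi> f n) \<longlonglongrightarrow> 0"
    and equivariant: "continuous_on UNIV f \<Longrightarrow> (\<lambda>n. \<phi> (\<lambda>h. f (- g + h)) n - \<alpha> g (\<phi> f n)) \<longlonglongrightarrow> 0"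
    and star: "continuous_on UNIV f \<Longrightarrow> (\<lambda>n. \<phi> (\<lambda>h. cnj (f h)) n - adj (\<phi> f n)) \<longlonglongrightarrow> 0"
    and homogeneous: "continuous_on UNIV f \<Longrightarrow> (\<lambda>n. \<phi> (\<lambda>h. c * f h) n - cscale c (\<phi> f n)) \<longlonglongrightarrow> 0"
    and additive: "continuous_on UNIV f \<Longrightarrow> continuous_on UNIV f' \<Longrightarrow>
      (\<lambda>n. \<phi> (\<lambda>h. f h + f' h) n - (\<phi> f n + \<phi> f' n)) \<longlonglongrightarrow> 0"
    and multiplicative: "continuous_on UNIV f \<Longrightarrow> continuous_on UNIV f' \<Longrightarrow>
      (\<lambda>n. \<phi> (\<lambda>h. f h * f' h) n - \<phi> f n * \<phi> f' n) \<longlonglongrightarrow> 0"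
    and unital: "(\<lambda>n. \<phi> (\<lambda>h. 1) n - 1) \<longlonglongrightarrow> 0"
begin

abbreviation \<psi> :: "('g \<Rightarrow> real) \<Rightarrow> nat \<Rightarrow> 'a" where
  "\<psi> q \<equiv> \<phi> (\<lambda>h. complex_of_real (q h))"

lemma Bseq_psi: "continuous_on UNIV q \<Longrightarrow> Bseq (\<psi> q)"
  unfolding Bseq_eq_bounded by (intro bounded continuous_intros)

lemma aeq_psi: "continuous_on UNIV q \<Longrightarrow> aeq (\<psi> q) (\<psi> q)"
  by (intro aeq_refl Bseq_psi)

lemma psi_adj: "continuous_on UNIV q \<Longrightarrow> aeq (\<psi> q) (\<lambda>n. adj (\<psi> q n))"
  unfolding aeq_def using star[of "\<lambda>h. complex_of_real (q h)"] Bseq_psi[of q]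
  by (simp add: Bseq_def continuous_on_of_real)

lemma psi_central: "continuous_on UNIV q \<Longrightarrow> aeq (\<lambda>n. \<psi> q n * c) (\<lambda>n. c * \<psi> q n)"
  unfolding aeq_def using central[of "\<lambda>h. complex_of_real (q h)" c]
  by (simp add: continuous_on_of_real Bseq_mult' Bseq_psi)

lemma psi_mult: "continuous_on UNIV q \<Longrightarrow> continuous_on UNIV r \<Longrightarrow>
    aeq (\<psi> (\<lambda>h. q h * r h)) (\<lambda>n. \<psi> q n * \<psi> r n)"
  unfolding aeq_def
  using multiplicative[of "\<lambda>h. complex_of_real (q h)" "\<lambda>h. complex_of_real (r h)"]
    Bseq_psi[of "\<lambda>h. q h * r h"]
  by (simp add: continuous_on_of_real Bseq_mult' Bseq_psi continuous_on_mult)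

lemma psi_add: "continuous_on UNIV q \<Longrightarrow> continuous_on UNIV r \<Longrightarrow>
    aeq (\<psi> (\<lambda>h. q h + r h)) (\<lambda>n. \<psi> q n + \<psi> r n)"
  unfolding aeq_def
  using additive[of "\<lambda>h. complex_of_real (q h)" "\<lambda>h. complex_of_real (r h)"]
    Bseq_psi[of "\<lambda>h. q h + r h"]
  by (simp add: continuous_on_of_real Bseq_add' Bseq_psi continuous_on_add)

lemma psi_zero: "aeq (\<psi> (\<lambda>h. 0)) (\<lambda>n. 0)"
  unfolding aeq_def using homogeneous[of "\<lambda>h. 1" 0] Bseq_psi[of "\<lambda>h. 0"] by simp

lemma psi_one: "aeq (\<psi> (\<lambda>h. 1)) (\<lambda>n. 1)"
  unfolding aeq_def using unital Bseq_psi[of "\<lambda>h. 1"] by simp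

lemma psi_sum:
  assumes "finite J" "\<And>j. j \<in> J \<Longrightarrow> continuous_on UNIV (q j)"
  shows "aeq (\<psi> (\<lambda>h. \<Sum>j\<in>J. q j h)) (\<lambda>n. \<Sum>j\<in>J. \<psi> (q j) n)"
  using assms
proof (induction J rule: finite_induct)
  case empty
  then show ?case using psi_zero by simp
next
  case (insert j J)
  have "aeq (\<psi> (\<lambda>h. q j h + (\<Sum>j\<in>J. q j h))) (\<lambda>n. \<psi> (q j) n + \<psi> (\<lambda>h. \<Sum>j\<in>J. q j h) n)"
    using insert by (intro psi_add continuous_on_sum) auto
  also have "aeq \<dots> (\<lambda>n. \<psi> (q j) n + (\<Sum>j\<in>J. \<psi> (q j) n))"
    using insert by (intro aeq_add aeq_psi) auto
  finally show ?case using insert by simp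
qed

lemma psi_shift: 
  assumes "continuous_on UNIV q" "continuous_on UNIV (\<lambda>h. q (- g + h))"
  shows "aeq (\<lambda>n. \<alpha> g (\<psi> q n)) (\<psi> (\<lambda>h. q (- g + h)))"
proof (rule aeq_sym)
  have "Bseq (\<lambda>n. \<alpha> g (\<psi> q n))" using Bseq_psi[OF assms(1)] by (simp add: Bseq_def)
  then show "aeq (\<psi> (\<lambda>h. q (- g + h))) (\<lambda>n. \<alpha> g (\<psi> q n))"
    unfolding aeq_def using equivariant[of "\<lambda>h. complex_of_real (q h)" g] Bseq_psi[OF assms(2)] assms(1)
    by (simp add: continuous_on_of_real)
qed

text \<open>A square root of the coefficient function can be moved to either side of
  \<open>c\<close> by asymptotic centrality; the result is the shape that
  \<open>op_bound_block_sum\<close> accepts.\<close>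

lemma psi_square_sandwich:
  assumes e: "continuous_on UNIV e"
  shows "aeq (\<lambda>n. \<psi> (\<lambda>h. e h * e h) n * c) (\<lambda>n. adj (\<psi> e n) * c * \<psi> e n)"
proof -
  have "aeq (\<lambda>n. \<psi> (\<lambda>h. e h * e h) n * c) (\<lambda>n. \<psi> e n * \<psi> e n * c)"
    by (intro aeq_mult psi_mult aeq_const e)
  also have "aeq \<dots> (\<lambda>n. adj (\<psi> e n) * (c * \<psi> e n))"
    unfolding mult.assoc by (intro aeq_mult psi_adj psi_central e)
  finally show ?thesis by (simp add: mult.assoc)
qed

text \<open>The left side is the shape of one summand in an entry of the sandwich of a glued matrix;
  asymptotic centrality collects both factors in front.\<close>

lemma psi_product_sandwich:
  assumes p: "continuous_on UNIV p" and q: "continuous_on UNIV q"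
  shows "aeq (\<lambda>n. x * adj (\<psi> p n) * y * \<psi> q n * z) (\<lambda>n. \<psi> (\<lambda>h. p h * q h) n * (x * y * z))"
proof -
  have "aeq (\<lambda>n. x * adj (\<psi> p n) * y * \<psi> q n * z) (\<lambda>n. x * \<psi> p n * y * \<psi> q n * z)"
    by (intro aeq_mult aeq_const aeq_psi aeq_sym[OF psi_adj] p q)
  also have "aeq \<dots> (\<lambda>n. \<psi> p n * x * y * \<psi> q n * z)"
    by (intro aeq_mult aeq_const aeq_psi aeq_sym[OF psi_central] p q)
  also have "(\<lambda>n. \<psi> p n * x * y * \<psi> q n * z) = (\<lambda>n. \<psi> p n * ((x * y) * \<psi> q n) * z)"
    by (simp add: mult.assoc)
  also have "aeq \<dots> (\<lambda>n. \<psi> p n * (\<psi> q n * (x * y)) * z)"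
    by (intro aeq_mult aeq_const aeq_psi aeq_sym[OF psi_central] p q)
  also have "(\<lambda>n. \<psi> p n * (\<psi> q n * (x * y)) * z) = (\<lambda>n. \<psi> p n * \<psi> q n * (x * y * z))"
    by (simp add: mult.assoc)
  also have "aeq \<dots> (\<lambda>n. \<psi> (\<lambda>h. p h * q h) n * (x * y * z))"
    by (intro aeq_mult aeq_const aeq_sym[OF psi_mult] p q)
  finally show ?thesis .
qed

text \<open>The map \<open>\<Sum> q\<^sub>j \<otimes> x\<^sub>j \<mapsto> \<Sum> \<psi>(q\<^sub>j) x\<^sub>j\<close> is asymptotically contractive on partitions of unity:
  splitting \<open>q\<^sub>j\<close> as a square exhibits the sum as a compression of a block diagonal matrix.\<close>
lemma partition_sum_bound:
  assumes J: "finite J" and q: "\<And>j. j \<in> J \<Longrightarrow> continuous_on UNIV (q j)"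
    and pos: "\<And>j h. j \<in> J \<Longrightarrow> 0 \<le> q j h" and one: "\<And>h. (\<Sum>j\<in>J. q j h) = 1"
    and x: "\<And>j h. j \<in> J \<Longrightarrow> q j h \<noteq> 0 \<Longrightarrow> op_bound N N (x j) C" and C: "0 \<le> C"
    and y: "\<And>i k. i < N \<Longrightarrow> k < N \<Longrightarrow> aeq (\<lambda>n. y n i k) (\<lambda>n. \<Sum>j\<in>J. \<psi> (q j) n * x j i k)"
    and d: "d > 0"
  shows "eventually (\<lambda>n. op_bound N N (y n) (C + d)) sequentially"
proof -
  \<comment> \<open>The bound on \<open>x j\<close> is available only if \<open>q j\<close> is
    nonzero somewhere; the other indices contribute null sequences and are dropped.\<close>
  define I where "I = {j\<in>J. \<exists>h. q j h \<noteq> 0}"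
  have I: "finite I" "I \<subseteq> J" using J by (auto simp: I_def)
  define e where "e = (\<lambda>j h. sqrt (q j h))"
  have e: "continuous_on UNIV (e j)" if "j \<in> J" for j
    unfolding e_def by (intro continuous_intros q that)
  have ee: "e j h * e j h = q j h" if "j \<in> J" for j h
    using pos[OF that] by (simp add: e_def)
  let ?z = "\<lambda>n i k. \<Sum>j\<in>I. adj (\<psi> (e j) n) * x j i k * \<psi> (e j) n"
  have yz: "aeq (\<lambda>n. y n i k) (\<lambda>n. ?z n i k)" if "i < N" "k < N" for i k
  proof -
    note y[OF that]
    also have "aeq (\<lambda>n. \<Sum>j\<in>J. \<psi> (q j) n * x j i k) (\<lambda>n. \<Sum>j\<in>J. if j \<in> I then \<psi> (q j) n * x j i k else 0)"
    proof (rule aeq_sum)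
      fix j assume j: "j \<in> J"
      show "aeq (\<lambda>n. \<psi> (q j) n * x j i k) (\<lambda>n. if j \<in> I then \<psi> (q j) n * x j i k else 0)"
      proof (cases "j \<in> I")
        case True
        then show ?thesis using q[OF j] by (simp add: aeq_mult aeq_psi aeq_const)
      next
        case False
        then have "q j = (\<lambda>h. 0)" using j by (auto simp: I_def)
        then show ?thesis using False aeq_mult[OF psi_zero aeq_const, of "x j i k"] by simp
      qed
    qed
    also have "(\<lambda>n. \<Sum>j\<in>J. if j \<in> I then \<psi> (q j) n * x j i k else 0) = (\<lambda>n. \<Sum>j\<in>I. \<psi> (q j) n * x j i k)"
      using J I(2) by (simp add: sum.inter_restrict[symmetric] Int_absorb1)
    also have "aeq \<dots> (\<lambda>n. ?z n i k)"
    proof (rule aeq_sum)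
      fix j assume "j \<in> I"
      then have j: "j \<in> J" using I by auto
      show "aeq (\<lambda>n. \<psi> (q j) n * x j i k) (\<lambda>n. adj (\<psi> (e j) n) * x j i k * \<psi> (e j) n)"
        using psi_square_sandwich[OF e[OF j], of "x j i k"] by (simp only: ee[OF j])
    qed
    finally show ?thesis .
  qed
  have oneI: "(\<Sum>j\<in>I. q j h) = 1" for h
  proof -
    have "(\<Sum>j\<in>I. q j h) = (\<Sum>j\<in>J. q j h)" using J by (intro sum.mono_neutral_left) (auto simp: I_def)
    then show ?thesis by (simp add: one)
  qed
  have "aeq (\<lambda>n. \<Sum>j\<in>I. adj (\<psi> (e j) n) * \<psi> (e j) n) (\<lambda>n. \<Sum>j\<in>I. \<psi> (q j) n)"
  proof (rule aeq_sum)
    fix j assume "j \<in> I"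
    then have j: "j \<in> J" using I by auto
    show "aeq (\<lambda>n. adj (\<psi> (e j) n) * \<psi> (e j) n) (\<psi> (q j))"
      using aeq_sym[OF psi_square_sandwich[OF e[OF j], of 1]] by (simp only: ee[OF j] mult_1_right)
  qed
  also have "aeq \<dots> (\<psi> (\<lambda>h. \<Sum>j\<in>I. q j h))"
    using I q by (intro aeq_sym[OF psi_sum]) auto
  also have "aeq \<dots> (\<lambda>n. 1)" using psi_one by (simp only: oneI)
  \<comment> \<open>Thus the factor \<open>K\<close> of the compression bound tends to 1, and
    \<open>C * K\<close> falls below \<open>C + d / 2\<close>.\<close>
  finally have "(\<lambda>n. \<Sum>j\<in>I. adj (\<psi> (e j) n) * \<psi> (e j) n) \<longlonglongrightarrow> 1"
    by (simp add: aeq_def LIM_zero_iff)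
  then have "(\<lambda>n. C * norm (\<Sum>j\<in>I. adj (\<psi> (e j) n) * \<psi> (e j) n)) \<longlonglongrightarrow> C * norm (1::'a)"
    by (intro tendsto_intros)
  then have "eventually (\<lambda>n. C * norm (\<Sum>j\<in>I. adj (\<psi> (e j) n) * \<psi> (e j) n) < C + d / 2) sequentially"
    by (rule order_tendstoD) (use d in simp)
  \<comment> \<open>An entrywise tolerance that costs at most \<open>d / 2\<close> over an
    \<open>N\<close> by \<open>N\<close> matrix, the other half of the margin.\<close>
  moreover define c where "c = d / (2 * (real N * real N + 1))"
  have c: "c > 0" "real N * real N * c \<le> d / 2"
    using d by (simp_all add: c_def field_simps add_pos_nonneg add_nonneg_pos)
  have "eventually (\<lambda>n. \<forall>i\<in>{..<N}. \<forall>k\<in>{..<N}. norm (y n i k - ?z n i k) < c) sequentially"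
  proof (intro eventually_ball_finite ballI)
    fix i k assume "i \<in> {..<N}" "k \<in> {..<N}"
    then have "(\<lambda>n. y n i k - ?z n i k) \<longlonglongrightarrow> 0" using yz by (simp add: aeq_def)
    then have "(\<lambda>n. norm (y n i k - ?z n i k)) \<longlonglongrightarrow> norm (0::'a)" by (rule tendsto_norm)
    then show "eventually (\<lambda>n. norm (y n i k - ?z n i k) < c) sequentially"
      by (rule order_tendstoD) (use c in simp)
  qed auto
  ultimately show ?thesis
  proof eventually_elim
    case (elim n)
    have "op_bound N N (?z n) (C * norm (\<Sum>j\<in>I. adj (\<psi> (e j) n) * \<psi> (e j) n))"
      using x C by (intro op_bound_block_sum) (auto simp: I_def)
    then have 1: "op_bound N N (?z n) (C + d / 2)" by (rule op_bound_mono) (use elim in simp)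
    have "op_bound N N (\<lambda>i k. y n i k - ?z n i k) (real N * real N * c)"
      using elim c by (intro op_bound_crude) (auto intro: less_imp_le)
    then have 2: "op_bound N N (\<lambda>i k. y n i k - ?z n i k) (d / 2)" by (rule op_bound_mono) (rule c)
    show ?case using op_bound_add[OF 2 1] by (simp add: add.commute)
  qed
qed

end

section \<open>Equicontinuous sequences and partitions of unity\<close>

context compact_action
begin

lemma continuous_translate:
  assumes "continuous_on UNIV (q :: 'g \<Rightarrow> 'b::topological_space)"
  shows "continuous_on UNIV (\<lambda>h. q (g + h))"
proof -
  have "continuous_on UNIV (\<lambda>p::'g \<times> 'g. fst p + snd p)" using compact by (simp add: compact_group_def)
  then have "continuous_on UNIV (\<lambda>h::'g. fst (g, h) + snd (g, h))"
    by (rule continuous_on_compose2) (auto intro: continuous_intros)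
  then have "continuous_on UNIV (\<lambda>h::'g. g + h)" by simp
  then show ?thesis by (rule continuous_on_compose2[OF assms]) simp
qed

lemma hnorm_act: "hnorm I (\<lambda>i. \<alpha> g (u i)) = hnorm I u"
proof -
  have "ip I (\<lambda>i. \<alpha> g (u i)) (\<lambda>i. \<alpha> g (u i)) = \<alpha> g (ip I u u)"
    by (simp add: act_sum act_mult act_adj)
  then show ?thesis by (simp add: hnorm_def)
qed

lemma op_bound_act:
  assumes "op_bound m n x C" shows "op_bound m n (\<lambda>i j. \<alpha> g (x i j)) C"
proof (rule op_boundI)
  show "0 \<le> C" using assms by (rule op_bound_nonneg)
  fix \<xi> :: "nat \<Rightarrow> 'a"
  have "(\<Sum>j<n. \<alpha> g (x i j) * \<xi> j) = \<alpha> g (\<Sum>j<n. x i j * \<alpha> (- g) (\<xi> j))" for i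
    by (simp add: act_sum act_mult act_act)
  then show "hnorm {..<m} (\<lambda>i. \<Sum>j<n. \<alpha> g (x i j) * \<xi> j) \<le> C * hnorm {..<n} \<xi>"
    using op_boundD[OF assms, of "\<lambda>j. \<alpha> (- g) (\<xi> j)"] by (simp add: hnorm_act)
qed

definition equicont :: "(nat \<Rightarrow> 'a) \<Rightarrow> bool" where
  "equicont x \<longleftrightarrow> (\<forall>g0. \<forall>e>0. \<forall>\<^sub>F g in nhds g0. \<forall>n. norm (\<alpha> g (x n) - \<alpha> g0 (x n)) \<le> e)"

lemma equicont_const: "equicont (\<lambda>n. c)"
  unfolding equicont_def
proof (intro allI impI)
  fix g0 :: 'g and e :: real assume e: "e > 0"
  have "((\<lambda>g. \<alpha> g c) \<longlongrightarrow> \<alpha> g0 c) (nhds g0)"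
    using continuous_act[of c] tendsto_at_iff_tendsto_nhds[of "\<lambda>g. \<alpha> g c" g0]
    by (simp add: continuous_on_eq_continuous_at isCont_def)
  then have "\<forall>\<^sub>F g in nhds g0. dist (\<alpha> g c) (\<alpha> g0 c) < e" using e by (rule tendstoD)
  then show "\<forall>\<^sub>F g in nhds g0. \<forall>n::nat. norm (\<alpha> g c - \<alpha> g0 c) \<le> e"
    by eventually_elim (simp add: dist_norm)
qed

lemma equicont_add:
  assumes "equicont x" "equicont y" shows "equicont (\<lambda>n. x n + y n)"
  unfolding equicont_def
proof (intro allI impI)
  fix g0 :: 'g and e :: real assume "e > 0"
  then have "e / 2 > 0" by simp
  then have "\<forall>\<^sub>F g in nhds g0. \<forall>n. norm (\<alpha> g (x n) - \<alpha> g0 (x n)) \<le> e / 2"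
    "\<forall>\<^sub>F g in nhds g0. \<forall>n. norm (\<alpha> g (y n) - \<alpha> g0 (y n)) \<le> e / 2"
    using assms unfolding equicont_def by blast+
  then show "\<forall>\<^sub>F g in nhds g0. \<forall>n. norm (\<alpha> g (x n + y n) - \<alpha> g0 (x n + y n)) \<le> e"
  proof eventually_elim
    case (elim g)
    show ?case
    proof
      fix n
      have "\<alpha> g (x n + y n) - \<alpha> g0 (x n + y n) = (\<alpha> g (x n) - \<alpha> g0 (x n)) + (\<alpha> g (y n) - \<alpha> g0 (y n))"
        by (simp add: act_add)
      also have "norm \<dots> \<le> e / 2 + e / 2" using elim by (intro norm_triangle_mono) auto
      finally show "norm (\<alpha> g (x n + y n) - \<alpha> g0 (x n + y n)) \<le> e" by simp
    qed
  qed
qed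

lemma equicont_sum: "(\<And>j. j \<in> J \<Longrightarrow> equicont (x j)) \<Longrightarrow> equicont (\<lambda>n. \<Sum>j\<in>J. x j n)"
  by (induction J rule: infinite_finite_induct) (auto intro: equicont_add simp: equicont_const)

lemma equicont_mult_const:
  assumes "equicont x" "Bseq x" shows "equicont (\<lambda>n. x n * c)"
  unfolding equicont_def
proof (intro allI impI)
  fix g0 :: 'g and e :: real assume e: "e > 0"
  obtain K where K: "K > 0" "\<And>n. norm (x n) \<le> K" using assms(2) by (auto simp: Bseq_def)
  define d where "d = e / (K + norm c)"
  have Kc: "K + norm c > 0" using K(1) by (simp add: add_pos_nonneg)
  have "d * (K + norm c) = e" using Kc by (simp add: d_def)
  then have d: "K * d + d * norm c = e" "d > 0" using e Kc by (simp add: algebra_simps, simp add: d_def)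
  have "\<forall>\<^sub>F g in nhds g0. \<forall>n. norm (\<alpha> g (x n) - \<alpha> g0 (x n)) \<le> d"
    "\<forall>\<^sub>F g in nhds g0. \<forall>n::nat. norm (\<alpha> g c - \<alpha> g0 c) \<le> d"
    using assms(1) equicont_const[of c] d(2) unfolding equicont_def by blast+
  then show "\<forall>\<^sub>F g in nhds g0. \<forall>n. norm (\<alpha> g (x n * c) - \<alpha> g0 (x n * c)) \<le> e"
  proof eventually_elim
    case (elim g)
    show ?case
    proof
      fix n
      have "\<alpha> g (x n * c) - \<alpha> g0 (x n * c) = \<alpha> g (x n) * (\<alpha> g c - \<alpha> g0 c) + (\<alpha> g (x n) - \<alpha> g0 (x n)) * \<alpha> g0 c"
        by (simp add: act_mult algebra_simps)
      also have "norm \<dots> \<le> K * d + d * norm c"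
        using elim K d(2) by (intro norm_triangle_mono order_trans[OF norm_mult_ineq] mult_mono) auto
      finally show "norm (\<alpha> g (x n * c) - \<alpha> g0 (x n * c)) \<le> e" by (simp add: d(1))
    qed
  qed
qed

text \<open>The threshold in \<open>n\<close> depends on \<open>g\<close>. Equicontinuity carries an
  estimate at \<open>g0\<close> to a neighbourhood for all \<open>n\<close> at once, so by
  compactness finitely many thresholds suffice.\<close>

lemma equicont_uniform:
  assumes x: "equicont x" and c: "\<And>g. \<forall>\<^sub>F n in sequentially. norm (\<alpha> g (x n) - x n) \<le> c" and e: "e > 0"
  shows "\<forall>\<^sub>F n in sequentially. \<forall>g. norm (\<alpha> g (x n) - x n) \<le> c + e"
proof -
  have "\<exists>U. open U \<and> g0 \<in> U \<and> (\<forall>g\<in>U. \<forall>n. norm (\<alpha> g (x n) - \<alpha> g0 (x n)) \<le> e)" for g0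
    using x e unfolding equicont_def eventually_nhds by blast
  then obtain U where U: "\<And>g0. open (U g0)" "\<And>g0. g0 \<in> U g0"
      "\<And>g0 g n. g \<in> U g0 \<Longrightarrow> norm (\<alpha> g (x n) - \<alpha> g0 (x n)) \<le> e"
    by metis
  have "UNIV \<subseteq> (\<Union>g. U g)" using U(2) by blast
  with U(1) obtain F where F: "finite F" "UNIV \<subseteq> (\<Union>g\<in>F. U g)"
    by (rule compactE_image[OF compact_UNIV])
  have "\<forall>\<^sub>F n in sequentially. \<forall>g\<in>F. norm (\<alpha> g (x n) - x n) \<le> c"
    using F(1) c by (intro eventually_ball_finite) auto
  then show ?thesis
  proof eventually_elim
    case (elim n)
    show ?case
    proof
      fix g
      obtain g0 where g0: "g0 \<in> F" "g \<in> U g0" using F(2) by blast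
      have "\<alpha> g (x n) - x n = (\<alpha> g0 (x n) - x n) + (\<alpha> g (x n) - \<alpha> g0 (x n))" by simp
      also have "norm \<dots> \<le> c + e" using elim g0 U(3) by (intro norm_triangle_mono) auto
      finally show "norm (\<alpha> g (x n) - x n) \<le> c + e" .
    qed
  qed
qed

end

text \<open>The bumps \<open>max 0 (d - r g h)\<close> live exactly where \<open>r g h < d\<close>;
  as a finite net covers the group, their sum is positive everywhere and can be divided out.\<close>

lemma partition_of_unity_net:
  assumes "compact (UNIV :: 'g::topological_space set)"
    and r: "\<And>g. continuous_on UNIV (r g :: 'g \<Rightarrow> real)" "\<And>g. r g g < d"
  obtains F p where "finite F" "\<And>g. continuous_on UNIV (p g :: 'g \<Rightarrow> real)" "\<And>g h. 0 \<le> p g h"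
    "\<And>h. (\<Sum>g\<in>F. p g h) = 1" "\<And>g h. p g h \<noteq> 0 \<Longrightarrow> r g h < d"
proof -
  obtain F where F: "finite F" "\<And>h. \<exists>g\<in>F. r g h < d" using compact_finite_net[OF assms] by metis
  define t where "t = (\<lambda>g h. max 0 (d - r g h))"
  define S where "S = (\<lambda>h. \<Sum>g\<in>F. t g h)"
  have S: "S h > 0" for h
  proof -
    obtain g where g: "g \<in> F" "r g h < d" using F(2) by blast
    then have "0 < t g h" by (simp add: t_def)
    also have "\<dots> \<le> S h" unfolding S_def by (rule member_le_sum) (use F g in \<open>auto simp: t_def\<close>)
    finally show ?thesis .
  qed
  have ct: "continuous_on UNIV (t g)" for g unfolding t_def by (intro continuous_intros r)
  show ?thesis
  proof (rule that[of F "\<lambda>g h. t g h / S h"])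
    show "continuous_on UNIV (\<lambda>h. t g h / S h)" for g
      unfolding S_def using S by (intro continuous_intros ct ballI) (metis S_def less_irrefl)
    show "0 \<le> t g h / S h" for g h using S[of h] by (simp add: t_def)
    show "(\<Sum>g\<in>F. t g h / S h) = 1" for h
      using S[of h] by (simp add: sum_divide_distrib[symmetric] S_def)
    show "r g h < d" if "t g h / S h \<noteq> 0" for g h using that by (auto simp: t_def max_def split: if_splits)
  qed (rule F)
qed

lemma sandwich_diff_bound:
  assumes "op_bound n n x X" "op_bound n n y Y" "op_bound n n b B" "op_bound n n (\<lambda>i j. x i j - y i j) e"
  shows "op_bound n n (\<lambda>i j. sandwich n x b i j - sandwich n y b i j) (e * B * X + Y * B * e)"
proof -
  have "op_bound n n (\<lambda>i j. (\<Sum>k<n. (\<Sum>l<n. adj (x l i - y l i) * b l k) * x k j)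
       + (\<Sum>k<n. (\<Sum>l<n. adj (y l i) * b l k) * (x k j - y k j))) (e * B * X + Y * B * e)"
    by (rule op_bound_add[OF op_bound_mult[OF op_bound_mult[OF op_bound_adj[OF assms(4)] assms(3)] assms(1)]
         op_bound_mult[OF op_bound_mult[OF op_bound_adj[OF assms(2)] assms(3)] assms(4)]])
  then show ?thesis
    unfolding sandwich_def by (simp add: adj_diff left_diff_distrib right_diff_distrib sum_subtractf)
qed

lemma small_factor:
  fixes A c :: real
  assumes "A \<ge> 0" "c > 0"
  obtains x where "x > 0" "A * x \<le> c"
proof (rule that[of "c / (A + 1)"])
  show "c / (A + 1) > 0" "A * (c / (A + 1)) \<le> c" using assms by (simp_all add: field_simps add_nonneg_pos)
qed

section \<open>Gluing translates of a matrix along a partition of unity\<close>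

context rokhlin_map
begin

lemma equicont_psi: "continuous_on UNIV q \<Longrightarrow> equicont (\<psi> q)"
  unfolding equicont_def using equicontinuous[of "\<lambda>h. complex_of_real (q h)"]
  by (simp add: continuous_on_of_real)

lemma psi_partition:
  assumes "finite J" "\<And>j. j \<in> J \<Longrightarrow> continuous_on UNIV (q j)" "\<And>h. (\<Sum>j\<in>J. q j h) = f h"
  shows "aeq (\<lambda>n. \<psi> f n * c) (\<lambda>n. \<Sum>j\<in>J. \<psi> (q j) n * c)"
proof -
  have "aeq (\<psi> f) (\<lambda>n. \<Sum>j\<in>J. \<psi> (q j) n)"
    using psi_sum[of J q, OF assms(1,2)] by (simp only: assms(3))
  then have "aeq (\<lambda>n. \<psi> f n * c) (\<lambda>n. (\<Sum>j\<in>J. \<psi> (q j) n) * c)"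
    by (intro aeq_mult aeq_const)
  then show ?thesis by (simp add: sum_distrib_right)
qed

context
  fixes N :: nat and v :: "'a mat" and d :: real and F :: "'g set" and p :: "'g \<Rightarrow> 'g \<Rightarrow> real"
  assumes F: "finite F" and p: "\<And>g. continuous_on UNIV (p g)" and pos: "\<And>g h. 0 \<le> p g h"
    and one: "\<And>h. (\<Sum>g\<in>F. p g h) = 1"
    and supp: "\<And>g h i k. p g h \<noteq> 0 \<Longrightarrow> i < N \<Longrightarrow> k < N \<Longrightarrow> norm (\<alpha> g (v i k) - \<alpha> h (v i k)) \<le> d"
    and d: "d > 0"
begin

definition glue :: "nat \<Rightarrow> 'a mat" where
  "glue n i k = (\<Sum>g\<in>F. \<psi> (p g) n * \<alpha> g (v i k))"

lemma supp2:
  assumes "p s h \<noteq> 0" "p t h \<noteq> 0" "i < N" "k < N"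
  shows "norm (\<alpha> t (v i k) - \<alpha> s (v i k)) \<le> 2 * d"
proof -
  have "\<alpha> t (v i k) - \<alpha> s (v i k) = (\<alpha> t (v i k) - \<alpha> h (v i k)) - (\<alpha> s (v i k) - \<alpha> h (v i k))" by simp
  also have "norm \<dots> \<le> d + d"
    by (rule order_trans[OF norm_triangle_ineq4 add_mono]) (use supp assms in auto)
  finally show ?thesis by simp
qed

lemma glue_bound:
  assumes "op_bound N N v C" "e > 0"
  shows "\<forall>\<^sub>F n in sequentially. op_bound N N (glue n) (C + e)"
proof (rule partition_sum_bound[where J = F and q = p and x = "\<lambda>g i k. \<alpha> g (v i k)"])
  show "aeq (\<lambda>n. glue n i k) (\<lambda>n. \<Sum>g\<in>F. \<psi> (p g) n * \<alpha> g (v i k))" for i k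
    unfolding glue_def by (intro aeq_sum aeq_mult aeq_psi aeq_const p)
qed (use F p pos one assms op_bound_act op_bound_nonneg[OF assms(1)] in auto)

lemma equicont_glue: "equicont (\<lambda>n. glue n i k)"
  unfolding glue_def by (intro equicont_sum equicont_mult_const equicont_psi Bseq_psi p)

text \<open>\<open>\<alpha> g\<close> shifts the partition functions and replaces
  \<open>\<alpha> s\<close> by \<open>\<alpha> (g + s)\<close>. The two sums are compared over the
  common refinement by the products \<open>p' s h * p t h\<close>; where such a product is nonzero,
  both translates of \<open>v\<close> are close to \<open>\<alpha> h\<close> of it.\<close>

lemma glue_almost_fixed:
  assumes "e > 0"
  shows "\<forall>\<^sub>F n in sequentially. op_bound N N (\<lambda>i k. \<alpha> g (glue n i k) - glue n i k) (real N * real N * (2 * d) + e)"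
proof -
  define p' where "p' = (\<lambda>s h. p s (- g + h))"
  have p': "continuous_on UNIV (p' s)" for s unfolding p'_def by (rule continuous_translate[OF p])
  have one': "(\<Sum>s\<in>F. p' s h) = 1" for h by (simp add: p'_def one)
  define q where "q = (\<lambda>j h. p' (fst j) h * p (snd j) h)"
  have q: "continuous_on UNIV (q j)" for j unfolding q_def by (intro continuous_intros p p')
  define x where "x = (\<lambda>j i k. \<alpha> (g + fst j) (v i k) - \<alpha> (snd j) (v i k))"
  show ?thesis
  proof (rule partition_sum_bound[where J = "F \<times> F" and q = q and x = x])
    show "(\<Sum>j\<in>F \<times> F. q j h) = 1" for h
      by (simp add: sum.cartesian_product' q_def sum_product[symmetric] one one')
    fix i k assume ik: "i < N" "k < N"
    have "aeq (\<lambda>n. \<alpha> g (glue n i k)) (\<lambda>n. \<Sum>s\<in>F. \<psi> (p' s) n * \<alpha> (g + s) (v i k))"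
      unfolding glue_def act_sum act_mult act_act p'_def
      by (intro aeq_sum aeq_mult aeq_const psi_shift p continuous_translate)
    also have "aeq \<dots> (\<lambda>n. \<Sum>s\<in>F. \<Sum>t\<in>F. \<psi> (q (s, t)) n * \<alpha> (g + s) (v i k))"
    proof (intro aeq_sum psi_partition)
      show "(\<Sum>t\<in>F. q (s, t) h) = p' s h" for s h
        by (simp add: q_def sum_distrib_left[symmetric] one)
    qed (use F q in auto)
    finally have 1: "aeq (\<lambda>n. \<alpha> g (glue n i k)) (\<lambda>n. \<Sum>s\<in>F. \<Sum>t\<in>F. \<psi> (q (s, t)) n * \<alpha> (g + s) (v i k))" .
    have "aeq (\<lambda>n. glue n i k) (\<lambda>n. \<Sum>t\<in>F. \<Sum>s\<in>F. \<psi> (q (s, t)) n * \<alpha> t (v i k))"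
      unfolding glue_def
    proof (intro aeq_sum psi_partition)
      show "(\<Sum>s\<in>F. q (s, t) h) = p t h" for t h
        by (simp add: q_def sum_distrib_right[symmetric] one')
    qed (use F q in auto)
    also have "(\<lambda>n. \<Sum>t\<in>F. \<Sum>s\<in>F. \<psi> (q (s, t)) n * \<alpha> t (v i k)) = (\<lambda>n. \<Sum>s\<in>F. \<Sum>t\<in>F. \<psi> (q (s, t)) n * \<alpha> t (v i k))"
      by (rule ext) (rule sum.swap)
    finally have "aeq (\<lambda>n. glue n i k) \<dots>" .
    from aeq_diff[OF 1 this]
    show "aeq (\<lambda>n. \<alpha> g (glue n i k) - glue n i k) (\<lambda>n. \<Sum>j\<in>F \<times> F. \<psi> (q j) n * x j i k)"
      by (simp add: sum.cartesian_product' x_def right_diff_distrib sum_subtractf)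
  next
    fix j h assume "q j h \<noteq> 0"
    then have nz: "p (fst j) (- g + h) \<noteq> 0" "p (snd j) h \<noteq> 0" by (auto simp: q_def p'_def)
    show "op_bound N N (x j) (real N * real N * (2 * d))"
    proof (rule op_bound_crude)
      fix i k assume ik: "i < N" "k < N"
      \<comment> \<open>This is the support condition at the point \<open>- g + h\<close>,
        transported by the isometry \<open>\<alpha> g\<close>.\<close>
      have "norm (\<alpha> (g + fst j) (v i k) - \<alpha> h (v i k)) \<le> d"
        using supp[OF nz(1) ik] norm_act_diff[of g "\<alpha> (fst j) (v i k)" h "v i k"] by (simp add: act_act)
      moreover have "norm (\<alpha> (snd j) (v i k) - \<alpha> h (v i k)) \<le> d" by (rule supp[OF nz(2) ik])
      moreover have "x j i k = (\<alpha> (g + fst j) (v i k) - \<alpha> h (v i k)) - (\<alpha> (snd j) (v i k) - \<alpha> h (v i k))"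
        by (simp add: x_def)
      ultimately have "norm (x j i k) \<le> d + d"
        by (metis order_trans[OF norm_triangle_ineq4 add_mono])
      then show "norm (x j i k) \<le> 2 * d" by simp
    qed (use d in simp)
  qed (use F q assms d in \<open>auto simp: q_def p'_def pos\<close>)
qed

text \<open>Since \<open>a\<close> and \<open>b\<close> have fixed entries, a diagonal term
  \<open>Y s s - a\<close> is \<open>\<alpha> s\<close> of the original error and keeps the bound
  \<open>E\<close>. Replacing \<open>\<alpha> t\<close> by \<open>\<alpha> s\<close> in the right
  factor costs the summand with \<open>d\<close>.\<close>

lemma glue_sandwich:
  assumes b: "\<And>i k. b i k \<in> fixed_points \<alpha>" and a: "\<And>i k. a i k \<in> fixed_points \<alpha>"
    and vB: "op_bound N N v C" and bB: "op_bound N N b B"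
    and E: "op_bound N N (\<lambda>i k. sandwich N v b i k - a i k) E" and e: "e > 0"
  shows "\<forall>\<^sub>F n in sequentially. op_bound N N (\<lambda>i k. sandwich N (glue n) b i k - a i k)
     (E + C * B * (real N * real N * (2 * d)) + e)"
proof -
  define q where "q = (\<lambda>j h. p (fst j) h * p (snd j) h)"
  have q: "continuous_on UNIV (q j)" for j unfolding q_def by (intro continuous_intros p)
  define Y where "Y = (\<lambda>s t i k. \<Sum>m<N. (\<Sum>l<N. adj (\<alpha> s (v l i)) * b l m) * \<alpha> t (v m k))"
  define x where "x = (\<lambda>j i k. Y (fst j) (snd j) i k - a i k)"
  have qone: "(\<Sum>j\<in>F \<times> F. q j h) = 1" for h
    by (simp add: sum.cartesian_product' q_def sum_product[symmetric] one)
  show ?thesis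
  proof (rule partition_sum_bound[where J = "F \<times> F" and q = q and x = x])
    show "(\<Sum>j\<in>F \<times> F. q j h) = 1" for h by (rule qone)
    fix i k assume ik: "i < N" "k < N"
    \<comment> \<open>\<open>T\<close> is a term as it arises from expanding both glued factors;
      \<open>T'\<close> is the same term with the \<open>\<psi>\<close> factors moved to the front
      and merged.\<close>
    define T where "T = (\<lambda>j m l n. adj (\<alpha> (fst j) (v l i)) * adj (\<psi> (p (fst j)) n) * b l m * \<psi> (p (snd j)) n * \<alpha> (snd j) (v m k))"
    define T' where "T' = (\<lambda>j m l n. \<psi> (q j) n * (adj (\<alpha> (fst j) (v l i)) * b l m * \<alpha> (snd j) (v m k)))"
    have "sandwich N (glue n) b i k = (\<Sum>m<N. \<Sum>l<N. \<Sum>j\<in>F \<times> F. T j m l n)" for n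
    proof -
      have "adj (glue n l i) * b l m * glue n m k = (\<Sum>j\<in>F \<times> F. T j m l n)" for l m
        unfolding glue_def adj_sum sum_distrib_right[of _ _ "b l m"] sum_product
        by (simp add: sum.cartesian_product' T_def adj_mult mult.assoc)
      then show ?thesis unfolding sandwich_def sum_distrib_right by simp
    qed
    moreover have "aeq (\<lambda>n. \<Sum>m<N. \<Sum>l<N. \<Sum>j\<in>F \<times> F. T j m l n) (\<lambda>n. \<Sum>m<N. \<Sum>l<N. \<Sum>j\<in>F \<times> F. T' j m l n)"
      unfolding T_def T'_def q_def by (intro aeq_sum psi_product_sandwich p)
    moreover have "(\<Sum>m<N. \<Sum>l<N. \<Sum>j\<in>F \<times> F. T' j m l n) = (\<Sum>j\<in>F \<times> F. \<psi> (q j) n * Y (fst j) (snd j) i k)" for n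
    proof -
      have "(\<Sum>m<N. \<Sum>l<N. \<Sum>j\<in>F \<times> F. T' j m l n) = (\<Sum>m<N. \<Sum>j\<in>F \<times> F. \<Sum>l<N. T' j m l n)"
        by (intro sum.cong refl sum.swap)
      also have "\<dots> = (\<Sum>j\<in>F \<times> F. \<Sum>m<N. \<Sum>l<N. T' j m l n)" by (rule sum.swap)
      finally show ?thesis by (simp add: T'_def Y_def sum_distrib_left sum_distrib_right)
    qed
    ultimately have 1: "aeq (\<lambda>n. sandwich N (glue n) b i k) (\<lambda>n. \<Sum>j\<in>F \<times> F. \<psi> (q j) n * Y (fst j) (snd j) i k)"
      by simp
    \<comment> \<open>Spreading \<open>a\<close> over the same partition allows the difference to be
      formed coefficient by coefficient.\<close>
    have "aeq (\<lambda>n. a i k) (\<lambda>n. \<psi> (\<lambda>h. 1) n * a i k)"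
      using aeq_mult[OF aeq_sym[OF psi_one] aeq_const, of "a i k"] by simp
    also have "aeq \<dots> (\<lambda>n. \<Sum>j\<in>F \<times> F. \<psi> (q j) n * a i k)"
      by (rule psi_partition) (use F q qone in auto)
    finally have 2: "aeq (\<lambda>n. a i k) (\<lambda>n. \<Sum>j\<in>F \<times> F. \<psi> (q j) n * a i k)" .
    show "aeq (\<lambda>n. sandwich N (glue n) b i k - a i k) (\<lambda>n. \<Sum>j\<in>F \<times> F. \<psi> (q j) n * x j i k)"
      using aeq_diff[OF 1 2] by (simp add: x_def right_diff_distrib sum_subtractf)
  next
    fix j h assume "q j h \<noteq> 0"
    then have nz: "p (fst j) h \<noteq> 0" "p (snd j) h \<noteq> 0" by (auto simp: q_def)
    let ?s = "fst j" and ?t = "snd j"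
    have "op_bound N N (\<lambda>i k. \<alpha> ?s (sandwich N v b i k - a i k)) E" by (rule op_bound_act[OF E])
    moreover have "\<alpha> ?s (sandwich N v b i k - a i k) = Y ?s ?s i k - a i k" for i k
      using a b unfolding sandwich_def Y_def
      by (simp add: act_diff act_sum act_mult act_adj fixed_points_def)
    ultimately have 1: "op_bound N N (\<lambda>i k. Y ?s ?s i k - a i k) E" by simp
    have vt: "op_bound N N (\<lambda>i k. \<alpha> ?t (v i k) - \<alpha> ?s (v i k)) (real N * real N * (2 * d))"
      using supp2[OF nz] d by (intro op_bound_crude) auto
    have "op_bound N N (\<lambda>i k. \<Sum>m<N. (\<Sum>l<N. adj (\<alpha> ?s (v l i)) * b l m) * (\<alpha> ?t (v m k) - \<alpha> ?s (v m k)))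
        (C * B * (real N * real N * (2 * d)))"
      by (rule op_bound_mult[OF op_bound_mult[OF op_bound_adj[OF op_bound_act[OF vB]] bB] vt])
    from op_bound_add[OF 1 this]
    show "op_bound N N (x j) (E + C * B * (real N * real N * (2 * d)))"
      by (simp add: x_def Y_def right_diff_distrib sum_subtractf)
  next
    show "0 \<le> E + C * B * (real N * real N * (2 * d))"
      using op_bound_nonneg[OF E] op_bound_nonneg[OF vB] op_bound_nonneg[OF bB] d by simp
  qed (use F q e in \<open>auto simp: q_def pos\<close>)
qed

end

text \<open>Tolerances are chosen backwards: \<open>\<kappa>\<close> for moving entries to fixed
  points, then the mesh \<open>d\<close> depending on \<open>\<kappa>\<close>. The margin
  \<open>e\<close> is spent as \<open>e / 2\<close> on that move and \<open>e / 4\<close> each on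
  the mesh and on the limit in \<open>n\<close>.\<close>

lemma fixed_sandwich_exists:
  assumes b: "\<And>i k. b i k \<in> fixed_points \<alpha>" and a: "\<And>i k. a i k \<in> fixed_points \<alpha>"
    and E: "op_bound N N (\<lambda>i k. sandwich N v b i k - a i k) E" and e: "e > 0"
  obtains w where "\<And>i k. w i k \<in> fixed_points \<alpha>" "op_bound N N (\<lambda>i k. sandwich N w b i k - a i k) (E + e)"
proof -
  define C B M where "C = mnorm_n N v" and "B = mnorm_n N b" and "M = real N * real N"
  have vB: "op_bound N N v C" and bB: "op_bound N N b B" unfolding C_def B_def by (rule op_bound_mnorm_n)+
  have nn: "0 \<le> C" "0 \<le> B" "0 \<le> M" unfolding C_def B_def M_def by (simp_all add: mnorm_n_nonneg)
  \<comment> \<open>This yields \<open>M * \<kappa> \<le> 1\<close>, so the corrected matrix has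
    bound \<open>C + 2\<close>; the perturbation of the sandwich then carries the factor
    \<open>(C + 2) + (C + 1) = 2 * C + 3\<close>.\<close>
  obtain \<kappa> where \<kappa>: "\<kappa> > 0" "(M * (1 + B * (2 * C + 3))) * \<kappa> \<le> min 1 (e / 2)"
    using small_factor[of "M * (1 + B * (2 * C + 3))" "min 1 (e / 2)"] nn e by auto
  obtain d where d: "d > 0" "(2 * M + C * B * M * 2) * d \<le> min (\<kappa> / 4) (e / 4)"
    using small_factor[of "2 * M + C * B * M * 2" "min (\<kappa> / 4) (e / 4)"] nn e \<kappa>(1) by auto
  \<comment> \<open>The sum over all entries lets one partition serve every entry of
    \<open>v\<close>.\<close>
  define r where "r = (\<lambda>g h. \<Sum>i<N. \<Sum>k<N. norm (\<alpha> g (v i k) - \<alpha> h (v i k)))"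
  have "continuous_on UNIV (r g)" for g unfolding r_def by (intro continuous_intros continuous_act)
  moreover have "r g g < d" for g using d by (simp add: r_def)
  ultimately obtain F p where Fp: "finite F" "\<And>g. continuous_on UNIV (p g :: 'g \<Rightarrow> real)" "\<And>g h. 0 \<le> p g h"
    "\<And>h. (\<Sum>g\<in>F. p g h) = 1" "\<And>g h. p g h \<noteq> 0 \<Longrightarrow> r g h < d"
    using partition_of_unity_net[OF compact_UNIV] by metis
  have supp: "norm (\<alpha> g (v i k) - \<alpha> h (v i k)) \<le> d" if "p g h \<noteq> 0" "i < N" "k < N" for g h i k
  proof -
    have "norm (\<alpha> g (v i k) - \<alpha> h (v i k)) \<le> (\<Sum>k<N. norm (\<alpha> g (v i k) - \<alpha> h (v i k)))"
      using that by (intro member_le_sum) auto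
    also have "\<dots> \<le> r g h" unfolding r_def using that
      by (intro member_le_sum[of i _ "\<lambda>i. \<Sum>k<N. norm (\<alpha> g (v i k) - \<alpha> h (v i k))"]) (auto intro: sum_nonneg)
    finally show ?thesis using Fp(5)[OF that(1)] by simp
  qed
  note ctx = Fp(1-4) supp d(1)
  define W where "W = glue v F p"
  have "\<forall>\<^sub>F n in sequentially. \<forall>g. norm (\<alpha> g (W n i k) - W n i k) \<le> M * (2 * d) + \<kappa> / 8 + \<kappa> / 8"
    if "i < N" "k < N" for i k
  proof (rule equicont_uniform)
    show "equicont (\<lambda>n. W n i k)" unfolding W_def by (rule equicont_glue[OF ctx])
    show "\<forall>\<^sub>F n in sequentially. norm (\<alpha> g (W n i k) - W n i k) \<le> M * (2 * d) + \<kappa> / 8" for g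
    proof -
      have "\<forall>\<^sub>F n in sequentially. op_bound N N (\<lambda>i k. \<alpha> g (W n i k) - W n i k) (M * (2 * d) + \<kappa> / 8)"
        unfolding W_def M_def by (rule glue_almost_fixed[OF ctx]) (use \<kappa> in auto)
      then show ?thesis
        by eventually_elim (use op_bound_entry[of N N "\<lambda>i k. \<alpha> g (W n i k) - W n i k" for n] that in fastforce)
    qed
  qed (use \<kappa> in simp)
  then have "\<forall>\<^sub>F n in sequentially. \<forall>i\<in>{..<N}. \<forall>k\<in>{..<N}. \<forall>g. norm (\<alpha> g (W n i k) - W n i k) \<le> M * (2 * d) + \<kappa> / 8 + \<kappa> / 8"
    by (intro eventually_ball_finite ballI) auto
  moreover have "\<forall>\<^sub>F n in sequentially. op_bound N N (W n) (C + 1)"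
    unfolding W_def by (rule glue_bound[OF ctx vB]) auto
  moreover have "\<forall>\<^sub>F n in sequentially. op_bound N N (\<lambda>i k. sandwich N (W n) b i k - a i k) (E + C * B * (M * (2 * d)) + e / 4)"
    unfolding W_def M_def by (rule glue_sandwich[OF ctx b a vB bB E]) (use e in auto)
  ultimately have "\<forall>\<^sub>F n in sequentially. (\<forall>i\<in>{..<N}. \<forall>k\<in>{..<N}. \<forall>g. norm (\<alpha> g (W n i k) - W n i k) \<le> M * (2 * d) + \<kappa> / 8 + \<kappa> / 8)
      \<and> op_bound N N (W n) (C + 1)
      \<and> op_bound N N (\<lambda>i k. sandwich N (W n) b i k - a i k) (E + C * B * (M * (2 * d)) + e / 4)"
    by eventually_elim blast
  then obtain n where n: "\<And>i k g. i < N \<Longrightarrow> k < N \<Longrightarrow> norm (\<alpha> g (W n i k) - W n i k) \<le> M * (2 * d) + \<kappa> / 8 + \<kappa> / 8"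
      "op_bound N N (W n) (C + 1)"
      "op_bound N N (\<lambda>i k. sandwich N (W n) b i k - a i k) (E + C * B * (M * (2 * d)) + e / 4)"
    using eventually_happens'[OF sequentially_bot] by (metis (no_types, lifting) lessThan_iff)
  have "0 \<le> C * B * M * 2 * d" using nn d(1) by simp
  then have Md: "M * (2 * d) \<le> \<kappa> / 4" using d(2) by (simp add: algebra_simps)
  have "0 \<le> 2 * M * d" using nn d(1) by simp
  then have CBd: "C * B * (M * (2 * d)) \<le> e / 4" using d(2) by (simp add: algebra_simps)
  have "\<exists>y. y \<in> fixed_points \<alpha> \<and> (i < N \<and> k < N \<longrightarrow> norm (y - W n i k) \<le> \<kappa>)" for i k
  proof (cases "i < N \<and> k < N")
    case True
    \<comment> \<open>Half of \<open>\<kappa>\<close>, because \<open>fixed_point_near\<close>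
      doubles the displacement.\<close>
    have "norm (\<alpha> g (W n i k) - W n i k) \<le> \<kappa> / 2" for g
    proof -
      have "norm (\<alpha> g (W n i k) - W n i k) \<le> M * (2 * d) + \<kappa> / 8 + \<kappa> / 8" using True n(1) by blast
      then show ?thesis using Md by linarith
    qed
    then obtain y where "y \<in> fixed_points \<alpha>" "norm (y - W n i k) \<le> 2 * (\<kappa> / 2)"
      using fixed_point_near[of "W n i k" "\<kappa> / 2"] \<kappa>(1) by auto
    then show ?thesis by auto
  next
    case False
    then show ?thesis by (intro exI[of _ 0]) (auto simp: fixed_points_def)
  qed
  then obtain w where w: "\<And>i k. w i k \<in> fixed_points \<alpha>" "\<And>i k. i < N \<Longrightarrow> k < N \<Longrightarrow> norm (w i k - W n i k) \<le> \<kappa>"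
    by metis
  have wW: "op_bound N N (\<lambda>i k. w i k - W n i k) (M * \<kappa>)"
    unfolding M_def using w(2) \<kappa>(1) by (intro op_bound_crude) auto
  have "0 \<le> M * B * (2 * C + 3) * \<kappa>" using nn \<kappa>(1) by simp
  then have Mk: "M * \<kappa> \<le> 1" using \<kappa>(2) by (simp add: algebra_simps)
  have "op_bound N N w (C + 2)"
  proof -
    have "op_bound N N w (M * \<kappa> + (C + 1))" using op_bound_add[OF wW n(2)] by simp
    then show ?thesis by (rule op_bound_mono) (use Mk in simp)
  qed
  from sandwich_diff_bound[OF this n(2) bB wW]
  have 1: "op_bound N N (\<lambda>i k. sandwich N w b i k - sandwich N (W n) b i k) (M * \<kappa> * B * (C + 2) + (C + 1) * B * (M * \<kappa>))" .
  have "0 \<le> M * \<kappa>" using nn \<kappa>(1) by simp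
  then have 2: "M * \<kappa> * B * (C + 2) + (C + 1) * B * (M * \<kappa>) \<le> e / 2" using \<kappa>(2) by (simp add: algebra_simps)
  have "op_bound N N (\<lambda>i k. sandwich N w b i k - a i k)
     ((M * \<kappa> * B * (C + 2) + (C + 1) * B * (M * \<kappa>)) + (E + C * B * (M * (2 * d)) + e / 4))"
    using op_bound_add[OF 1 n(3)] by simp
  then have "op_bound N N (\<lambda>i k. sandwich N w b i k - a i k) (E + e)"
    by (rule op_bound_mono) (use 2 CBd in linarith)
  then show ?thesis using that w(1) by blast
qed

end

section \<open>Descent of Cuntz subequivalence to the fixed point algebra\<close>

lemma rokhlin_map_exists:
  assumes "compact_group TYPE('g::{t2_space,group_add})" "cstar_action \<alpha>" "rokhlin \<alpha>"
  obtains \<phi> where "rokhlin_map (\<alpha> :: 'g \<Rightarrow> 'a::cstar_algebra \<Rightarrow> 'a) \<phi>"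
proof -
  obtain \<phi> where \<phi>: "(\<forall>f. continuous_on UNIV f \<longrightarrow>
        bounded (range (\<phi> f))
        \<and> (\<forall>g0. \<forall>e>0. eventually (\<lambda>g. \<forall>n. norm (\<alpha> g (\<phi> f n) - \<alpha> g0 (\<phi> f n)) \<le> e) (nhds g0))
        \<and> (\<forall>a. (\<lambda>n. \<phi> f n * a - a * \<phi> f n) \<longlonglongrightarrow> 0)
        \<and> (\<forall>g. (\<lambda>n. \<phi> (\<lambda>h. f (- g + h)) n - \<alpha> g (\<phi> f n)) \<longlonglongrightarrow> 0)
        \<and> (\<lambda>n. \<phi> (\<lambda>h. cnj (f h)) n - adj (\<phi> f n)) \<longlonglongrightarrow> 0
        \<and> (\<forall>c. (\<lambda>n. \<phi> (\<lambda>h. c * f h) n - cscale c (\<phi> f n)) \<longlonglongrightarrow> 0))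
     \<and> (\<forall>f f'. continuous_on UNIV f \<and> continuous_on UNIV f' \<longrightarrow>
        (\<lambda>n. \<phi> (\<lambda>h. f h + f' h) n - (\<phi> f n + \<phi> f' n)) \<longlonglongrightarrow> 0
        \<and> (\<lambda>n. \<phi> (\<lambda>h. f h * f' h) n - \<phi> f n * \<phi> f' n) \<longlonglongrightarrow> 0)
     \<and> (\<lambda>n. \<phi> (\<lambda>h. 1) n - 1) \<longlonglongrightarrow> 0"
    using assms(3) unfolding rokhlin_def by blast
  have "rokhlin_map \<alpha> \<phi>"
    by unfold_locales (use assms(1,2) \<phi> in \<open>simp_all\<close>)
  then show ?thesis by (rule that)
qed

lemma (in compact_action) cu_pos_fixed:
  assumes "a \<in> cu_pos (fixed_points \<alpha>)" shows "a i j \<in> fixed_points \<alpha>"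
proof -
  obtain c where c: "c \<in> stab (fixed_points \<alpha>)" "a = mmult (madj c) c" using assms by (auto simp: cu_pos_def)
  obtain C where C: "mat_bound c C" using stab_bounded[OF c(1)] by blast
  have lim: "(\<lambda>n. \<Sum>k<n. adj (c k i) * c k j) \<longlonglongrightarrow> a i j"
    unfolding c(2) using mmult_madj_tendsto[OF C C] c(1) by blast
  have inv: "\<alpha> g (c k l) = c k l" for g k l using c(1) by (simp add: stab_def fixed_points_def)
  have "\<alpha> g (a i j) = a i j" for g
  proof -
    have "(\<lambda>n. \<alpha> g (\<Sum>k<n. adj (c k i) * c k j)) \<longlonglongrightarrow> \<alpha> g (a i j)" by (intro tendsto_intros lim)
    then have "(\<lambda>n. \<Sum>k<n. adj (c k i) * c k j) \<longlonglongrightarrow> \<alpha> g (a i j)"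
      by (simp add: act_sum act_mult act_adj inv)
    then show ?thesis using lim by (rule LIMSEQ_unique)
  qed
  then show ?thesis by (simp add: fixed_points_def)
qed

text \<open>The four quarters of \<open>e\<close> pay for the passage to a finite corner, the error
  of the given \<open>v k\<close>, the replacement by fixed entries, and the tail of
  \<open>a\<close> outside the corner.\<close>

lemma (in rokhlin_map) fixed_subequivalence_step:
  assumes a: "a \<in> cu_pos (fixed_points \<alpha>)" and b: "b \<in> cu_pos (fixed_points \<alpha>)"
    and ab: "cuntz_le UNIV a b" and e: "e > 0"
  obtains w where "w \<in> stab (fixed_points \<alpha>)"
    "mat_bound (\<lambda>i j. mmult (mmult (madj w) b) w i j - a i j) e"
proof -
  obtain v where v: "\<And>k. v k \<in> stab UNIV"
      "(\<lambda>k. mnorm (\<lambda>i j. mmult (mmult (madj (v k)) b) (v k) i j - a i j)) \<longlonglongrightarrow> 0"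
    using ab unfolding cuntz_le_def by blast
  have e4: "e / 4 > 0" using e by simp
  obtain k where k: "mnorm (\<lambda>i j. mmult (mmult (madj (v k)) b) (v k) i j - a i j) < e / 4"
    using order_tendstoD(2)[OF v(2) e4] eventually_happens'[OF sequentially_bot] by blast
  define u where "u = v k"
  have u: "u \<in> stab UNIV" unfolding u_def by (rule v)
  define R where "R = (\<lambda>i j. mmult (mmult (madj u) b) u i j - a i j)"
  obtain A B C where A: "mat_bound a A" and B: "mat_bound b B" and C: "mat_bound u C"
    using cu_pos_bounded[OF a] cu_pos_bounded[OF b] stab_bounded[OF u] by metis
  have "mat_bound (madj (mmult (madj u) b)) (C * B)"
    using mat_bound_mmult_madj[OF C B] u by (blast intro: mat_bound_madj)
  from mat_bound_mmult_madj[OF this C] have "mat_bound (mmult (mmult (madj u) b) u) (C * B * C)"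
    using u by (metis madj_madj)
  then have "mat_bound R (C * B * C + A)"
    unfolding R_def using A by (simp add: mat_bound_def op_bound_diff)
  then have R: "op_bound n n R (e / 4)" for n
    using op_bound_mono[OF mat_bound_mnorm(1)] k unfolding R_def u_def by (meson less_imp_le)
  obtain N1 where N1: "\<And>n. n \<ge> N1 \<Longrightarrow> op_bound n n (\<lambda>i j. sandwich n u b i j - mmult (mmult (madj u) b) u i j) (e / 4)"
    using sandwich_approx[OF u B e4] by blast
  obtain N2 where N2: "\<And>m. m \<ge> N2 \<Longrightarrow> mat_bound (\<lambda>i j. a i j - trunc m a i j) (e / 4)"
    using cu_pos_tail[OF a e4] by blast
  define N where "N = max N1 N2"
  have uN: "op_bound N N (\<lambda>i j. sandwich N u b i j - a i j) (e / 4 + e / 4)"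
    using op_bound_add[OF N1 R, of N] by (simp add: R_def N_def)
  obtain w where w: "\<And>i j. w i j \<in> fixed_points \<alpha>"
      "op_bound N N (\<lambda>i j. sandwich N w b i j - a i j) (e / 4 + e / 4 + e / 4)"
    using fixed_sandwich_exists[OF cu_pos_fixed[OF b] cu_pos_fixed[OF a] uN e4] by blast
  \<comment> \<open>Truncation puts the matrix into \<open>stab\<close>, leaves the sandwich
    unchanged inside the corner and makes the product vanish outside it.\<close>
  define t where "t = trunc N w"
  have t0: "t i j = 0" if "\<not> (i < N \<and> j < N)" for i j using that by (auto simp: t_def trunc_def)
  have st: "sandwich N t b i j = sandwich N w b i j" if "i < N" "j < N" for i j
    using that by (simp add: sandwich_def t_def trunc_def)
  have z: "mmult (mmult (madj t) b) t = trunc N (sandwich N t b)"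
    by (rule sandwich_zero_extend) (rule t0)
  have "0 \<in> fixed_points \<alpha>" by (simp add: fixed_points_def)
  then have "t i j \<in> fixed_points \<alpha>" for i j using w(1) by (simp add: t_def trunc_def)
  then have "t \<in> stab (fixed_points \<alpha>)" using t0 by (rule finite_matrix_in_stab)
  moreover have "mat_bound (\<lambda>i j. mmult (mmult (madj t) b) t i j - a i j) e"
  proof -
    have "op_bound r s (\<lambda>i j. mmult (mmult (madj t) b) t i j - a i j) e" for r s
    proof -
      have 1: "op_bound r s (\<lambda>i j. if i < N \<and> j < N then sandwich N w b i j - a i j else 0) (e / 4 + e / 4 + e / 4)"
        by (rule op_bound_zero_extend[OF w(2)])
      have 2: "op_bound r s (\<lambda>i j. a i j - trunc N a i j) (e / 4)"
        using N2[of N] by (simp add: N_def mat_bound_def)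
      \<comment> \<open>Inside the corner the error is that of the finite sandwich; outside it is
        minus the tail of \<open>a\<close>.\<close>
      have "mmult (mmult (madj t) b) t i j - a i j =
          (if i < N \<and> j < N then sandwich N w b i j - a i j else 0) - (a i j - trunc N a i j)" for i j
        unfolding z by (simp add: trunc_def st)
      then have "(\<lambda>i j. mmult (mmult (madj t) b) t i j - a i j) =
          (\<lambda>i j. (if i < N \<and> j < N then sandwich N w b i j - a i j else 0) - (a i j - trunc N a i j))"
        by (intro ext)
      then show ?thesis using op_bound_diff[OF 1 2] by (simp only:) simp
    qed
    then show ?thesis by (simp add: mat_bound_def)
  qed
  ultimately show ?thesis by (rule that)
qed

theorem theorem3p16:
  fixes \<alpha> :: "'g::{t2_space, second_countable_topology, group_add} \<Rightarrow> 'a::cstar_algebra \<Rightarrow> 'a"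
    and a b :: "'a mat"
  assumes "separable_type TYPE('a)"
    and "compact_group TYPE('g)"
    and "cstar_action \<alpha>"
    and "rokhlin \<alpha>"
    and "a \<in> cu_pos (fixed_points \<alpha>)" and "b \<in> cu_pos (fixed_points \<alpha>)"
    and "cuntz_le UNIV a b"
  shows "cuntz_le (fixed_points \<alpha>) a b"
proof -
  obtain \<phi> where "rokhlin_map \<alpha> \<phi>" using rokhlin_map_exists[OF assms(2-4)] by blast
  then interpret rokhlin_map \<alpha> \<phi> .
  let ?D = "\<lambda>w i j. mmult (mmult (madj w) b) w i j - a i j"
  have "\<exists>w. w \<in> stab (fixed_points \<alpha>) \<and> mat_bound (?D w) (inverse (real (Suc k)))" for k
  proof -
    have "inverse (real (Suc k)) > 0" by simp
    from fixed_subequivalence_step[OF assms(5-7) this] show ?thesis by blast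
  qed
  then obtain w where w: "\<And>k. w k \<in> stab (fixed_points \<alpha>)"
      "\<And>k. mat_bound (?D (w k)) (inverse (real (Suc k)))" by metis
  have "(\<lambda>k. mnorm (?D (w k))) \<longlonglongrightarrow> 0"
  proof (rule Lim_null_comparison[OF always_eventually LIMSEQ_inverse_real_of_nat], rule allI)
    fix k
    show "norm (mnorm (?D (w k))) \<le> inverse (real (Suc k))"
      using mnorm_le[OF w(2)] mat_bound_mnorm(2)[OF w(2)] by simp
  qed
  then show ?thesis unfolding cuntz_le_def using w(1) by blast
qed

end
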